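(* Let $X$ and $Y$ be metric spaces. Assume that $A(X)$ satisfies one of the following: (a) $A(X)$ is a sublattice of $C(X)$ that separates points from closed sets and contains the constants, and either (i) $A(X)=A^{\mathrm{loc}}(X)$ or $A(X)=A^{\mathrm{loc}}_b(X)$; or (ii) $X$ is complete and $A(X)=\mathrm{Lip}(X)$ or $\mathrm{Lip}_b(X)$; or (iii) $A(X)=\mathrm{lip}(X)$ or $\mathrm{lip}_b(X)$, where $X$ is complete with metric $d$ such that $d=D^\alpha$ for some metric $D$ on $X$ and some $0<\alpha<1$; (b) $A(X)=C^p(X)$ or $C^p_b(X)$, where $X$ is an open set in a real Banach space $E$ that supports a $C^p$ bump function ($p\in\mathbb{N}\cup\{\infty\}$). Assume that $A(Y)$ likewise satisfies one of these conditions (with $Y$ in place of $X$). If $T:A(X)\to A(Y)$ is a linear order isomorphism, then there is a homeomorphism $h:X\to Y$ such that $Tf=T1_X\cdot(f\circ h^{-1})$ and $T^{-1}g = T^{-1}1_Y\cdot(g\circ h)$ for all $f\in A(X)$ and $g\in A(Y)$.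
   Context: All functions are real-valued; $1_X$ is the constant $1$. A sublattice of $C(X)$ is a subspace closed under pointwise max and min. $A(X)$ separates points from closed sets if for every $x\in X$ and closed $F\not\ni x$ there is $f\in A(X)$ with $f(x)=1$, $f=0$ on $F$. $A^{\mathrm{loc}}(X)$ is the space of real functions $f$ on $X$ such that every $x_0\in X$ has a neighborhood $U$ and some $g\in A(X)$ with $f=g$ on $U$; a subscript $b$ denotes the subspace of bounded functions. $\mathrm{Lip}(X)$ is the space of real functions $f$ on the metric space $(X,d)$ with $\sup_{x\ne y}|f(x)-f(y)|/d(x,y)<\infty$; $\mathrm{lip}(X)$ is the set of $f\in\mathrm{Lip}(X)$ with $\lim_{t\to0}\sup\{|f(x)-f(y)|/t: 0<d(x,y)<t\}=0$. $C^p(X)$ is the space of $p$ times continuously (Fréchet) differentiable real functions on $X$; $E$ supports a $C^p$ bump function if there is $\varphi\in C^p(E)$ with $\varphi(0)\neq0$ and bounded support. A linear bijection $T$ is an order isomorphism if $f\ge 0\iff Tf\ge0$. *)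

theory Defs
  imports "HOL-Analysis.Analysis" "HOL-Library.Extended_Nat"
begin

definition is_subspace_fun :: "('a \<Rightarrow> real) set \<Rightarrow> bool" where
  "is_subspace_fun A \<longleftrightarrow> (\<lambda>_. 0) \<in> A \<and>
     (\<forall>f\<in>A. \<forall>g\<in>A. (\<lambda>x. f x + g x) \<in> A) \<and>
     (\<forall>c. \<forall>f\<in>A. (\<lambda>x. c * f x) \<in> A)"

definition is_sublattice_C :: "('a::topological_space \<Rightarrow> real) set \<Rightarrow> bool" where
  "is_sublattice_C A \<longleftrightarrow> (\<forall>f\<in>A. continuous_on UNIV f) \<and> is_subspace_fun A \<and>
     (\<forall>f\<in>A. \<forall>g\<in>A. (\<lambda>x. max (f x) (g x)) \<in> A \<and> (\<lambda>x. min (f x) (g x)) \<in> A)"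

definition separates_points_closed :: "('a::topological_space \<Rightarrow> real) set \<Rightarrow> bool" where
  "separates_points_closed A \<longleftrightarrow>
     (\<forall>x F. closed F \<and> x \<notin> F \<longrightarrow> (\<exists>f\<in>A. f x = 1 \<and> (\<forall>y\<in>F. f y = 0)))"

definition contains_constants :: "('a \<Rightarrow> real) set \<Rightarrow> bool" where
  "contains_constants A \<longleftrightarrow> (\<forall>c. (\<lambda>_. c) \<in> A)"

definition bounded_funs :: "('a \<Rightarrow> real) set" where
  "bounded_funs = {f. bounded (range f)}"

definition Aloc :: "('a::topological_space \<Rightarrow> real) set \<Rightarrow> ('a \<Rightarrow> real) set" where
  "Aloc A = {f. \<forall>x0. \<exists>U. open U \<and> x0 \<in> U \<and> (\<exists>g\<in>A. \<forall>x\<in>U. f x = g x)}"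

definition Lip_funs :: "('a::metric_space \<Rightarrow> real) set" where
  "Lip_funs = {f. \<exists>L. \<forall>x y. x \<noteq> y \<longrightarrow> \<bar>f x - f y\<bar> / dist x y \<le> L}"

definition lip_funs :: "('a::metric_space \<Rightarrow> real) set" where
  "lip_funs = {f. f \<in> Lip_funs \<and>
     (\<forall>\<epsilon>>0. \<exists>\<delta>>0. \<forall>t. 0 < t \<and> t < \<delta> \<longrightarrow>
        (\<forall>x y. 0 < dist x y \<and> dist x y < t \<longrightarrow> \<bar>f x - f y\<bar> / t \<le> \<epsilon>))}"

definition is_metric :: "('a \<Rightarrow> 'a \<Rightarrow> real) \<Rightarrow> bool" where
  "is_metric D \<longleftrightarrow> (\<forall>x y. 0 \<le> D x y) \<and> (\<forall>x y. D x y = 0 \<longleftrightarrow> x = y) \<and>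
     (\<forall>x y. D x y = D y x) \<and> (\<forall>x y z. D x z \<le> D x y + D y z)"

text \<open>k-linear bounded forms on E, represented as functions of a list of k vectors\<close>
definition multilin :: "nat \<Rightarrow> ('e::real_normed_vector list \<Rightarrow> real) \<Rightarrow> bool" where
  "multilin k m \<longleftrightarrow>
     (\<forall>us vs. length us + length vs + 1 = k \<longrightarrow> linear (\<lambda>v. m (us @ v # vs))) \<and>
     (\<exists>C. \<forall>vs. length vs = k \<longrightarrow> \<bar>m vs\<bar> \<le> C * prod_list (map norm vs))"

definition mnorm :: "nat \<Rightarrow> ('e::real_normed_vector list \<Rightarrow> real) \<Rightarrow> real" where
  "mnorm k m = Sup {\<bar>m vs\<bar> | vs. length vs = k \<and> (\<forall>v\<in>set vs. norm v \<le> 1)}"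

text \<open>g is p times continuously Frechet differentiable on the open set U;
  D k x is the k-th derivative at x (a bounded k-linear form), and
  D (k+1) x (h # vs) = (derivative of D k at x applied to h) vs.\<close>
definition Cp_on :: "enat \<Rightarrow> 'e::banach set \<Rightarrow> ('e \<Rightarrow> real) \<Rightarrow> bool" where
  "Cp_on p U g \<longleftrightarrow> (\<exists>D :: nat \<Rightarrow> 'e \<Rightarrow> 'e list \<Rightarrow> real.
     (\<forall>x\<in>U. D 0 x [] = g x) \<and>
     (\<forall>k. enat k \<le> p \<longrightarrow>
        (\<forall>x\<in>U. multilin k (D k x) \<and>
           ((\<lambda>y. mnorm k (\<lambda>vs. D k y vs - D k x vs)) \<longlongrightarrow> 0) (at x within U))) \<and>
     (\<forall>k. enat k < p \<longrightarrow>
        (\<forall>x\<in>U. ((\<lambda>h. mnorm k (\<lambda>vs. D k (x + h) vs - D k x vs - D (Suc k) x (h # vs)) / norm h)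
                    \<longlongrightarrow> 0) (at 0))))"

definition supports_Cp_bump :: "'e::banach itself \<Rightarrow> enat \<Rightarrow> bool" where
  "supports_Cp_bump E p \<longleftrightarrow>
     (\<exists>\<phi> :: 'e \<Rightarrow> real. Cp_on p UNIV \<phi> \<and> \<phi> 0 \<noteq> 0 \<and> bounded {x. \<phi> x \<noteq> 0})"

definition cond_a :: "('a::metric_space \<Rightarrow> real) set \<Rightarrow> bool" where
  "cond_a A \<longleftrightarrow> is_sublattice_C A \<and> separates_points_closed A \<and> contains_constants A \<and>
     ( (A = Aloc A \<or> A = Aloc A \<inter> bounded_funs)
     \<or> (complete (UNIV :: 'a::metric_space set) \<and> (A = Lip_funs \<or> A = Lip_funs \<inter> bounded_funs))
     \<or> (complete (UNIV :: 'a::metric_space set) \<and>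
          (\<exists>(D :: 'a \<Rightarrow> 'a \<Rightarrow> real) \<alpha>. is_metric D \<and> 0 < \<alpha> \<and> \<alpha> < 1 \<and> (\<forall>x y. dist x y = D x y powr \<alpha>)) \<and>
          (A = lip_funs \<or> A = lip_funs \<inter> bounded_funs)))"

text \<open>(b): X is (isometric, via e, to) an open set U of the real Banach space 'e
  which supports a C^p bump, and A is C^p(X) or C^p_b(X).\<close>
definition cond_b :: "'e::banach itself \<Rightarrow> ('a::metric_space \<Rightarrow> real) set \<Rightarrow> bool" where
  "cond_b E A \<longleftrightarrow> (\<exists>(e :: 'a \<Rightarrow> 'e) U p.
     open U \<and> bij_betw e UNIV U \<and> (\<forall>x y. dist x y = dist (e x) (e y)) \<and>
     supports_Cp_bump E p \<and>
     (A = {f. \<exists>g. Cp_on p U g \<and> f = g \<circ> e} \<or>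
      A = {f. \<exists>g. Cp_on p U g \<and> f = g \<circ> e} \<inter> bounded_funs))"

definition order_iso :: "('a \<Rightarrow> real) set \<Rightarrow> ('b \<Rightarrow> real) set \<Rightarrow> (('a \<Rightarrow> real) \<Rightarrow> ('b \<Rightarrow> real)) \<Rightarrow> bool" where
  "order_iso AX AY T \<longleftrightarrow> bij_betw T AX AY \<and>
     (\<forall>f\<in>AX. \<forall>g\<in>AX. T (\<lambda>x. f x + g x) = (\<lambda>y. T f y + T g y)) \<and>
     (\<forall>c. \<forall>f\<in>AX. T (\<lambda>x. c * f x) = (\<lambda>y. c * T f y)) \<and>
     (\<forall>f\<in>AX. (\<forall>x. f x \<ge> 0) \<longleftrightarrow> (\<forall>y. T f y \<ge> 0))"

end

(* Let u = T 1. Nonnegative f and g are disjoint iff no nonzero h in the space satisfies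
   0 <= h <= f and 0 <= h <= g, so T preserves disjointness of nonnegative functions. Hence f >= 0
   near a point where a small bump b is supported forces T f >= 0 wherever T b > 0. Given y0,
   pulling back ever smaller bumps at y0 yields a sequence (x_n) such that f(x_n) > 0 for infinitely
   many n implies T f(y0) >= 0. If a subsequence converges to x0, then T f(y0) = u(y0) f(x0) for all f.
   Otherwise take g = T^{-1} 1 + 1: completeness of X or the local nature of A(X) provides an f in
   A(X) that is at least 3g/4 at infinitely many x_n and at most g/4 at infinitely many others, so
   that 2/3 T g(y0) <= T f(y0) <= 1/3 T g(y0), contradicting T g(y0) >= 1.

   For C^p, the positive part is replaced by (f^2 + 1) exp(-1/f), extended by 0 to {f <= 0}, so all
   that is needed is that C^p is closed under products and composition with smooth real functions. *)

theory Submission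
  imports Defs
begin

section \<open>Order isomorphisms of adequate function spaces\<close>

text \<open>Every kind of space enters only through the locale below; completeness of the metric
  space, or locality of the function space, serves only to establish \<open>oscillation\<close>. The
  obstacle that shapes the argument is that the candidate points for \<open>y0\<close> need not
  cluster anywhere, and that \<open>T 1\<close> might a priori vanish at \<open>y0\<close>. If it
  did, comparing \<open>f\<close> with constants could never yield a contradiction, since constants
  would be sent to 0 there. Adding the preimage of the constant 1 produces a comparison function
  whose image is at least 1 everywhere. The price is that this function may be unbounded, so
  \<open>oscillation\<close> has to be proved relative to an arbitrary \<open>g \<ge> 1\<close> and
  not just for the levels 0 and 1. Strict positivity of the weight is a by-product, obtained from
  surjectivity once points have been matched.\<close>

locale adequate =
  fixes A :: "('a::metric_space \<Rightarrow> real) set"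
  assumes subspace: "is_subspace_fun A"
    and constants: "contains_constants A"
    and continuous: "f \<in> A \<Longrightarrow> continuous_on UNIV f"
    \<comment> \<open>The height 3 is a bound for e: the smooth bump is
      \<open>exp 1 * flat 1 (f y)\<close>, which may exceed its value 1 at \<open>x\<close>.\<close>
    and bump: "\<lbrakk>open U; x \<in> U\<rbrakk> \<Longrightarrow>
      \<exists>b\<in>A. b x = 1 \<and> (\<forall>y. 0 \<le> b y \<and> b y \<le> 3) \<and> (\<forall>y. y \<notin> U \<longrightarrow> b y = 0)"
    \<comment> \<open>The error \<open>\<epsilon>\<close> is the cost of a smooth substitute for
      \<open>max f 0\<close>; it disappears in a limit inside
      \<open>local_positivity\<close>.\<close>
    and almost_positive_part: "\<lbrakk>f \<in> A; \<epsilon> > 0\<rbrakk> \<Longrightarrow>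
      \<exists>k\<in>A. (\<forall>x. 0 \<le> k x \<and> f x \<le> \<epsilon> + k x) \<and> (\<forall>x. f x \<le> 0 \<longrightarrow> k x = 0)"
    and oscillation: "\<lbrakk>g \<in> A; \<And>x. g x \<ge> 1; \<nexists>l r. strict_mono (r::nat \<Rightarrow> nat) \<and> (X \<circ> r) \<longlonglongrightarrow> l\<rbrakk> \<Longrightarrow>
      \<exists>f\<in>A. (\<exists>\<^sub>\<infinity>n. f (X n) \<ge> 3/4 * g (X n)) \<and> (\<exists>\<^sub>\<infinity>n. f (X n) \<le> 1/4 * g (X n))"
begin

lemma add: "f \<in> A \<Longrightarrow> g \<in> A \<Longrightarrow> (\<lambda>x. f x + g x) \<in> A"
  using subspace by (simp add: is_subspace_fun_def)

lemma scale: "f \<in> A \<Longrightarrow> (\<lambda>x. c * f x) \<in> A"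
  using subspace by (simp add: is_subspace_fun_def)

lemma const: "(\<lambda>_. c) \<in> A"
  using constants by (simp add: contains_constants_def)

lemma diff: "f \<in> A \<Longrightarrow> g \<in> A \<Longrightarrow> (\<lambda>x. f x - g x) \<in> A"
  using add[of f "\<lambda>x. -1 * g x"] scale[of g "-1"] by simp

lemma open_greater: "f \<in> A \<Longrightarrow> open {x. f x > c}"
  using continuous[of f] by (intro open_Collect_less continuous_intros) auto

lemma tendsto: "f \<in> A \<Longrightarrow> X \<longlonglongrightarrow> l \<Longrightarrow> (\<lambda>n. f (X n)) \<longlonglongrightarrow> f l"
  by (rule continuous_on_tendsto_compose[OF continuous]) auto

lemma scaled_bump:
  assumes "open U" "x \<in> U" "c > 0"
  obtains b where "b \<in> A" "b x > 0" "\<And>y. 0 \<le> b y" "\<And>y. b y \<le> 3 * c" "\<And>y. y \<notin> U \<Longrightarrow> b y = 0"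
proof -
  obtain b where b: "b \<in> A" "b x = 1" "\<And>y. 0 \<le> b y \<and> b y \<le> 3" "\<And>y. y \<notin> U \<Longrightarrow> b y = 0"
    using bump[OF assms(1,2)] by blast
  show thesis
    by (rule that[of "\<lambda>x. c * b x"]) (use b assms in \<open>auto intro: scale\<close>)
qed

end

locale order_isomorphism = X: adequate AX + Y: adequate AY
  for AX :: "('a::metric_space \<Rightarrow> real) set" and AY :: "('b::metric_space \<Rightarrow> real) set" +
  fixes T :: "('a \<Rightarrow> real) \<Rightarrow> ('b \<Rightarrow> real)"
  assumes iso: "order_iso AX AY T"
begin

abbreviation "S \<equiv> inv_into AX T"

lemma T_in: "f \<in> AX \<Longrightarrow> T f \<in> AY"
  using iso by (auto simp: order_iso_def bij_betw_def)

lemma S_in: "g \<in> AY \<Longrightarrow> S g \<in> AX"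
  using iso by (metis bij_betw_def inv_into_into order_iso_def)

lemma TS: "g \<in> AY \<Longrightarrow> T (S g) = g"
  using iso by (metis bij_betw_inv_into_right order_iso_def)

lemma ST: "f \<in> AX \<Longrightarrow> S (T f) = f"
  using iso by (metis bij_betw_inv_into_left order_iso_def)

lemma T_add: "f \<in> AX \<Longrightarrow> g \<in> AX \<Longrightarrow> T (\<lambda>x. f x + g x) = (\<lambda>y. T f y + T g y)"
  using iso by (simp add: order_iso_def)

lemma T_scale: "f \<in> AX \<Longrightarrow> T (\<lambda>x. c * f x) = (\<lambda>y. c * T f y)"
  using iso by (simp add: order_iso_def)

lemma T_diff: "f \<in> AX \<Longrightarrow> g \<in> AX \<Longrightarrow> T (\<lambda>x. f x - g x) = (\<lambda>y. T f y - T g y)"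
  using T_add[of f "\<lambda>x. -1 * g x"] T_scale[of g "-1"] X.scale[of g "-1"] by simp

lemma T_const: "T (\<lambda>_. c) = (\<lambda>y. c * T (\<lambda>_. 1) y)"
  using T_scale[OF X.const[of 1], of c] by simp

lemma T_zero: "T (\<lambda>_. 0) = (\<lambda>_. 0)"
  using T_const[of 0] by simp

lemma T_nonneg_iff: "f \<in> AX \<Longrightarrow> (\<forall>x. f x \<ge> 0) \<longleftrightarrow> (\<forall>y. T f y \<ge> 0)"
  using iso by (simp add: order_iso_def)

lemma T_mono: "f \<in> AX \<Longrightarrow> g \<in> AX \<Longrightarrow> (\<And>x. f x \<le> g x) \<Longrightarrow> T f y \<le> T g y"
  using T_nonneg_iff[of "\<lambda>x. g x - f x"] X.diff[of g f] T_diff[of g f] by simp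

text \<open>The hypotheses are symmetric in \<open>T\<close> and \<open>S\<close>, so interpreting
  the locale at \<open>S\<close> makes every result about \<open>T\<close> available for the
  inverse.\<close>

lemma order_isomorphism_inverse: "order_isomorphism AY AX S"
proof (unfold_locales, unfold order_iso_def, intro conjI ballI allI)
  show "bij_betw S AY AX"
    using iso by (simp add: order_iso_def bij_betw_inv_into)
  show "S (\<lambda>x. f x + g x) = (\<lambda>y. S f y + S g y)" if "f \<in> AY" "g \<in> AY" for f g
    using ST[OF X.add[OF S_in S_in, OF that]] by (simp add: T_add S_in TS that)
  show "S (\<lambda>x. c * f x) = (\<lambda>y. c * S f y)" if "f \<in> AY" for c f
    using ST[OF X.scale[OF S_in, OF that]] by (simp add: T_scale S_in TS that)
  show "(\<forall>x. f x \<ge> 0) \<longleftrightarrow> (\<forall>y. S f y \<ge> 0)" if "f \<in> AY" for f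
    using T_nonneg_iff[OF S_in, OF that] TS[OF that] by simp
qed

lemma T_disjoint:
  assumes f: "f \<in> AX" "\<And>x. f x \<ge> 0" and g: "g \<in> AX" "\<And>x. g x \<ge> 0"
    and disj: "\<And>x. f x = 0 \<or> g x = 0" and "T f y > 0"
  shows "T g y = 0"
proof (rule ccontr)
  have nonneg: "T f z \<ge> 0" "T g z \<ge> 0" for z
    using T_nonneg_iff f g by blast+
  assume "T g y \<noteq> 0"
  \<comment> \<open>A bump with parameter \<open>c\<close> may reach height \<open>3 * c\<close>; a
    quarter of the minimum keeps \<open>3 * c\<close> strictly below both values at
    \<open>y\<close>.\<close>
  define c where "c = min (T f y) (T g y) / 4"
  have "c > 0"
    using \<open>T f y > 0\<close> \<open>T g y \<noteq> 0\<close> nonneg(2)[of y] by (auto simp: c_def)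
  define U where "U = {z. T f z > 3 * c} \<inter> {z. T g z > 3 * c}"
  have "open U"
    unfolding U_def by (intro open_Int Y.open_greater T_in f g)
  moreover have "y \<in> U"
    using \<open>c > 0\<close> by (auto simp: U_def c_def)
  ultimately obtain b where b: "b \<in> AY" "b y > 0" "\<And>z. 0 \<le> b z" "\<And>z. b z \<le> 3 * c"
      "\<And>z. z \<notin> U \<Longrightarrow> b z = 0"
    using Y.scaled_bump[OF _ _ \<open>c > 0\<close>] by metis
  have "b z \<le> T f z" "b z \<le> T g z" for z
    using b(4)[of z] b(5)[of z] nonneg[of z] by (auto simp: U_def) fastforce+
  interpret inv: order_isomorphism AY AX S
    by (rule order_isomorphism_inverse)
  have "S b x \<le> f x" "S b x \<le> g x" "S b x \<ge> 0" for x
    using inv.T_mono[OF b(1) T_in[OF f(1)]] inv.T_mono[OF b(1) T_in[OF g(1)]]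
      inv.T_nonneg_iff[OF b(1)] \<open>\<And>z. b z \<le> T f z\<close> \<open>\<And>z. b z \<le> T g z\<close> b(3)
    by (auto simp: ST f g)
  then have "S b = (\<lambda>_. 0)"
    using disj by (intro ext) (metis order_antisym)
  then have "b = (\<lambda>_. 0)"
    using TS[OF b(1)] T_zero by metis
  with b(2) show False by simp
qed

text \<open>The substitute for a point corresponding to \<open>y0\<close>: such a point need not exist for a single
  \<open>\<delta>\<close>, but along \<open>\<delta> \<rightarrow> 0\<close> the points \<open>x\<close> found here can only converge to it.\<close>

lemma local_positivity:
  assumes "\<delta> > 0"
  shows "\<exists>x. \<forall>f\<in>AX. f x > 0 \<longrightarrow> (\<exists>y\<in>ball y0 \<delta>. T f y \<ge> 0)"
proof -
  interpret inv: order_isomorphism AY AX S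
    by (rule order_isomorphism_inverse)
  obtain g where g: "g \<in> AY" "g y0 > 0" "\<And>y. 0 \<le> g y" "\<And>y. y \<notin> ball y0 \<delta> \<Longrightarrow> g y = 0"
    using Y.scaled_bump[of "ball y0 \<delta>" y0 1] \<open>\<delta> > 0\<close> by (metis centre_in_ball open_ball zero_less_one)
  have nonneg: "S g x \<ge> 0" for x
    using inv.T_nonneg_iff g by blast
  have "\<exists>x. S g x \<noteq> 0"
  proof (rule ccontr)
    assume "\<nexists>x. S g x \<noteq> 0"
    then have "S g = (\<lambda>_. 0)" by auto
    then show False
      using TS[OF g(1)] T_zero g(2) by (metis less_irrefl)
  qed
  then obtain x where x: "S g x > 0"
    using nonneg by (metis order_less_le)
  show ?thesis
  proof (intro exI[of _ x] ballI impI)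
    fix f assume f: "f \<in> AX" "f x > 0"
    \<comment> \<open>On \<open>W\<close> the function \<open>S g\<close> exceeds half its value at
      \<open>x\<close>, and parameter \<open>S g x / 6\<close> keeps the bump below that half. Hence
      \<open>b \<le> S g\<close>, so \<open>T b \<le> g\<close> and \<open>T b\<close> can be
      positive only inside the ball.\<close>
    define W where "W = {z. f z > 0} \<inter> {z. S g z > S g x / 2}"
    have W: "open W" "x \<in> W"
      unfolding W_def by (intro open_Int X.open_greater S_in g f) (use f x in auto)
    obtain b where b: "b \<in> AX" "b x > 0" "\<And>z. 0 \<le> b z" "\<And>z. b z \<le> S g x / 2"
        "\<And>z. z \<notin> W \<Longrightarrow> b z = 0"
      using X.scaled_bump[OF W, of "S g x / 6"] x by auto
    have "b z \<le> S g z" for z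
      using b(4)[of z] b(5)[of z] nonneg[of z] by (auto simp: W_def) fastforce
    then have Tb: "T b y \<le> g y" for y
      using T_mono[OF b(1) S_in[OF g(1)]] TS[OF g(1)] by simp
    have Tb0: "T b y \<ge> 0" for y
      using T_nonneg_iff[OF b(1)] b(3) by blast
    have "\<exists>y. T b y \<noteq> 0"
    proof (rule ccontr)
      assume "\<nexists>y. T b y \<noteq> 0"
      then have "T b = (\<lambda>_. 0)" by auto
      then show False
        using ST[OF b(1)] inv.T_zero b(2) by (metis less_irrefl)
    qed
    then obtain y where y: "T b y > 0"
      using Tb0 by (metis order_less_le)
    then have "y \<in> ball y0 \<delta>"
      using Tb[of y] g(4)[of y] by fastforce
    moreover have "T f y \<ge> - \<epsilon> * T (\<lambda>_. 1) y" if "\<epsilon> > 0" for \<epsilon>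
    proof -
      have "(\<lambda>x. - f x) \<in> AX"
        using X.scale[OF f(1), of "-1"] by simp
      from X.almost_positive_part[OF this that] obtain k where k: "k \<in> AX"
        "\<And>x. 0 \<le> k x" "\<And>x. - f x \<le> \<epsilon> + k x" "\<And>x. - f x \<le> 0 \<Longrightarrow> k x = 0"
        by blast
      \<comment> \<open>\<open>b\<close> lives where \<open>f > 0\<close>, and there the approximate
        positive part \<open>k\<close> of \<open>-f\<close> vanishes.\<close>
      have "b z = 0 \<or> k z = 0" for z
        using b(5)[of z] k(4)[of z] by (cases "f z > 0") (auto simp: W_def)
      then have "T k y = 0"
        using T_disjoint[OF b(1,3) k(1,2) _ y] by blast
      moreover have "T (\<lambda>x. - \<epsilon> - k x) y \<le> T f y"
      proof (intro T_mono X.diff X.const k f)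
        show "- \<epsilon> - k x \<le> f x" for x
          using k(3)[of x] by linarith
      qed
      ultimately show ?thesis
        using T_diff[OF X.const[of "-\<epsilon>"] k(1)] T_const[of "-\<epsilon>"] by simp
    qed
    have "T f y \<ge> 0"
    proof (rule ccontr)
      assume neg: "\<not> T f y \<ge> 0"
      have u: "T (\<lambda>_. 1) y \<ge> 0"
        using T_nonneg_iff[OF X.const[of 1]] by simp
      \<comment> \<open>The weight at \<open>y\<close> may still be 0 here, hence the added 1 in the
        denominator. With this choice the lower bound for \<open>T f y\<close> is at least
        \<open>T f y / 2\<close>, impossible for a negative number.\<close>
      define \<epsilon> where "\<epsilon> = - T f y / (2 * (T (\<lambda>_. 1) y + 1))"
      have "\<epsilon> > 0"
        using neg u by (auto simp: \<epsilon>_def intro!: divide_neg_pos)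
      moreover have "\<epsilon> * (T (\<lambda>_. 1) y + 1) = - T f y / 2"
        using u by (simp add: \<epsilon>_def field_simps)
      ultimately show False
        using \<open>\<And>\<epsilon>. \<epsilon> > 0 \<Longrightarrow> T f y \<ge> - \<epsilon> * T (\<lambda>_. 1) y\<close>[of \<epsilon>] neg by (simp add: algebra_simps)
    qed
    ultimately show "\<exists>y\<in>ball y0 \<delta>. T f y \<ge> 0" by blast
  qed
qed

section \<open>Points matched by the weight formula\<close>

text \<open>The weight is allowed to be 0 in the relation itself; \<open>paired_weight_pos\<close>
  derives its positivity.\<close>

definition paired :: "'a \<Rightarrow> 'b \<Rightarrow> bool" where
  "paired x y \<longleftrightarrow> (\<forall>f\<in>AX. T f y = T (\<lambda>_. 1) y * f x)"

text \<open>Subtracting the constant \<open>f x - \<epsilon>\<close> makes any \<open>f\<close>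
  positive at \<open>x\<close>, so the hypothesis gives one inequality up to a multiple of
  \<open>\<epsilon>\<close>; applied to \<open>-f\<close> it gives the reverse one.\<close>

lemma pairedI:
  assumes "\<And>f. f \<in> AX \<Longrightarrow> f x > 0 \<Longrightarrow> T f y \<ge> 0"
  shows "paired x y"
  unfolding paired_def
proof (intro ballI)
  have le: "T (\<lambda>_. 1) y * f x \<le> T f y" if f: "f \<in> AX" for f
  proof (rule field_le_epsilon)
    fix e :: real assume "e > 0"
    have u: "T (\<lambda>_. 1) y \<ge> 0"
      using T_nonneg_iff[OF X.const[of 1]] by simp
    define \<epsilon> where "\<epsilon> = e / (T (\<lambda>_. 1) y + 1)"
    have "\<epsilon> > 0" "\<epsilon> * T (\<lambda>_. 1) y \<le> e"
      using u \<open>e > 0\<close> by (auto simp: \<epsilon>_def field_simps)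
    have "0 \<le> T (\<lambda>z. f z - (f x - \<epsilon>)) y"
      using \<open>\<epsilon> > 0\<close> by (intro assms X.diff X.const f) simp
    also have "\<dots> = T f y - (f x - \<epsilon>) * T (\<lambda>_. 1) y"
      using T_diff[OF f X.const] T_const[of "f x - \<epsilon>"] by simp
    finally show "T (\<lambda>_. 1) y * f x \<le> T f y + e"
      using \<open>\<epsilon> * T (\<lambda>_. 1) y \<le> e\<close> by (simp add: algebra_simps)
  qed
  fix f assume f: "f \<in> AX"
  have "T (\<lambda>_. 1) y * - f x \<le> - T f y"
    using le[OF X.scale[OF f, of "-1"]] T_scale[OF f, of "-1"] by simp
  with le[OF f] show "T f y = T (\<lambda>_. 1) y * f x" by simp
qed

lemma ex_paired: "\<exists>x. paired x y0"
proof -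
  have "\<exists>X. \<forall>n. \<forall>f\<in>AX. f (X n) > 0 \<longrightarrow> (\<exists>y\<in>ball y0 (inverse (real (Suc n))). T f y \<ge> 0)"
    by (intro choice allI local_positivity) simp
  then obtain X where X: "\<And>n f. f \<in> AX \<Longrightarrow> f (X n) > 0 \<Longrightarrow>
      \<exists>y\<in>ball y0 (inverse (real (Suc n))). T f y \<ge> 0"
    by metis
  \<comment> \<open>A negative value at \<open>y0\<close> persists on a ball, while a large
    \<open>n\<close> with \<open>f (X n) > 0\<close> puts a point where \<open>T f\<close> is
    nonnegative into that ball.\<close>
  have limit: "T f y0 \<ge> 0" if f: "f \<in> AX" and inf: "\<exists>\<^sub>\<infinity>n. f (X n) > 0" for f
  proof (rule ccontr)
    assume "\<not> T f y0 \<ge> 0"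
    then have "open {y. T f y < 0}" "y0 \<in> {y. T f y < 0}"
      using Y.continuous[OF T_in[OF f]] by (auto intro!: open_Collect_less continuous_intros)
    then obtain \<delta> where "\<delta> > 0" and \<delta>: "ball y0 \<delta> \<subseteq> {y. T f y < 0}"
      by (meson openE)
    obtain N where N: "inverse (real (Suc N)) < \<delta>"
      using reals_Archimedean[OF \<open>\<delta> > 0\<close>] by blast
    obtain n where n: "n > N" "f (X n) > 0"
      using inf unfolding INFM_nat by blast
    then obtain y where y: "y \<in> ball y0 (inverse (real (Suc n)))" "T f y \<ge> 0"
      using X[OF f] by blast
    have "inverse (real (Suc n)) \<le> inverse (real (Suc N))"
      using n(1) by (simp add: field_simps)
    then have "y \<in> ball y0 \<delta>"
      using y(1) N unfolding mem_ball by linarith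
    with \<delta> y(2) show False by force
  qed
  show ?thesis
  proof (cases "\<exists>l r. strict_mono (r::nat \<Rightarrow> nat) \<and> (X \<circ> r) \<longlonglongrightarrow> l")
    case True
    then obtain l and r :: "nat \<Rightarrow> nat" where r: "strict_mono r" "(X \<circ> r) \<longlonglongrightarrow> l" by blast
    have "paired l y0"
    proof (intro pairedI limit)
      fix f assume f: "f \<in> AX" "f l > 0"
      have "(\<lambda>n. f ((X \<circ> r) n)) \<longlonglongrightarrow> f l"
        by (rule X.tendsto[OF f(1) r(2)])
      then have "eventually (\<lambda>n. f (X (r n)) > 0) sequentially"
        using f(2) order_tendstoD(1) by fastforce
      then obtain N where N: "\<And>n. n \<ge> N \<Longrightarrow> f (X (r n)) > 0"
        by (auto simp: eventually_sequentially)
      show "\<exists>\<^sub>\<infinity>n. f (X n) > 0"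
        unfolding INFM_nat_le
        by (metis N seq_suble[OF r(1)] nle_le order_trans)
    qed
    then show ?thesis by blast
  next
    case False
    interpret inv: order_isomorphism AY AX S
      by (rule order_isomorphism_inverse)
    define g where "g = (\<lambda>x. S (\<lambda>_. 1) x + 1)"
    have g: "g \<in> AX"
      unfolding g_def by (intro X.add S_in X.const Y.const)
    have Tg: "T g y = 1 + T (\<lambda>_. 1) y" for y
      unfolding g_def using T_add[OF S_in[OF Y.const[of 1]] X.const[of 1]] TS[OF Y.const[of 1]] by simp
    have "g x \<ge> 1" for x
      unfolding g_def using inv.T_nonneg_iff[OF Y.const[of 1]] by simp
    from X.oscillation[OF g this False] obtain f where f: "f \<in> AX"
      "\<exists>\<^sub>\<infinity>n. f (X n) \<ge> 3/4 * g (X n)" "\<exists>\<^sub>\<infinity>n. f (X n) \<le> 1/4 * g (X n)"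
      by blast
    have pos: "g x > 0" for x
      using \<open>\<And>x. g x \<ge> 1\<close>[of x] by simp
    \<comment> \<open>Both comparisons leave a margin of \<open>g (X n) / 12\<close>, which turns
      the weak inequalities from \<open>oscillation\<close> into the strict ones that
      \<open>limit\<close> demands.\<close>
    have "T (\<lambda>x. f x - 2/3 * g x) y0 \<ge> 0"
    proof (rule limit)
      show "\<exists>\<^sub>\<infinity>n. f (X n) - 2/3 * g (X n) > 0"
      proof (rule INFM_mono[OF f(2)])
        fix n assume "f (X n) \<ge> 3/4 * g (X n)"
        then show "f (X n) - 2/3 * g (X n) > 0" using pos[of "X n"] by simp
      qed
    qed (intro X.diff X.scale f g)
    moreover have "T (\<lambda>x. 1/3 * g x - f x) y0 \<ge> 0"
    proof (rule limit)
      show "\<exists>\<^sub>\<infinity>n. 1/3 * g (X n) - f (X n) > 0"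
      proof (rule INFM_mono[OF f(3)])
        fix n assume "f (X n) \<le> 1/4 * g (X n)"
        then show "1/3 * g (X n) - f (X n) > 0" using pos[of "X n"] by simp
      qed
    qed (intro X.diff X.scale f g)
    ultimately have "T f y0 \<ge> 2/3 * T g y0" "T f y0 \<le> 1/3 * T g y0"
      using T_diff[OF f(1) X.scale[OF g, of "2/3"]] T_diff[OF X.scale[OF g, of "1/3"] f(1)]
        T_scale[OF g, of "2/3"] T_scale[OF g, of "1/3"] by auto
    moreover have "T g y0 > 0"
      using Tg[of y0] T_nonneg_iff[OF X.const[of 1]] by (simp add: add_pos_nonneg)
    ultimately show ?thesis by simp
  qed
qed

text \<open>A vanishing weight would make every function in the image vanish at \<open>y\<close>,
  including the constant 1.\<close>

lemma paired_weight_pos: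
  assumes "paired x y"
  shows "T (\<lambda>_. 1) y > 0"
proof -
  have "T (\<lambda>_. 1) y * S (\<lambda>_. 1) x = 1"
    using assms S_in[OF Y.const[of 1]] TS[OF Y.const[of 1]] by (metis paired_def)
  moreover have "T (\<lambda>_. 1) y \<ge> 0"
    using T_nonneg_iff[OF X.const[of 1]] by simp
  ultimately show ?thesis
    by (metis less_eq_real_def mult_zero_left zero_neq_one)
qed

text \<open>The pairing applied to \<open>S g\<close> reads \<open>T 1 y * S g x = g y\<close>; the
  case \<open>g = 1\<close> shows that the weights of \<open>T\<close> at \<open>y\<close> and of
  \<open>S\<close> at \<open>x\<close> are reciprocal.\<close>

lemma paired_inverse:
  assumes "paired x y"
  shows "order_isomorphism.paired AY S y x"
proof -
  interpret inv: order_isomorphism AY AX S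
    by (rule order_isomorphism_inverse)
  have eq: "T (\<lambda>_. 1) y * S g x = g y" if "g \<in> AY" for g
    using assms S_in[OF that] TS[OF that] by (metis paired_def)
  have "S g x = S (\<lambda>_. 1) x * g y" if "g \<in> AY" for g
    using eq[OF that, symmetric] eq[OF Y.const[of 1]] by (simp add: mult.left_commute)
  then show ?thesis
    by (simp add: inv.paired_def)
qed

lemma paired_left_unique:
  assumes "paired x y" "paired x' y"
  shows "x = x'"
proof (rule ccontr)
  assume "x \<noteq> x'"
  then obtain b where b: "b \<in> AX" "b x = 1" "b x' = 0"
    using X.bump[of "- {x'}" x] by auto
  then have "T (\<lambda>_. 1) y * 1 = T (\<lambda>_. 1) y * 0"
    using assms by (metis paired_def)
  then show False
    using paired_weight_pos[OF assms(1)] by simp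
qed

text \<open>For a bump \<open>g\<close> in \<open>V\<close>, the continuous function
  \<open>S g\<close> is a positive weight times \<open>g \<circ> h\<close>, so its positivity set is
  an open neighborhood of \<open>x\<close> inside the preimage of \<open>V\<close>.\<close>

lemma paired_continuous:
  assumes h: "\<And>x. paired x (h x)"
  shows "continuous_on UNIV h"
proof (subst continuous_on_open_invariant, intro allI impI)
  interpret inv: order_isomorphism AY AX S
    by (rule order_isomorphism_inverse)
  fix V :: "'b set" assume "open V"
  show "\<exists>A. open A \<and> A \<inter> UNIV = h -` V \<inter> UNIV"
  proof (intro exI conjI)
    show "open (h -` V)"
    proof (subst open_subopen, intro ballI)
      fix x assume "x \<in> h -` V"
      then obtain g where g: "g \<in> AY" "g (h x) = 1" "\<And>y. y \<notin> V \<Longrightarrow> g y = 0"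
        using Y.bump[OF \<open>open V\<close>, of "h x"] by auto
      have eq: "S g z = S (\<lambda>_. 1) z * g (h z)" for z
        using paired_inverse[OF h] g(1) by (simp add: inv.paired_def)
      have "S g x > 0"
        using eq[of x] g(2) inv.paired_weight_pos[OF paired_inverse[OF h]] by simp
      moreover have "{z. S g z > 0} \<subseteq> h -` V"
        using eq g(3) by fastforce
      ultimately show "\<exists>W. open W \<and> x \<in> W \<and> W \<subseteq> h -` V"
        using X.open_greater[OF S_in[OF g(1)]] by blast
    qed
  qed simp
qed

lemma weighted_composition:
  "\<exists>h k. homeomorphism UNIV UNIV h k \<and>
     (\<forall>f\<in>AX. T f = (\<lambda>y. T (\<lambda>_. 1) y * f (k y))) \<and>
     (\<forall>g\<in>AY. S g = (\<lambda>x. S (\<lambda>_. 1) x * g (h x)))"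
proof -
  interpret inv: order_isomorphism AY AX S
    by (rule order_isomorphism_inverse)
  \<comment> \<open>\<open>inv.S\<close> inverts the inverse; it is known to agree with
    \<open>T\<close> only on \<open>AX\<close>, which suffices because \<open>paired\<close> ranges
    over \<open>AX\<close>.\<close>
  have inv_paired: "paired x y" if "inv.paired y x" for x y
  proof -
    have "T f y = inv.S f y" if "f \<in> AX" for f
      using that by (metis ST T_in TS inv.ST)
    then show ?thesis
      using inv.paired_inverse[OF that] unfolding paired_def
        order_isomorphism.paired_def[OF inv.order_isomorphism_inverse]
      by (metis X.const)
  qed
  \<comment> \<open>\<open>k\<close> and \<open>h\<close> are chosen independently for the two
    directions; left uniqueness on each side forces them to be mutually inverse.\<close>
  obtain k where k: "\<And>y. paired (k y) y"
    using ex_paired by metis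
  obtain h where h: "\<And>x. paired x (h x)"
    using inv.ex_paired inv_paired by metis
  have "h (k y) = y" for y
    using inv.paired_left_unique paired_inverse h k by metis
  moreover have "k (h x) = x" for x
    using paired_left_unique h k by metis
  moreover have "continuous_on UNIV k"
    using inv.paired_continuous paired_inverse[OF k] by blast
  ultimately have "homeomorphism UNIV UNIV h k"
    using paired_continuous[OF h] by (auto simp: homeomorphism_def intro: rangeI) (metis rangeI)+
  moreover have "\<forall>f\<in>AX. T f = (\<lambda>y. T (\<lambda>_. 1) y * f (k y))"
    using k by (auto simp: paired_def)
  moreover have "\<forall>g\<in>AY. S g = (\<lambda>x. S (\<lambda>_. 1) x * g (h x))"
    using paired_inverse[OF h] by (auto simp: inv.paired_def)
  ultimately show ?thesis by blast
qed

end

section \<open>Sublattices of continuous functions\<close>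

lemma image_Collect_mono:
  assumes "range q \<subseteq> range X"
  shows "q ` {n. P (q n)} \<subseteq> X ` {n. P (X n)}"
proof (intro image_subsetI)
  fix n assume n: "n \<in> {n. P (q n)}"
  have "q n \<in> range X"
    using assms by (rule subsetD) (rule rangeI)
  then obtain m where "q n = X m"
    by (elim rangeE)
  with n show "q n \<in> X ` {n. P (X n)}"
    by simp
qed

text \<open>Lets \<open>X\<close> be replaced by an injective sequence of its values: infinitely
  many \<open>q n\<close> are infinitely many distinct points, and these need infinitely many
  indices of \<open>X\<close>.\<close>

lemma INFM_reindex:
  assumes "inj (q::nat \<Rightarrow> 'a)" "range q \<subseteq> range (X::nat \<Rightarrow> 'a)" "\<exists>\<^sub>\<infinity>n. P (q n)"
  shows "\<exists>\<^sub>\<infinity>n. P (X n)"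
proof -
  have "infinite (q ` {n. P (q n)})"
    using assms(1,3) by (simp add: finite_image_iff inj_on_subset frequently_cofinite)
  moreover have "q ` {n. P (q n)} \<subseteq> X ` {n. P (X n)}"
    by (rule image_Collect_mono[OF assms(2)])
  ultimately show ?thesis
    unfolding frequently_cofinite by (auto dest: finite_subset)
qed

lemma INFM_even: "(\<And>n::nat. even n \<Longrightarrow> n \<ge> N \<Longrightarrow> P n) \<Longrightarrow> \<exists>\<^sub>\<infinity>n. P n"
  unfolding INFM_nat_le by (metis dvd_triv_left le_add2 mult_2 nle_le order_trans)

lemma INFM_odd: "(\<And>n::nat. odd n \<Longrightarrow> P n) \<Longrightarrow> \<exists>\<^sub>\<infinity>n. P n"
  unfolding INFM_nat_le by (metis even_Suc le_SucI order_refl)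

lemma strict_mono_choice:
  assumes "\<And>k. \<exists>\<^sub>\<infinity>n. P k n"
  obtains r :: "nat \<Rightarrow> nat" where "strict_mono r" "\<And>k. P k (r k)"
proof -
  have "\<exists>r. \<forall>k. P k (r k) \<and> r k < r (Suc k)"
  proof (rule dependent_nat_choice)
    show "\<exists>n. P 0 n"
      using assms[of 0] by (auto simp: INFM_nat)
    show "\<exists>m. P (Suc k) m \<and> n < m" for n k
      using assms[of "Suc k"] by (auto simp: INFM_nat)
  qed
  then show thesis
    using that by (auto simp: strict_mono_Suc_iff)
qed

text \<open>If every ball around \<open>z\<close> contained infinitely many terms, a diagonal choice
  with radii \<open>1 / (k + 1)\<close> would give a subsequence converging to
  \<open>z\<close>.\<close>

lemma no_convergent_subseq_finite_ball:
  fixes X :: "nat \<Rightarrow> 'a::metric_space"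
  assumes "\<nexists>l r. strict_mono (r::nat \<Rightarrow> nat) \<and> (X \<circ> r) \<longlonglongrightarrow> l"
  shows "\<exists>e>0. finite {n. X n \<in> ball z e}"
proof (rule ccontr)
  assume *: "\<not> ?thesis"
  have "\<exists>\<^sub>\<infinity>n. dist (X n) z < inverse (real (Suc k))" for k
    using * by (auto simp: frequently_cofinite dist_commute)
  then obtain r where r: "strict_mono r" "\<And>k. dist (X (r k)) z < inverse (real (Suc k))"
    using strict_mono_choice[of "\<lambda>k n. dist (X n) z < inverse (real (Suc k))"] by metis
  have "(\<lambda>k. dist (X (r k)) z) \<longlonglongrightarrow> 0"
    by (rule tendsto_sandwich[OF _ _ tendsto_const LIMSEQ_inverse_real_of_nat])
      (use r(2) in \<open>auto intro!: always_eventually less_imp_le\<close>)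
  then have "(X \<circ> r) \<longlonglongrightarrow> z"
    by (subst tendsto_dist_iff) (simp add: o_def)
  with assms r(1) show False by blast
qed

text \<open>Prepares places for infinitely many bumps: disjointness controls the size of their sum,
  and local finiteness makes it a finite sum near each point.\<close>

lemma no_convergent_subseq_disjoint_balls:
  fixes X :: "nat \<Rightarrow> 'a::metric_space"
  assumes "\<nexists>l r. strict_mono (r::nat \<Rightarrow> nat) \<and> (X \<circ> r) \<longlonglongrightarrow> l"
  obtains q \<rho> where "inj (q::nat \<Rightarrow> 'a)" "range q \<subseteq> range X" "\<And>n. \<rho> n > 0"
    "\<And>m n. m \<noteq> n \<Longrightarrow> ball (q m) (\<rho> m) \<inter> ball (q n) (\<rho> n) = {}"
    "\<And>z. \<exists>e>0. finite {n. ball (q n) (\<rho> n) \<inter> ball z e \<noteq> {}}"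
proof -
  note fin = no_convergent_subseq_finite_ball[OF assms]
  have "infinite (range X)"
  proof
    assume "finite (range X)"
    then obtain z where "infinite {n. X n = z}"
      using inf_img_fin_domE[of X UNIV] by (auto simp: vimage_def)
    moreover obtain e where "e > 0" "finite {n. X n \<in> ball z e}"
      using fin by blast
    moreover have "{n. X n = z} \<subseteq> {n. X n \<in> ball z e}"
      using \<open>e > 0\<close> by auto
    ultimately show False
      using finite_subset by blast
  qed
  then obtain q :: "nat \<Rightarrow> 'a" where q: "inj q" "range q \<subseteq> range X"
    using infinite_countable_subset by blast
  have finq: "\<exists>e>0. finite {n. q n \<in> ball z e}" for z
  proof -
    obtain e where e: "e > 0" "finite {n. X n \<in> ball z e}"
      using fin by blast
    have "q ` {n. q n \<in> ball z e} \<subseteq> X ` {n. X n \<in> ball z e}"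
      by (rule image_Collect_mono[OF q(2)])
    then have "finite {n. q n \<in> ball z e}"
      using e(2) q(1) by (meson finite_imageD finite_imageI finite_subset inj_on_subset subset_UNIV)
    with e(1) show ?thesis by blast
  qed
  have "\<exists>d>0. \<forall>m. m \<noteq> n \<longrightarrow> dist (q n) (q m) \<ge> d" for n
  proof -
    obtain e where e: "e > 0" "finite {m. q m \<in> ball (q n) e}"
      using finq by blast
    have "finite (q ` {m. q m \<in> ball (q n) e} - {q n})"
      using e(2) by simp
    then obtain d where d: "d > 0" "\<And>x. x \<in> q ` {m. q m \<in> ball (q n) e} - {q n} \<Longrightarrow> dist (q n) x \<ge> d"
      using finite_set_avoid[of "q ` {m. q m \<in> ball (q n) e} - {q n}" "q n"] by auto
    show ?thesis
    proof (intro exI[of _ "min d e"] conjI allI impI)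
      fix m assume "m \<noteq> n"
      then have "q m \<noteq> q n"
        using q(1) by (meson injD)
      then show "min d e \<le> dist (q n) (q m)"
        using d(2)[of "q m"] by (cases "q m \<in> ball (q n) e") auto
    qed (use d e in auto)
  qed
  then obtain d where d: "\<And>n. d n > 0" "\<And>n m. m \<noteq> n \<Longrightarrow> dist (q n) (q m) \<ge> d n"
    by metis
  \<comment> \<open>The bound \<open>d n / 2\<close> gives disjointness. The bound
    \<open>1 / (n + 1)\<close> gives local finiteness: a ball of large index that meets a small ball
    around \<open>z\<close> has its centre near \<open>z\<close>, and only finitely many centres are
    near \<open>z\<close>.\<close>
  define \<rho> where "\<rho> = (\<lambda>n. min (d n / 2) (inverse (real (Suc n))))"
  show thesis
  proof (rule that[OF q])
    show "\<rho> n > 0" for n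
      using d(1)[of n] by (simp add: \<rho>_def)
    show "ball (q m) (\<rho> m) \<inter> ball (q n) (\<rho> n) = {}" if "m \<noteq> n" for m n
    proof (rule ccontr)
      assume "ball (q m) (\<rho> m) \<inter> ball (q n) (\<rho> n) \<noteq> {}"
      then obtain z where "dist (q m) z < \<rho> m" "dist (q n) z < \<rho> n" by auto
      moreover have "dist (q m) (q n) \<le> dist (q m) z + dist (q n) z"
        by (rule dist_triangle2)
      moreover have "\<rho> m \<le> d m / 2" "\<rho> n \<le> d n / 2"
        by (simp_all add: \<rho>_def)
      ultimately show False
        using d(2)[of n m] d(2)[of m n] that by (simp add: dist_commute)
    qed
    show "\<exists>e>0. finite {n. ball (q n) (\<rho> n) \<inter> ball z e \<noteq> {}}" for z
    proof -
      obtain e where e: "e > 0" "finite {n. q n \<in> ball z e}"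
        using finq by blast
      obtain N where N: "inverse (real (Suc N)) < e / 2"
        using reals_Archimedean[of "e / 2"] e(1) by auto
      have "{n. ball (q n) (\<rho> n) \<inter> ball z (e/2) \<noteq> {}} \<subseteq> {..N} \<union> {n. q n \<in> ball z e}"
      proof
        fix n assume "n \<in> {n. ball (q n) (\<rho> n) \<inter> ball z (e/2) \<noteq> {}}"
        then obtain w where w: "dist (q n) w < \<rho> n" "dist z w < e/2" by auto
        show "n \<in> {..N} \<union> {n. q n \<in> ball z e}"
        proof (cases "n \<le> N")
          case False
          then have "inverse (real (Suc n)) \<le> inverse (real (Suc N))"
            by (simp add: field_simps)
          moreover have "\<rho> n \<le> inverse (real (Suc n))"
            unfolding \<rho>_def by (rule min.cobounded2)
          ultimately have "\<rho> n < e / 2"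
            using N by linarith
          moreover have "dist z (q n) \<le> dist z w + dist (q n) w"
            by (rule dist_triangle2)
          ultimately show ?thesis
            using w by auto
        qed simp
      qed
      then have "finite {n. ball (q n) (\<rho> n) \<inter> ball z (e/2) \<noteq> {}}"
        using e(2) finite_subset by blast
      with e(1) show ?thesis
        by (intro exI[of _ "e/2"]) simp
    qed
  qed
qed

section \<open>Oscillating functions in spaces determined locally\<close>

text \<open>Lies outside \<open>adequate\<close> because it establishes the last assumption of that
  locale; it covers the local lattices and the smooth functions alike.\<close>

lemma local_oscillation:
  fixes A :: "('a::metric_space \<Rightarrow> real) set"
  assumes loc: "A = Aloc A \<or> A = Aloc A \<inter> bounded_funs"
    and sub: "is_subspace_fun A"
    and bump: "\<And>U x. open U \<Longrightarrow> x \<in> U \<Longrightarrow>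
      \<exists>b\<in>A. b x = 1 \<and> (\<forall>y. 0 \<le> b y \<and> b y \<le> 3) \<and> (\<forall>y. y \<notin> U \<longrightarrow> b y = 0)"
    and g: "g \<in> A" "\<And>x. g x \<ge> 1"
    and X: "\<nexists>l r. strict_mono (r::nat \<Rightarrow> nat) \<and> (X \<circ> r) \<longlonglongrightarrow> l"
  shows "\<exists>f\<in>A. (\<exists>\<^sub>\<infinity>n. f (X n) \<ge> 3/4 * g (X n)) \<and> (\<exists>\<^sub>\<infinity>n. f (X n) \<le> 1/4 * g (X n))"
proof -
  obtain q \<rho> where q: "inj (q::nat \<Rightarrow> 'a)" "range q \<subseteq> range X" and \<rho>: "\<And>n. \<rho> n > 0"
    and disj: "\<And>m n. m \<noteq> n \<Longrightarrow> ball (q m) (\<rho> m) \<inter> ball (q n) (\<rho> n) = {}"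
    and locfin: "\<And>z. \<exists>e>0. finite {n. ball (q n) (\<rho> n) \<inter> ball z e \<noteq> {}}"
    by (rule no_convergent_subseq_disjoint_balls[OF X]) (rule that)
  have "\<exists>b\<in>A. b (q n) = 1 \<and> (\<forall>y. 0 \<le> b y \<and> b y \<le> 3) \<and> (\<forall>y. y \<notin> ball (q n) (\<rho> n) \<longrightarrow> b y = 0)" for n
    using bump[OF open_ball] \<rho>[of n] by simp
  then obtain b where B: "\<And>n. b n \<in> A \<and> b n (q n) = 1 \<and> (\<forall>y. 0 \<le> b n y \<and> b n y \<le> 3) \<and>
      (\<forall>y. y \<notin> ball (q n) (\<rho> n) \<longrightarrow> b n y = 0)"
    unfolding Bex_def by metis
  then have b: "\<And>n. b n \<in> A" "\<And>n. b n (q n) = 1" "\<And>n y. 0 \<le> b n y" "\<And>n y. b n y \<le> 3"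
      "\<And>n y. y \<notin> ball (q n) (\<rho> n) \<Longrightarrow> b n y = 0"
    by blast+
  \<comment> \<open>Disjointness leaves at most one index in \<open>N z\<close>, so
    \<open>f z\<close> is 0 or a single term. Thus \<open>f\<close> equals \<open>g\<close> at even
    centres, vanishes at odd ones, and is at most three times any bound of \<open>g\<close>.\<close>
  define N where "N z = {n. even n \<and> z \<in> ball (q n) (\<rho> n)}" for z
  define f where "f z = (\<Sum>n\<in>N z. g (q n) * b n z)" for z
  have "m = n" if "m \<in> N z" "n \<in> N z" for m n z
  proof (rule ccontr)
    assume "m \<noteq> n"
    from disj[OF this] that show False
      unfolding N_def by blast
  qed
  then have N: "N z = {} \<or> (\<exists>n. N z = {n})" for z
    by blast
  have f_even: "f (q n) = g (q n)" if "even n" for n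
  proof -
    have "n \<in> N (q n)"
      using that \<rho> by (simp add: N_def)
    then have "N (q n) = {n}"
      using N[of "q n"] by auto
    then show ?thesis
      by (simp add: f_def b)
  qed
  have f_odd: "f (q n) = 0" if "odd n" for n
  proof -
    have "q n \<notin> ball (q m) (\<rho> m)" if "even m" for m
    proof -
      have "m \<noteq> n"
        using \<open>odd n\<close> that by auto
      then show ?thesis
        using disj[of m n] \<rho>[of n] by (metis centre_in_ball disjoint_iff)
    qed
    then have "N (q n) = {}"
      unfolding N_def by blast
    then show ?thesis
      by (simp add: f_def)
  qed
  have sum_in: "(\<lambda>z. \<Sum>n\<in>F. g (q n) * b n z) \<in> A" if "finite F" for F
    using that
  proof induction
    case empty
    then show ?case
      using sub by (simp add: is_subspace_fun_def)
  next
    case (insert n F)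
    have "(\<lambda>z. g (q n) * b n z) \<in> A"
      using sub b(1) by (simp add: is_subspace_fun_def)
    then show ?case
      using sub insert by (simp add: is_subspace_fun_def)
  qed
  have "f \<in> Aloc A"
    unfolding Aloc_def
  proof (intro CollectI allI)
    fix z0
    obtain e where e: "e > 0" "finite {n. ball (q n) (\<rho> n) \<inter> ball z0 e \<noteq> {}}"
      using locfin by blast
    define F where "F = {n. ball (q n) (\<rho> n) \<inter> ball z0 e \<noteq> {}}"
    \<comment> \<open>Near \<open>z0\<close> only finitely many balls matter, so \<open>f\<close>
      coincides there with one fixed finite sum of elements of \<open>A\<close>.\<close>
    have "f z = (\<Sum>n\<in>{n\<in>F. even n}. g (q n) * b n z)" if "z \<in> ball z0 e" for z
      unfolding f_def using that e(2) b(5)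
      by (intro sum.mono_neutral_left) (auto simp: N_def F_def)
    moreover have "finite {n\<in>F. even n}"
      using e(2) by (simp add: F_def)
    ultimately show "\<exists>U. open U \<and> z0 \<in> U \<and> (\<exists>g\<in>A. \<forall>x\<in>U. f x = g x)"
      using sum_in e(1) by (metis (no_types, lifting) centre_in_ball open_ball)
  qed
  \<comment> \<open>In the bounded variant of \<open>loc\<close>, membership of \<open>g\<close> in
    \<open>A\<close> supplies the condition \<open>bdd\<close>.\<close>
  moreover have "f \<in> bounded_funs" if bdd: "g \<in> bounded_funs"
  proof -
    obtain C where C: "\<And>x. \<bar>g x\<bar> \<le> C"
      using bdd by (auto simp: bounded_funs_def bounded_iff)
    have "C \<ge> 0"
      using C[of undefined] by simp
    have "\<bar>f z\<bar> \<le> C * 3" for z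
      using N[of z] C b(3,4) \<open>C \<ge> 0\<close> by (auto simp: f_def abs_mult intro!: mult_mono)
    then show ?thesis
      by (auto simp: bounded_funs_def bounded_iff)
  qed
  ultimately have "f \<in> A"
    using loc g(1) by blast
  moreover have "\<exists>\<^sub>\<infinity>n. f (X n) \<ge> 3/4 * g (X n)"
  proof (rule INFM_reindex[OF q], rule INFM_even)
    show "f (q n) \<ge> 3/4 * g (q n)" if "even n" for n
      using f_even[OF that] g(2)[of "q n"] by simp
  qed
  moreover have "\<exists>\<^sub>\<infinity>n. f (X n) \<le> 1/4 * g (X n)"
  proof (rule INFM_reindex[OF q], rule INFM_odd)
    show "f (q n) \<le> 1/4 * g (q n)" if "odd n" for n
      using f_odd[OF that] g(2)[of "q n"] by simp
  qed
  ultimately show ?thesis by blast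
qed

section \<open>Oscillating Lipschitz functions on complete spaces\<close>

text \<open>If the range were totally bounded, its closure would be complete and totally bounded,
  hence compact, and \<open>X\<close> would have a convergent subsequence. So for some
  \<open>e\<close> no finite family of \<open>e\<close>-balls covers the range, and points can be
  picked greedily.\<close>

lemma no_convergent_subseq_separated:
  fixes X :: "nat \<Rightarrow> 'a::metric_space"
  assumes complete: "complete (UNIV :: 'a set)"
    and X: "\<nexists>l r. strict_mono (r::nat \<Rightarrow> nat) \<and> (X \<circ> r) \<longlonglongrightarrow> l"
  obtains q e where "e > 0" "range q \<subseteq> range X" "\<And>m n::nat. m \<noteq> n \<Longrightarrow> dist (q m) (q n) \<ge> e"
proof -
  have "\<exists>e>0. \<forall>K. finite K \<longrightarrow> \<not> range X \<subseteq> (\<Union>x\<in>K. ball x e)"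
  proof (rule ccontr)
    assume "\<not> ?thesis"
    then have *: "\<exists>K. finite K \<and> range X \<subseteq> (\<Union>x\<in>K. ball x e)" if "e > 0" for e
      using that by blast
    have "\<exists>K. finite K \<and> closure (range X) \<subseteq> (\<Union>x\<in>K. ball x e)" if "e > 0" for e
    proof -
      obtain K where K: "finite K" "range X \<subseteq> (\<Union>x\<in>K. ball x (e/2))"
        using *[OF half_gt_zero[OF \<open>e > 0\<close>]] by blast
      have "closure (range X) \<subseteq> (\<Union>x\<in>K. cball x (e/2))"
        using K(2) by (intro closure_minimal closed_UN K(1)) (force intro: less_imp_le)+
      also have "\<dots> \<subseteq> (\<Union>x\<in>K. ball x e)"
        using that by force
      finally show ?thesis
        using K(1) by blast
    qed
    moreover have "complete (closure (range X))"
      using complete by (metis closed_closure complete_Int_closed inf_top_left)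
    ultimately have "compact (closure (range X))"
      by (simp add: compact_eq_totally_bounded)
    moreover have "\<forall>n. X n \<in> closure (range X)"
      by (simp add: closure_subset[THEN subsetD])
    ultimately show False
      using X unfolding compact_eq_seq_compact_metric seq_compact_def by blast
  qed
  then obtain e where e: "e > 0" "\<And>K. finite K \<Longrightarrow> \<not> range X \<subseteq> (\<Union>x\<in>K. ball x e)"
    by blast
  have "\<exists>q. \<forall>n::nat. q n \<in> range X \<and> (\<forall>m<n. dist (q m) (q n) \<ge> e)"
  proof (rule dependent_wellorder_choice)
    fix n and q :: "nat \<Rightarrow> 'a"
    have "\<not> range X \<subseteq> (\<Union>x\<in>q ` {..<n}. ball x e)"
      by (rule e) simp
    then obtain x where "x \<in> range X" "x \<notin> (\<Union>x\<in>q ` {..<n}. ball x e)"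
      by blast
    then show "\<exists>x. x \<in> range X \<and> (\<forall>m<n. dist (q m) x \<ge> e)"
      by (intro exI[of _ x]) (auto simp: not_less)
  qed simp
  then obtain q where q: "\<And>n. q n \<in> range X" "\<And>m n::nat. m < n \<Longrightarrow> dist (q m) (q n) \<ge> e"
    by metis
  show thesis
  proof (rule that[OF e(1)])
    show "range q \<subseteq> range X"
      using q(1) by blast
    show "dist (q m) (q n) \<ge> e" if "m \<noteq> n" for m n
      using q(2)[of m n] q(2)[of n m] that by (metis dist_commute linorder_neqE_nat)
  qed
qed

text \<open>The function is a truncated linear function of the distance to \<open>P\<close>. It is
  built for a metric \<open>D\<close> given as a plain function, because the snowflake case needs
  the original metric and not the \<open>dist\<close> of the type.\<close>

lemma metric_plateau:
  fixes D :: "'a \<Rightarrow> 'a \<Rightarrow> real"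
  assumes D: "is_metric D" and "P \<noteq> {}" "\<epsilon> > 0" "L \<ge> 0"
  obtains f where "\<And>z. 0 \<le> f z" "\<And>z. f z \<le> L" "\<And>z w. \<bar>f z - f w\<bar> \<le> L / \<epsilon> * D z w"
    "\<And>p. p \<in> P \<Longrightarrow> f p = L" "\<And>z. \<forall>p\<in>P. D z p \<ge> \<epsilon> \<Longrightarrow> f z = 0"
proof -
  define \<delta> where "\<delta> z = (INF p\<in>P. D z p)" for z
  have nonneg: "D z w \<ge> 0" for z w
    using D by (simp add: is_metric_def)
  have bdd: "bdd_below (D z ` P)" for z
    using nonneg by (intro bdd_belowI[of _ 0]) auto
  have \<delta>0: "\<delta> z \<ge> 0" for z
    unfolding \<delta>_def using assms(2) nonneg by (intro cINF_greatest)
  have le: "\<delta> z \<le> \<delta> w + D z w" for z w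
  proof -
    have "\<delta> z - D z w \<le> \<delta> w"
      unfolding \<delta>_def[of w]
    proof (rule cINF_greatest[OF assms(2)])
      fix p assume "p \<in> P"
      then have "\<delta> z \<le> D z p"
        unfolding \<delta>_def by (rule cINF_lower[OF bdd])
      also have "\<dots> \<le> D z w + D w p"
        using D unfolding is_metric_def by blast
      finally show "\<delta> z - D z w \<le> D w p" by simp
    qed
    then show ?thesis by simp
  qed
  have sym: "D z w = D w z" for z w
    using D by (simp add: is_metric_def)
  define f where "f z = L * max 0 (1 - \<delta> z / \<epsilon>)" for z
  show thesis
  proof (rule that[of f])
    show "0 \<le> f z" for z
      using assms by (simp add: f_def)
    show "f z \<le> L" for z
      using assms \<delta>0[of z] by (simp add: f_def mult_left_le)
    show "\<bar>f z - f w\<bar> \<le> L / \<epsilon> * D z w" for z w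
    proof -
      have "\<bar>\<delta> z - \<delta> w\<bar> \<le> D z w"
        using le[of z w] le[of w z] sym[of z w] by simp
      then have "\<bar>\<delta> z / \<epsilon> - \<delta> w / \<epsilon>\<bar> \<le> D z w / \<epsilon>"
        using assms(3) by (simp add: diff_divide_distrib[symmetric] divide_right_mono)
      then have "\<bar>max 0 (1 - \<delta> z / \<epsilon>) - max 0 (1 - \<delta> w / \<epsilon>)\<bar> \<le> D z w / \<epsilon>"
        by linarith
      then have "L * \<bar>max 0 (1 - \<delta> z / \<epsilon>) - max 0 (1 - \<delta> w / \<epsilon>)\<bar> \<le> L * (D z w / \<epsilon>)"
        using assms(4) by (rule mult_left_mono)
      then show ?thesis
        using assms(4) by (simp add: f_def abs_mult right_diff_distrib[symmetric] del: max_mult_distrib_left)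
    qed
    show "f p = L" if "p \<in> P" for p
    proof -
      have "\<delta> p \<le> D p p"
        unfolding \<delta>_def using that by (intro cINF_lower bdd)
      also have "D p p = 0"
        using D by (simp add: is_metric_def)
      finally show ?thesis
        using \<delta>0[of p] by (simp add: f_def)
    qed
    show "f z = 0" if "\<forall>p\<in>P. D z p \<ge> \<epsilon>" for z
    proof -
      have "\<delta> z \<ge> \<epsilon>"
        unfolding \<delta>_def using assms(2) that by (intro cINF_greatest) auto
      then show ?thesis
        using assms(3) by (simp add: f_def)
    qed
  qed
qed

text \<open>Treats \<open>Lip\<close> (with \<open>D = dist\<close>) and \<open>lip\<close> (with
  \<open>D\<close> the metric before the snowflake power) together. \<open>infdist_in\<close> speaks
  of unbounded \<open>f\<close>, so it only concerns the variants without a boundedness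
  condition.\<close>

lemma Lipschitz_oscillation:
  fixes A :: "('a::metric_space \<Rightarrow> real) set" and D :: "'a \<Rightarrow> 'a \<Rightarrow> real"
  assumes complete: "complete (UNIV :: 'a set)"
    and D: "is_metric D" "\<And>e. e > 0 \<Longrightarrow> \<exists>e'>0. \<forall>z w. dist z w \<ge> e \<longrightarrow> D z w \<ge> e'"
    and Lip_in: "\<And>f K. f \<in> bounded_funs \<Longrightarrow> (\<And>z w. \<bar>f z - f w\<bar> \<le> K * D z w) \<Longrightarrow> f \<in> A"
    and infdist_in: "\<And>f Q. f \<in> A \<Longrightarrow> f \<notin> bounded_funs \<Longrightarrow> (\<lambda>x. infdist (f x) Q) \<in> A"
    and g: "g \<in> A" "\<And>x. g x \<ge> 1"
    and X: "\<nexists>l r. strict_mono (r::nat \<Rightarrow> nat) \<and> (X \<circ> r) \<longlonglongrightarrow> l"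
  shows "\<exists>f\<in>A. (\<exists>\<^sub>\<infinity>n. f (X n) \<ge> 3/4 * g (X n)) \<and> (\<exists>\<^sub>\<infinity>n. f (X n) \<le> 1/4 * g (X n))"
proof -
  obtain q e where q: "e > 0" "range q \<subseteq> range X" "\<And>m n::nat. m \<noteq> n \<Longrightarrow> dist (q m) (q n) \<ge> e"
    by (rule no_convergent_subseq_separated[OF complete X]) (rule that)
  have "inj q"
    using q(1,3) by (intro injI) (metis dist_self not_less)
  show ?thesis
  proof (cases "bounded (range (g \<circ> q))")
    case True
    \<comment> \<open>Along a subsequence \<open>g\<close> is almost the constant \<open>L\<close>,
      so a plateau of height \<open>L\<close> over the even terms is enough: eventually
      \<open>g < 4/3 * L\<close>, and the odd terms are too far away to see the plateau.\<close>
    then obtain L r where r: "strict_mono r" "((g \<circ> q) \<circ> r) \<longlonglongrightarrow> L"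
      using bounded_imp_convergent_subsequence by blast
    define p where "p = q \<circ> r"
    have p: "inj p" "range p \<subseteq> range X"
      using \<open>inj q\<close> r(1) q(2) by (auto simp: p_def intro!: inj_compose strict_mono_imp_inj_on)
    have lim: "(\<lambda>n. g (p n)) \<longlonglongrightarrow> L"
      using r(2) by (simp add: p_def o_def)
    have "L \<ge> 1"
      using LIMSEQ_le_const[OF lim] g(2) by blast
    obtain e' where e': "e' > 0" "\<And>z w. dist z w \<ge> e \<Longrightarrow> D z w \<ge> e'"
      using D(2)[OF q(1)] by blast
    obtain f where f: "\<And>z. 0 \<le> f z" "\<And>z. f z \<le> L" "\<And>z w. \<bar>f z - f w\<bar> \<le> L / e' * D z w"
      "\<And>z. z \<in> p ` {n. even n} \<Longrightarrow> f z = L"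
      "\<And>z. \<forall>w\<in>p ` {n. even n}. D z w \<ge> e' \<Longrightarrow> f z = 0"
    proof (rule metric_plateau[OF D(1) _ e'(1)])
      show "p ` {n. even n} \<noteq> {}"
        by (auto intro: exI[of _ 0])
      show "L \<ge> 0"
        using \<open>L \<ge> 1\<close> by simp
    qed (rule that)
    have "\<bar>f z\<bar> \<le> L" for z
      using f(1,2)[of z] by simp
    then have "f \<in> bounded_funs"
      by (auto simp: bounded_funs_def bounded_iff)
    then have "f \<in> A"
      using f(3) by (rule Lip_in)
    moreover have "\<exists>\<^sub>\<infinity>n. f (X n) \<ge> 3/4 * g (X n)"
    proof -
      have "eventually (\<lambda>n. g (p n) < 4/3 * L) sequentially"
        using \<open>L \<ge> 1\<close> by (intro order_tendstoD(2)[OF lim]) simp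
      then obtain N where N: "\<And>n. n \<ge> N \<Longrightarrow> g (p n) < 4/3 * L"
        by (auto simp: eventually_sequentially)
      show ?thesis
      proof (rule INFM_reindex[OF p], rule INFM_even)
        show "f (p n) \<ge> 3/4 * g (p n)" if "even n" "n \<ge> N" for n
          using f(4)[of "p n"] N[OF that(2)] that(1) by simp
      qed
    qed
    moreover have "\<exists>\<^sub>\<infinity>n. f (X n) \<le> 1/4 * g (X n)"
    proof (rule INFM_reindex[OF p], rule INFM_odd)
      fix n :: nat assume "odd n"
      have "f (p n) = 0"
      proof (rule f(5), rule ballI)
        fix w assume "w \<in> p ` {n. even n}"
        then obtain m where m: "w = p m" "even m" by blast
        then have "r m \<noteq> r n"
          using \<open>odd n\<close> r(1) by (metis strict_mono_eq)
        then show "D (p n) w \<ge> e'"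
          unfolding m(1) p_def o_def by (intro e'(2) q(3)) simp
      qed
      then show "f (p n) \<le> 1/4 * g (p n)"
        using g(2)[of "p n"] by simp
    qed
    ultimately show ?thesis by blast
  next
    case False
    have large: "\<exists>m. n < m \<and> g (q m) \<ge> C" for n C
    proof (rule ccontr)
      assume *: "\<not> ?thesis"
      have "\<bar>g (q m)\<bar> \<le> Max ((g \<circ> q) ` {..n}) + \<bar>C\<bar>" for m
      proof (cases "m \<le> n")
        case True
        then have "g (q m) \<le> Max ((g \<circ> q) ` {..n})"
          by (intro Max_ge) auto
        then show ?thesis
          using g(2)[of "q m"] by simp
      next
        case False
        have "g (q 0) \<le> Max ((g \<circ> q) ` {..n})"
          by (intro Max_ge) auto
        moreover have "g (q m) < C"
          using * False by (meson not_le)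
        ultimately show ?thesis
          using g(2)[of "q m"] g(2)[of "q 0"] by linarith
      qed
      then have "bounded (range (g \<circ> q))"
        by (auto simp: bounded_iff)
      with False show False by simp
    qed
    \<comment> \<open>With growth by a factor 4, each value at an odd index is at most a quarter of
      \<open>g (p n)\<close> or at least four times it when \<open>n\<close> is even. Either way its
      distance from \<open>g (p n)\<close> is at least \<open>3/4 * g (p n)\<close>.\<close>
    have "\<exists>r. \<forall>k. True \<and> (r k < r (Suc k) \<and> g (q (r (Suc k))) \<ge> 4 * g (q (r k)))"
      by (rule dependent_nat_choice) (use large in auto)
    then obtain r :: "nat \<Rightarrow> nat" where r: "strict_mono r" "\<And>k. g (q (r (Suc k))) \<ge> 4 * g (q (r k))"
      by (auto simp: strict_mono_Suc_iff)
    define p where "p = q \<circ> r"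
    have p: "inj p" "range p \<subseteq> range X"
      using \<open>inj q\<close> r(1) q(2) by (auto simp: p_def intro!: inj_compose strict_mono_imp_inj_on)
    have step: "4 * g (p m) \<le> g (p n)" if "m < n" for m n
      using that
    proof (induction n)
      case (Suc n)
      have "4 * g (p n) \<le> g (p (Suc n))"
        using r(2) by (simp add: p_def)
      then show ?case
        using Suc g(2)[of "p n"] by (cases "m = n") auto
    qed simp
    define Q where "Q = (g \<circ> p) ` {n. odd n}"
    have "Q \<noteq> {}"
      unfolding Q_def by (auto intro: exI[of _ 1])
    \<comment> \<open>A cutoff times an unbounded \<open>g\<close> need not be Lipschitz, whereas a
      1-Lipschitz function of \<open>g\<close> inherits the regularity of \<open>g\<close>.\<close>
    define f where "f = (\<lambda>x. infdist (g x) Q)"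
    have "bounded (range (g \<circ> q))" if "bounded (range g)"
      using bounded_subset[OF that, of "range (g \<circ> q)"] by auto
    then have "f \<in> A"
      unfolding f_def using False by (intro infdist_in g(1)) (auto simp: bounded_funs_def)
    moreover have "\<exists>\<^sub>\<infinity>n. f (X n) \<ge> 3/4 * g (X n)"
    proof (rule INFM_reindex[OF p], rule INFM_even)
      fix n :: nat assume "even n"
      show "f (p n) \<ge> 3/4 * g (p n)"
        unfolding f_def infdist_notempty[OF \<open>Q \<noteq> {}\<close>]
      proof (rule cINF_greatest[OF \<open>Q \<noteq> {}\<close>])
        fix t assume "t \<in> Q"
        then obtain m where m: "odd m" "t = g (p m)"
          by (auto simp: Q_def)
        then have "m < n \<or> n < m"
          using \<open>even n\<close> by (metis linorder_neqE_nat)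
        then show "3/4 * g (p n) \<le> dist (g (p n)) t"
          using step[of m n] step[of n m] g(2)[of "p n"] m(2) by (auto simp: dist_real_def)
      qed
    qed
    moreover have "\<exists>\<^sub>\<infinity>n. f (X n) \<le> 1/4 * g (X n)"
    proof (rule INFM_reindex[OF p], rule INFM_odd)
      show "f (p n) \<le> 1/4 * g (p n)" if "odd n" for n
        using that g(2)[of "p n"] by (simp add: f_def Q_def)
    qed
    ultimately show ?thesis by blast
  qed
qed

section \<open>Verification of \<open>adequate\<close> under condition (a)\<close>

lemma lattice_bump:
  assumes "is_sublattice_C A" "separates_points_closed A" "contains_constants A" "open U" "x \<in> U"
  shows "\<exists>b\<in>A. b x = 1 \<and> (\<forall>y. 0 \<le> b y \<and> b y \<le> 3) \<and> (\<forall>y. y \<notin> U \<longrightarrow> b y = 0)"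
proof -
  obtain f where f: "f \<in> A" "f x = 1" "\<forall>y\<in>-U. f y = 0"
    using assms(2,4,5) unfolding separates_points_closed_def by (metis ComplD closed_Compl)
  have const: "(\<lambda>_. c) \<in> A" for c
    using assms(3) by (simp add: contains_constants_def)
  have "(\<lambda>y. max 0 (f y)) \<in> A"
    using assms(1) const[of 0] f(1) by (simp add: is_sublattice_C_def)
  then have "(\<lambda>y. min 1 (max 0 (f y))) \<in> A"
    using assms(1) const[of 1] by (simp add: is_sublattice_C_def)
  then show ?thesis
    using f by (intro bexI[of _ "\<lambda>y. min 1 (max 0 (f y))"]) auto
qed

lemma Lip_funs_iff: "f \<in> Lip_funs \<longleftrightarrow> (\<exists>L. \<forall>x y. \<bar>f x - f y\<bar> \<le> L * dist x y)"
proof -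
  have "(x \<noteq> y \<longrightarrow> \<bar>f x - f y\<bar> / dist x y \<le> L) \<longleftrightarrow> \<bar>f x - f y\<bar> \<le> L * dist x y" for x y L
    by (cases "x = y") (auto simp: pos_divide_le_eq)
  then show ?thesis
    by (simp add: Lip_funs_def)
qed

lemma Lip_funs_contraction:
  fixes f h :: "'a::metric_space \<Rightarrow> real"
  assumes "f \<in> Lip_funs" "\<And>x y. \<bar>h x - h y\<bar> \<le> \<bar>f x - f y\<bar>"
  shows "h \<in> Lip_funs"
  using assms unfolding Lip_funs_iff by (meson order_trans)

lemma lip_funs_contraction:
  fixes f h :: "'a::metric_space \<Rightarrow> real"
  assumes f: "f \<in> lip_funs" and h: "\<And>x y. \<bar>h x - h y\<bar> \<le> \<bar>f x - f y\<bar>"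
  shows "h \<in> lip_funs"
proof -
  have "\<exists>\<delta>>0. \<forall>t. 0 < t \<and> t < \<delta> \<longrightarrow>
        (\<forall>x y. 0 < dist x y \<and> dist x y < t \<longrightarrow> \<bar>h x - h y\<bar> / t \<le> \<epsilon>)" if "\<epsilon> > 0" for \<epsilon>
  proof -
    have "\<exists>\<delta>>0. \<forall>t. 0 < t \<and> t < \<delta> \<longrightarrow>
        (\<forall>x y. 0 < dist x y \<and> dist x y < t \<longrightarrow> \<bar>f x - f y\<bar> / t \<le> \<epsilon>)"
      using f that by (simp add: lip_funs_def)
    then obtain \<delta> where \<delta>: "\<delta> > 0" "\<forall>t. 0 < t \<and> t < \<delta> \<longrightarrow>
        (\<forall>x y. 0 < dist x y \<and> dist x y < t \<longrightarrow> \<bar>f x - f y\<bar> / t \<le> \<epsilon>)"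
      by blast
    have "\<bar>h x - h y\<bar> / t \<le> \<epsilon>" if "0 < t" "t < \<delta>" "0 < dist x y" "dist x y < t" for t x y
    proof -
      have "\<bar>f x - f y\<bar> / t \<le> \<epsilon>"
        using \<delta>(2) that by blast
      then show ?thesis
        using divide_right_mono[OF h[of x y], of t] that(1) by linarith
    qed
    with \<delta>(1) show ?thesis by blast
  qed
  moreover have "h \<in> Lip_funs"
    using f h Lip_funs_contraction[of f h] by (simp add: lip_funs_def)
  ultimately show ?thesis
    by (simp add: lip_funs_def)
qed

text \<open>Bounded functions that are Lipschitz for \<open>D\<close> are the supply of elements of
  \<open>lip_funs\<close>. Boundedness handles distances above 1, where \<open>D\<close> outgrows
  \<open>dist\<close>.\<close>

lemma snowflake_lip:
  fixes f :: "'a::metric_space \<Rightarrow> real" and D :: "'a \<Rightarrow> 'a \<Rightarrow> real"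
  assumes D: "is_metric D" "0 < \<alpha>" "\<alpha> < 1" "\<And>x y. dist x y = D x y powr \<alpha>"
    and f: "f \<in> bounded_funs" "\<And>x y. \<bar>f x - f y\<bar> \<le> K * D x y"
  shows "f \<in> lip_funs"
proof -
  \<comment> \<open>\<open>D\<close> is \<open>dist\<close> to the power
    \<open>1 / \<alpha> = \<beta> + 1\<close>; the surplus exponent \<open>\<beta> > 0\<close> makes
    the difference quotients tend to 0 with the distance.\<close>
  define \<beta> where "\<beta> = 1 / \<alpha> - 1"
  have "\<beta> > 0"
    using D by (simp add: \<beta>_def)
  have Dd: "D x y = dist x y powr \<beta> * dist x y" for x y
  proof (cases "x = y")
    case True
    then show ?thesis
      using D(1) by (simp add: is_metric_def)
  next
    case False
    have "D x y = dist x y powr (1 / \<alpha>)"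
      using D by (simp add: powr_powr is_metric_def)
    also have "\<dots> = dist x y powr (\<beta> + 1)"
      by (simp add: \<beta>_def)
    also have "\<dots> = dist x y powr \<beta> * dist x y"
      using False by (simp add: powr_add)
    finally show ?thesis .
  qed
  define M where "M = \<bar>K\<bar> + 1"
  have fM: "\<bar>f x - f y\<bar> \<le> M * dist x y powr \<beta> * dist x y" for x y
  proof -
    have "\<bar>f x - f y\<bar> \<le> K * D x y" by (rule f)
    also have "\<dots> \<le> M * D x y"
      using D(1) by (intro mult_right_mono) (auto simp: M_def is_metric_def)
    finally show ?thesis
      by (simp add: Dd)
  qed
  have "M > 0" by (simp add: M_def)
  obtain C where C: "\<And>x. \<bar>f x\<bar> \<le> C"
    using f(1) by (auto simp: bounded_funs_def bounded_iff)
  have "f \<in> Lip_funs"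
    unfolding Lip_funs_iff
  proof (intro exI allI)
    fix x y
    have "C \<ge> 0"
      using C[of x] by simp
    show "\<bar>f x - f y\<bar> \<le> (M + 2 * C) * dist x y"
    proof (cases "dist x y \<le> 1")
      case True
      have "M * dist x y powr \<beta> \<le> M * 1"
        using True \<open>M > 0\<close> \<open>\<beta> > 0\<close> by (intro mult_left_mono powr_le1) auto
      then have "M * dist x y powr \<beta> * dist x y \<le> (M + 2 * C) * dist x y"
        using \<open>C \<ge> 0\<close> by (intro mult_right_mono) auto
      with fM[of x y] show ?thesis by linarith
    next
      case False
      have "\<bar>f x - f y\<bar> \<le> 2 * C * 1"
        using C[of x] C[of y] by simp
      also have "\<dots> \<le> (M + 2 * C) * dist x y"
        using False \<open>C \<ge> 0\<close> \<open>M > 0\<close> by (intro mult_mono) auto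
      finally show ?thesis .
    qed
  qed
  moreover have "\<exists>\<delta>>0. \<forall>t. 0 < t \<and> t < \<delta> \<longrightarrow>
        (\<forall>x y. 0 < dist x y \<and> dist x y < t \<longrightarrow> \<bar>f x - f y\<bar> / t \<le> \<epsilon>)" if "\<epsilon> > 0" for \<epsilon>
  \<comment> \<open>The witness solves
    \<open>M * \<delta> powr \<beta> = \<epsilon>\<close>.\<close>
  proof (intro exI[of _ "(\<epsilon> / M) powr (1 / \<beta>)"] conjI allI impI)
    show "0 < (\<epsilon> / M) powr (1 / \<beta>)"
      using \<open>\<epsilon> > 0\<close> \<open>M > 0\<close> by simp
    fix t and x y :: 'a
    assume "0 < t \<and> t < (\<epsilon> / M) powr (1 / \<beta>)" "0 < dist x y \<and> dist x y < t"
    then have t: "0 < t" "t < (\<epsilon> / M) powr (1 / \<beta>)" "dist x y < t"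
      by blast+
    have "dist x y powr \<beta> \<le> ((\<epsilon> / M) powr (1 / \<beta>)) powr \<beta>"
      using t \<open>\<beta> > 0\<close> by (intro powr_mono2) auto
    then have "dist x y powr \<beta> \<le> \<epsilon> / M"
      using \<open>\<beta> > 0\<close> \<open>\<epsilon> > 0\<close> \<open>M > 0\<close> by (simp add: powr_powr)
    then have "M * dist x y powr \<beta> \<le> \<epsilon>"
      using \<open>M > 0\<close> by (simp add: field_simps)
    then have "M * dist x y powr \<beta> * dist x y \<le> \<epsilon> * t"
      using t \<open>\<epsilon> > 0\<close> by (intro mult_mono) auto
    then show "\<bar>f x - f y\<bar> / t \<le> \<epsilon>"
      using fM[of x y] t(1) by (simp add: pos_divide_le_eq)
  qed
  ultimately show ?thesis
    by (simp add: lip_funs_def)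
qed

lemma infdist_contraction: "\<bar>infdist (a::real) Q - infdist b Q\<bar> \<le> \<bar>a - b\<bar>"
  using infdist_triangle_abs[of a Q b] by (simp add: dist_real_def)

lemma cond_a_adequate:
  fixes A :: "('a::metric_space \<Rightarrow> real) set"
  assumes A: "cond_a A"
  shows "adequate A"
proof unfold_locales
  have lat: "is_sublattice_C A" "separates_points_closed A" "contains_constants A"
    using A by (auto simp: cond_a_def)
  show "is_subspace_fun A" "contains_constants A"
    using lat by (auto simp: is_sublattice_C_def)
  show "continuous_on UNIV f" if "f \<in> A" for f
    using lat that by (auto simp: is_sublattice_C_def)
  show bump: "\<exists>b\<in>A. b x = 1 \<and> (\<forall>y. 0 \<le> b y \<and> b y \<le> 3) \<and> (\<forall>y. y \<notin> U \<longrightarrow> b y = 0)"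
    if "open U" "x \<in> U" for U x
    using lattice_bump[OF lat that] .
  show "\<exists>k\<in>A. (\<forall>x. 0 \<le> k x \<and> f x \<le> \<epsilon> + k x) \<and> (\<forall>x. f x \<le> 0 \<longrightarrow> k x = 0)"
    if "f \<in> A" "\<epsilon> > 0" for f \<epsilon>
  proof (rule bexI[of _ "\<lambda>x. max (f x) 0"])
    show "(\<lambda>x. max (f x) 0) \<in> A"
      using lat that by (simp add: is_sublattice_C_def contains_constants_def)
  qed (use that in auto)
  fix g :: "'a \<Rightarrow> real" and X :: "nat \<Rightarrow> 'a"
  assume g: "g \<in> A" "\<And>x. 1 \<le> g x" and X: "\<nexists>l r. strict_mono (r::nat \<Rightarrow> nat) \<and> (X \<circ> r) \<longlonglongrightarrow> l"
  have "(A = Aloc A \<or> A = Aloc A \<inter> bounded_funs)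
     \<or> (complete (UNIV :: 'a set) \<and> (A = Lip_funs \<or> A = Lip_funs \<inter> bounded_funs))
     \<or> (complete (UNIV :: 'a set) \<and>
          (\<exists>(D :: 'a \<Rightarrow> 'a \<Rightarrow> real) \<alpha>. is_metric D \<and> 0 < \<alpha> \<and> \<alpha> < 1 \<and> (\<forall>x y. dist x y = D x y powr \<alpha>)) \<and>
          (A = lip_funs \<or> A = lip_funs \<inter> bounded_funs))"
    (is "?loc \<or> ?Lip \<or> ?lip")
    using A unfolding cond_a_def by (elim conjE)
  then show "\<exists>f\<in>A. (\<exists>\<^sub>\<infinity>n. f (X n) \<ge> 3/4 * g (X n)) \<and> (\<exists>\<^sub>\<infinity>n. f (X n) \<le> 1/4 * g (X n))"
  proof
    assume ?loc
    have "is_subspace_fun A"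
      using lat by (simp add: is_sublattice_C_def)
    from local_oscillation[OF \<open>?loc\<close> this bump g X] show ?thesis by blast
  next
    assume "?Lip \<or> ?lip"
    then show ?thesis
    proof
      assume ?Lip
      show ?thesis
      proof (rule Lipschitz_oscillation[OF _ _ _ _ _ g X])
        show "complete (UNIV :: 'a set)"
          using \<open>?Lip\<close> by simp
        show "is_metric (dist :: 'a \<Rightarrow> _)"
          by (auto simp: is_metric_def dist_commute dist_triangle)
        show "f \<in> A" if "f \<in> bounded_funs" "\<And>z w. \<bar>f z - f w\<bar> \<le> K * dist z w" for f K
        proof -
          have "f \<in> Lip_funs"
            using that(2) by (auto simp: Lip_funs_iff)
          then show ?thesis
            using \<open>?Lip\<close> that(1) by auto
        qed
        show "(\<lambda>x. infdist (f x) Q) \<in> A" if "f \<in> A" "f \<notin> bounded_funs" for f Q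
          using \<open>?Lip\<close> that Lip_funs_contraction[of f "\<lambda>x. infdist (f x) Q", OF _ infdist_contraction]
          by auto
      qed blast
    next
      assume ?lip
      then obtain D \<alpha> where D: "is_metric D" "0 < \<alpha>" "\<alpha> < 1" "\<And>x y :: 'a. dist x y = D x y powr \<alpha>"
        by (elim conjE exE) (rule that; blast)
      show ?thesis
      proof (rule Lipschitz_oscillation[OF _ D(1) _ _ _ g X])
        show "complete (UNIV :: 'a set)"
          using \<open>?lip\<close> by simp
        show "\<exists>e'>0. \<forall>z w. dist z w \<ge> e \<longrightarrow> D z w \<ge> e'" if "e > 0" for e
        proof (intro exI[of _ "e powr (1/\<alpha>)"] conjI allI impI)
          fix z w :: 'a assume "dist z w \<ge> e"
          then have "e powr (1/\<alpha>) \<le> dist z w powr (1/\<alpha>)"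
            using \<open>e > 0\<close> D(2) by (intro powr_mono2) auto
          also have "\<dots> = D z w"
            using D by (simp add: powr_powr is_metric_def)
          finally show "e powr (1/\<alpha>) \<le> D z w" .
        qed (use that in auto)
        show "f \<in> A" if "f \<in> bounded_funs" "\<And>z w. \<bar>f z - f w\<bar> \<le> K * D z w" for f K
          using \<open>?lip\<close> that(1) snowflake_lip[OF D that] by auto
        show "(\<lambda>x. infdist (f x) Q) \<in> A" if "f \<in> A" "f \<notin> bounded_funs" for f Q
          using \<open>?lip\<close> that lip_funs_contraction[of f "\<lambda>x. infdist (f x) Q", OF _ infdist_contraction]
          by auto
      qed
    qed
  qed
qed

section \<open>Fields of multilinear forms\<close>

abbreviation norm_prod :: "'e::real_normed_vector list \<Rightarrow> real" where
  "norm_prod vs \<equiv> prod_list (map norm vs)"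

lemma norm_prod_nonneg [simp]: "norm_prod vs \<ge> 0"
  by (intro prod_list_nonneg) auto

lemma norm_prod_le_1: "(\<And>v. v \<in> set vs \<Longrightarrow> norm v \<le> 1) \<Longrightarrow> norm_prod vs \<le> 1"
  by (induction vs) (auto intro: mult_le_one)

lemma multilin_linear:
  "multilin k m \<Longrightarrow> length us + length vs + 1 = k \<Longrightarrow> linear (\<lambda>v. m (us @ v # vs))"
  by (simp add: multilin_def)

lemma multilin_bound:
  assumes "multilin k m"
  obtains C where "C \<ge> 0" "\<And>vs. length vs = k \<Longrightarrow> \<bar>m vs\<bar> \<le> C * norm_prod vs"
proof -
  obtain C where C: "\<And>vs. length vs = k \<Longrightarrow> \<bar>m vs\<bar> \<le> C * norm_prod vs"
    using assms by (auto simp: multilin_def)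
  have "\<bar>m vs\<bar> \<le> \<bar>C\<bar> * norm_prod vs" if "length vs = k" for vs
    using C[OF that] mult_right_mono[OF abs_ge_self[of C] norm_prod_nonneg[of vs]] by linarith
  then show thesis
    using that[of "\<bar>C\<bar>"] by simp
qed

lemma multilin_cong:
  assumes "multilin k m" "\<And>vs. length vs = k \<Longrightarrow> m' vs = m vs"
  shows "multilin k m'"
  unfolding multilin_def
proof (intro conjI allI impI)
  fix us vs :: "'a list" assume *: "length us + length vs + 1 = k"
  then have "(\<lambda>v. m' (us @ v # vs)) = (\<lambda>v. m (us @ v # vs))"
    by (intro ext assms(2)) simp
  then show "linear (\<lambda>v. m' (us @ v # vs))"
    using multilin_linear[OF assms(1) *] by simp
next
  show "\<exists>C. \<forall>vs. length vs = k \<longrightarrow> \<bar>m' vs\<bar> \<le> C * norm_prod vs"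
    using assms by (simp add: multilin_def)
qed

lemma multilin_add:
  assumes "multilin k m" "multilin k m'"
  shows "multilin k (\<lambda>vs. m vs + m' vs)"
  unfolding multilin_def
proof (intro conjI allI impI)
  fix us vs :: "'a list" assume *: "length us + length vs + 1 = k"
  show "linear (\<lambda>v. m (us @ v # vs) + m' (us @ v # vs))"
    by (intro linear_compose_add multilin_linear[OF assms(1) *] multilin_linear[OF assms(2) *])
next
  obtain C where C: "\<And>vs. length vs = k \<Longrightarrow> \<bar>m vs\<bar> \<le> C * norm_prod vs"
    using multilin_bound[OF assms(1)] by metis
  obtain C' where C': "\<And>vs. length vs = k \<Longrightarrow> \<bar>m' vs\<bar> \<le> C' * norm_prod vs"
    using multilin_bound[OF assms(2)] by metis
  have "\<bar>m vs + m' vs\<bar> \<le> (C + C') * norm_prod vs" if "length vs = k" for vs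
    using C[OF that] C'[OF that] abs_triangle_ineq[of "m vs" "m' vs"] by (simp add: distrib_right)
  then show "\<exists>C. \<forall>vs. length vs = k \<longrightarrow> \<bar>m vs + m' vs\<bar> \<le> C * norm_prod vs"
    by blast
qed

lemma multilin_scale:
  assumes "multilin k m"
  shows "multilin k (\<lambda>vs. c * m vs)"
  unfolding multilin_def
proof (intro conjI allI impI)
  fix us vs :: "'a list" assume *: "length us + length vs + 1 = k"
  show "linear (\<lambda>v. c * m (us @ v # vs))"
    using linear_compose_scale_right[OF multilin_linear[OF assms *], of c] by simp
next
  obtain C where C: "\<And>vs. length vs = k \<Longrightarrow> \<bar>m vs\<bar> \<le> C * norm_prod vs"
    using multilin_bound[OF assms] by metis
  have "\<bar>c * m vs\<bar> \<le> (\<bar>c\<bar> * C) * norm_prod vs" if "length vs = k" for vs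
    using mult_left_mono[OF C[OF that] abs_ge_zero[of c]] by (simp add: abs_mult mult.assoc)
  then show "\<exists>C. \<forall>vs. length vs = k \<longrightarrow> \<bar>c * m vs\<bar> \<le> C * norm_prod vs"
    by blast
qed

lemma multilin_diff:
  "multilin k m \<Longrightarrow> multilin k m' \<Longrightarrow> multilin k (\<lambda>vs. m vs - m' vs)"
  using multilin_add[of k m "\<lambda>vs. -1 * m' vs"] multilin_scale[of k m' "-1"] by simp

lemma multilin_const: "k = 0 \<or> c = 0 \<Longrightarrow> multilin k (\<lambda>_. c)"
  by (auto simp: multilin_def intro!: exI[of _ "\<bar>c\<bar>"] linear_zero)

lemma multilin_slice:
  assumes "multilin (Suc k) m"
  shows "multilin k (\<lambda>vs. m (h # vs))"
  unfolding multilin_def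
proof (intro conjI allI impI)
  fix us vs :: "'a list" assume "length us + length vs + 1 = k"
  then show "linear (\<lambda>v. m (h # us @ v # vs))"
    using multilin_linear[OF assms, of "h # us" vs] by simp
next
  obtain C where C: "\<And>vs. length vs = Suc k \<Longrightarrow> \<bar>m vs\<bar> \<le> C * norm_prod vs"
    using multilin_bound[OF assms] by metis
  have "\<bar>m (h # vs)\<bar> \<le> (C * norm h) * norm_prod vs" if "length vs = k" for vs
    using C[of "h # vs"] that by (simp add: mult.assoc)
  then show "\<exists>C. \<forall>vs. length vs = k \<longrightarrow> \<bar>m (h # vs)\<bar> \<le> C * norm_prod vs"
    by blast
qed

text \<open>Serves to normalise all arguments at once; the prefix \<open>us\<close> collects those
  already treated in the induction.\<close>

lemma multilin_scaleR_all:
  assumes "multilin k m" "length us + length vs = k"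
  shows "m (us @ map (\<lambda>v. c v *\<^sub>R f v) vs) = prod_list (map c vs) * m (us @ map f vs)"
  using assms(2)
proof (induction vs arbitrary: us)
  case (Cons v vs)
  let ?g = "map (\<lambda>v. c v *\<^sub>R f v) vs"
  have "linear (\<lambda>w. m (us @ w # ?g))"
    using Cons.prems by (intro multilin_linear[OF assms(1)]) simp
  from linear_scale[OF this] have "m (us @ (c v *\<^sub>R f v) # ?g) = c v * m (us @ f v # ?g)"
    by simp
  also have "m (us @ f v # ?g) = prod_list (map c vs) * m (us @ f v # map f vs)"
    using Cons.IH[of "us @ [f v]"] Cons.prems by simp
  finally show ?case by simp
qed simp

lemma mnorm_le_iff:
  assumes m: "multilin k m" and "\<epsilon> \<ge> 0"
  shows "mnorm k m \<le> \<epsilon> \<longleftrightarrow> (\<forall>vs. length vs = k \<longrightarrow> \<bar>m vs\<bar> \<le> \<epsilon> * norm_prod vs)"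
    and "mnorm k m \<ge> 0"
proof -
  let ?S = "{\<bar>m vs\<bar> | vs. length vs = k \<and> (\<forall>v\<in>set vs. norm v \<le> 1)}"
  obtain C where C: "C \<ge> 0" "\<And>vs. length vs = k \<Longrightarrow> \<bar>m vs\<bar> \<le> C * norm_prod vs"
    using multilin_bound[OF m] by metis
  have "\<bar>m vs\<bar> \<le> C" if "length vs = k" "\<forall>v\<in>set vs. norm v \<le> 1" for vs
    using C(2)[OF that(1)] mult_left_mono[OF norm_prod_le_1[of vs] C(1)] that(2) by fastforce
  then have bdd: "bdd_above ?S"
    by (intro bdd_aboveI[of _ C]) auto
  have zero: "\<bar>m (replicate k 0)\<bar> \<in> ?S"
    by (auto intro!: exI[of _ "replicate k 0"])
  show "mnorm k m \<ge> 0"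
    unfolding mnorm_def using cSup_upper[OF zero bdd] by (meson abs_ge_zero order_trans)
  show "mnorm k m \<le> \<epsilon> \<longleftrightarrow> (\<forall>vs. length vs = k \<longrightarrow> \<bar>m vs\<bar> \<le> \<epsilon> * norm_prod vs)"
  proof (intro iffI allI impI)
    fix vs :: "'a list" assume "mnorm k m \<le> \<epsilon>" and len: "length vs = k"
    \<comment> \<open>\<open>sgn\<close> fixes 0 and sends every other vector to norm 1, so
      \<open>v = norm v *\<^sub>R sgn v\<close> holds throughout and zero entries need no separate
      treatment.\<close>
    have "\<bar>m (map sgn vs)\<bar> \<in> ?S"
      using len by (auto intro!: exI[of _ "map sgn vs"] simp: norm_sgn)
    then have "\<bar>m (map sgn vs)\<bar> \<le> mnorm k m"
      unfolding mnorm_def by (rule cSup_upper[OF _ bdd])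
    then have *: "\<bar>m (map sgn vs)\<bar> \<le> \<epsilon>"
      using \<open>mnorm k m \<le> \<epsilon>\<close> by simp
    have "map (\<lambda>v. norm v *\<^sub>R sgn v) vs = vs"
    proof (intro map_idI)
      show "norm v *\<^sub>R sgn v = v" for v :: 'a
        by (cases "v = 0") (auto simp: sgn_div_norm)
    qed
    then have "m vs = norm_prod vs * m (map sgn vs)"
      using multilin_scaleR_all[OF m, of "[]" vs norm sgn] len by simp
    then show "\<bar>m vs\<bar> \<le> \<epsilon> * norm_prod vs"
      using mult_left_mono[OF * norm_prod_nonneg[of vs]] by (simp add: abs_mult mult.commute)
  next
    assume *: "\<forall>vs. length vs = k \<longrightarrow> \<bar>m vs\<bar> \<le> \<epsilon> * norm_prod vs"
    show "mnorm k m \<le> \<epsilon>"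
      unfolding mnorm_def
    proof (rule cSup_least)
      show "?S \<noteq> {}"
        using zero by blast
      fix r assume "r \<in> ?S"
      then obtain vs where vs: "r = \<bar>m vs\<bar>" "length vs = k" "\<forall>v\<in>set vs. norm v \<le> 1"
        by blast
      have "r \<le> \<epsilon> * norm_prod vs"
        using * vs by simp
      also have "\<dots> \<le> \<epsilon> * 1"
        using vs(3) assms(2) by (intro mult_left_mono norm_prod_le_1) auto
      finally show "r \<le> \<epsilon>" by simp
    qed
  qed
qed

text \<open>This is convergence of \<open>mnorm\<close> of the difference to 0, unfolded into
  homogeneous estimates on argument lists, which can be added and multiplied without handling
  suprema. \<open>form_cont_at_iff_mnorm\<close> gives the equivalence.\<close>

definition form_cont_at :: "'e::real_normed_vector \<Rightarrow> nat \<Rightarrow> ('e \<Rightarrow> 'e list \<Rightarrow> real) \<Rightarrow> bool" where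
  "form_cont_at x k M \<longleftrightarrow> (\<forall>\<epsilon>>0. \<forall>\<^sub>F h in at 0. \<forall>vs. length vs = k \<longrightarrow>
     \<bar>M (x + h) vs - M x vs\<bar> \<le> \<epsilon> * norm_prod vs)"

definition form_deriv_at :: "'e::real_normed_vector \<Rightarrow> nat \<Rightarrow> ('e \<Rightarrow> 'e list \<Rightarrow> real) \<Rightarrow> ('e list \<Rightarrow> real) \<Rightarrow> bool" where
  "form_deriv_at x k M L \<longleftrightarrow> (\<forall>\<epsilon>>0. \<forall>\<^sub>F h in at 0. \<forall>vs. length vs = k \<longrightarrow>
     \<bar>M (x + h) vs - M x vs - L (h # vs)\<bar> \<le> \<epsilon> * norm h * norm_prod vs)"

lemma form_cont_atD:
  "form_cont_at x k M \<Longrightarrow> \<epsilon> > 0 \<Longrightarrow> \<forall>\<^sub>F h in at 0. \<forall>vs. length vs = k \<longrightarrow>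
     \<bar>M (x + h) vs - M x vs\<bar> \<le> \<epsilon> * norm_prod vs"
  by (simp add: form_cont_at_def)

lemma form_deriv_atD:
  "form_deriv_at x k M L \<Longrightarrow> \<epsilon> > 0 \<Longrightarrow> \<forall>\<^sub>F h in at 0. \<forall>vs. length vs = k \<longrightarrow>
     \<bar>M (x + h) vs - M x vs - L (h # vs)\<bar> \<le> \<epsilon> * norm h * norm_prod vs"
  by (simp add: form_deriv_at_def)

lemma eventually_shift_in_open:
  fixes x :: "'e::real_normed_vector"
  assumes "open U" "x \<in> U"
  shows "\<forall>\<^sub>F h in at 0. x + h \<in> U"
  using eventually_at_in_open'[OF assms] unfolding eventually_at_to_0[of _ x] by (simp add: add.commute)

lemma form_cont_at_cong:
  assumes "form_cont_at x k M" "open U" "x \<in> U"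
    and "\<And>y vs. y \<in> U \<Longrightarrow> length vs = k \<Longrightarrow> N y vs = M y vs"
  shows "form_cont_at x k N"
  unfolding form_cont_at_def
proof (intro allI impI)
  fix \<epsilon> :: real assume "\<epsilon> > 0"
  show "\<forall>\<^sub>F h in at 0. \<forall>vs. length vs = k \<longrightarrow> \<bar>N (x + h) vs - N x vs\<bar> \<le> \<epsilon> * norm_prod vs"
    using form_cont_atD[OF assms(1) \<open>\<epsilon> > 0\<close>] eventually_shift_in_open[OF assms(2,3)]
    by eventually_elim (simp add: assms(3,4))
qed

lemma form_deriv_at_cong:
  assumes "form_deriv_at x k M L" "open U" "x \<in> U"
    and "\<And>y vs. y \<in> U \<Longrightarrow> length vs = k \<Longrightarrow> N y vs = M y vs"
    and "\<And>vs. length vs = Suc k \<Longrightarrow> L' vs = L vs"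
  shows "form_deriv_at x k N L'"
  unfolding form_deriv_at_def
proof (intro allI impI)
  fix \<epsilon> :: real assume "\<epsilon> > 0"
  show "\<forall>\<^sub>F h in at 0. \<forall>vs. length vs = k \<longrightarrow>
      \<bar>N (x + h) vs - N x vs - L' (h # vs)\<bar> \<le> \<epsilon> * norm h * norm_prod vs"
    using form_deriv_atD[OF assms(1) \<open>\<epsilon> > 0\<close>] eventually_shift_in_open[OF assms(2,3)]
    by eventually_elim (simp add: assms(3,4,5))
qed

lemma form_cont_at_add:
  assumes "form_cont_at x k M" "form_cont_at x k N"
  shows "form_cont_at x k (\<lambda>y vs. M y vs + N y vs)"
  unfolding form_cont_at_def
proof (intro allI impI)
  fix \<epsilon> :: real assume "\<epsilon> > 0"
  then have "\<epsilon> / 2 > 0" by simp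
  show "\<forall>\<^sub>F h in at 0. \<forall>vs. length vs = k \<longrightarrow>
      \<bar>M (x + h) vs + N (x + h) vs - (M x vs + N x vs)\<bar> \<le> \<epsilon> * norm_prod vs"
    using form_cont_atD[OF assms(1) \<open>\<epsilon> / 2 > 0\<close>] form_cont_atD[OF assms(2) \<open>\<epsilon> / 2 > 0\<close>]
  proof eventually_elim
    case (elim h)
    show ?case
    proof (intro allI impI)
      fix vs :: "'a list" assume "length vs = k"
      then have "\<bar>M (x + h) vs - M x vs\<bar> \<le> \<epsilon> / 2 * norm_prod vs"
        "\<bar>N (x + h) vs - N x vs\<bar> \<le> \<epsilon> / 2 * norm_prod vs"
        using elim by blast+
      then show "\<bar>M (x + h) vs + N (x + h) vs - (M x vs + N x vs)\<bar> \<le> \<epsilon> * norm_prod vs"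
        by (simp add: abs_if split: if_splits)
    qed
  qed
qed

lemma form_deriv_at_add:
  assumes "form_deriv_at x k M L" "form_deriv_at x k N L'"
  shows "form_deriv_at x k (\<lambda>y vs. M y vs + N y vs) (\<lambda>vs. L vs + L' vs)"
  unfolding form_deriv_at_def
proof (intro allI impI)
  fix \<epsilon> :: real assume "\<epsilon> > 0"
  then have "\<epsilon> / 2 > 0" by simp
  show "\<forall>\<^sub>F h in at 0. \<forall>vs. length vs = k \<longrightarrow>
      \<bar>M (x + h) vs + N (x + h) vs - (M x vs + N x vs) - (L (h # vs) + L' (h # vs))\<bar>
      \<le> \<epsilon> * norm h * norm_prod vs"
    using form_deriv_atD[OF assms(1) \<open>\<epsilon> / 2 > 0\<close>] form_deriv_atD[OF assms(2) \<open>\<epsilon> / 2 > 0\<close>]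
  proof eventually_elim
    case (elim h)
    show ?case
    proof (intro allI impI)
      fix vs :: "'a list" assume "length vs = k"
      then have "\<bar>M (x + h) vs - M x vs - L (h # vs)\<bar> \<le> \<epsilon> / 2 * norm h * norm_prod vs"
        "\<bar>N (x + h) vs - N x vs - L' (h # vs)\<bar> \<le> \<epsilon> / 2 * norm h * norm_prod vs"
        using elim by blast+
      then show "\<bar>M (x + h) vs + N (x + h) vs - (M x vs + N x vs) - (L (h # vs) + L' (h # vs))\<bar>
          \<le> \<epsilon> * norm h * norm_prod vs"
        by (simp add: abs_if split: if_splits)
    qed
  qed
qed

text \<open>\<open>S\<close> is the set of argument positions that the tensor product passes to its first factor.\<close>

definition splits :: "nat set \<Rightarrow> nat \<Rightarrow> nat \<Rightarrow> bool" where
  "splits S k l \<longleftrightarrow> card {i. i < k + l \<and> i \<in> S} = k"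

definition tens :: "nat set \<Rightarrow> ('e \<Rightarrow> 'e list \<Rightarrow> real) \<Rightarrow> ('e \<Rightarrow> 'e list \<Rightarrow> real) \<Rightarrow> 'e \<Rightarrow> 'e list \<Rightarrow> real" where
  "tens S M N = (\<lambda>x vs. M x (nths vs S) * N x (nths vs (- S)))"

lemma splits_length:
  assumes "splits S k l" "length vs = k + l"
  shows "length (nths vs S) = k" "length (nths vs (- S)) = l"
proof -
  show "length (nths vs S) = k"
    using assms by (simp add: length_nths splits_def)
  have "card {i. i < k + l \<and> i \<in> - S} = card ({..<k+l} - {i. i < k + l \<and> i \<in> S})"
    by (rule arg_cong[where f = card]) auto
  also have "\<dots> = l"
    using assms(1) by (subst card_Diff_subset) (auto simp: splits_def)
  finally show "length (nths vs (- S)) = l"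
    using assms(2) by (simp add: length_nths)
qed

text \<open>In the Leibniz rule the new direction is put in front of the list, so all positions move
  up by one and position 0 goes to the differentiated factor: the first one here, the second one in
  \<open>splits_Suc_right\<close>.\<close>

lemma splits_Suc_left: "splits S k l \<Longrightarrow> splits (insert 0 (Suc ` S)) (Suc k) l"
proof -
  have "{i. i < Suc k + l \<and> i \<in> insert 0 (Suc ` S)} = insert 0 (Suc ` {i. i < k + l \<and> i \<in> S})"
    by auto
  then show "splits S k l \<Longrightarrow> splits (insert 0 (Suc ` S)) (Suc k) l"
    by (simp add: splits_def card_image)
qed

lemma splits_Suc_right: "splits S k l \<Longrightarrow> splits (Suc ` S) k (Suc l)"
proof -
  have "{i. i < k + Suc l \<and> i \<in> Suc ` S} = Suc ` {i. i < k + l \<and> i \<in> S}"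
    by auto
  then show "splits S k l \<Longrightarrow> splits (Suc ` S) k (Suc l)"
    by (simp add: splits_def card_image)
qed

lemma nths_Cons_shift:
  "nths (h # vs) (insert 0 (Suc ` S)) = h # nths vs S"
  "nths (h # vs) (- insert 0 (Suc ` S)) = nths vs (- S)"
  "nths (h # vs) (Suc ` S) = nths vs S"
  "nths (h # vs) (- Suc ` S) = h # nths vs (- S)"
proof -
  have "{j. Suc j \<in> Suc ` S} = S" "{j. Suc j \<in> - Suc ` S} = - S" for S
    by auto
  then show "nths (h # vs) (insert 0 (Suc ` S)) = h # nths vs S"
    "nths (h # vs) (- insert 0 (Suc ` S)) = nths vs (- S)"
    "nths (h # vs) (Suc ` S) = nths vs S"
    "nths (h # vs) (- Suc ` S) = h # nths vs (- S)"
    by (simp_all add: nths_Cons image_iff Compl_eq)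
qed

lemma norm_prod_nths: "norm_prod (nths vs S) * norm_prod (nths vs (- S)) = norm_prod vs"
proof (induction vs arbitrary: S)
  case (Cons v vs)
  have "{j. Suc j \<in> - S} = - {j. Suc j \<in> S}"
    by auto
  then show ?case
    using Cons.IH[of "{j. Suc j \<in> S}"] by (simp add: nths_Cons algebra_simps)
qed simp

text \<open>The varying argument goes to exactly one factor, decided by whether
  \<open>length us\<close> lies in \<open>S\<close>; the other factor is then a constant
  scalar.\<close>

lemma multilin_tens:
  assumes m: "multilin k m" and n: "multilin l n" and S: "splits S k l"
  shows "multilin (k + l) (\<lambda>vs. m (nths vs S) * n (nths vs (- S)))"
  unfolding multilin_def
proof (intro conjI allI impI)
  fix us vs :: "'a list" assume len: "length us + length vs + 1 = k + l"
  define us1 us2 where "us1 = nths us S" and "us2 = nths us (- S)"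
  define vs1 vs2 where "vs1 = nths vs {j. Suc (j + length us) \<in> S}"
    and "vs2 = nths vs {j. Suc (j + length us) \<notin> S}"
  show "linear (\<lambda>v. m (nths (us @ v # vs) S) * n (nths (us @ v # vs) (- S)))"
  proof (cases "length us \<in> S")
    case True
    then have eq: "nths (us @ v # vs) S = us1 @ v # vs1" "nths (us @ v # vs) (- S) = us2 @ vs2" for v
      by (simp_all add: nths_append nths_Cons us1_def us2_def vs1_def vs2_def)
    have "length us1 + length vs1 + 1 = k"
      using splits_length(1)[OF S, of "us @ 0 # vs"] len unfolding eq by simp
    then have "linear (\<lambda>v. n (us2 @ vs2) *\<^sub>R m (us1 @ v # vs1))"
      by (intro linear_compose_scale_right multilin_linear[OF m])
    then show ?thesis
      unfolding eq by (simp add: mult.commute)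
  next
    case False
    then have eq: "nths (us @ v # vs) S = us1 @ vs1" "nths (us @ v # vs) (- S) = us2 @ v # vs2" for v
      by (simp_all add: nths_append nths_Cons us1_def us2_def vs1_def vs2_def)
    have "length us2 + length vs2 + 1 = l"
      using splits_length(2)[OF S, of "us @ 0 # vs"] len unfolding eq by simp
    then have "linear (\<lambda>v. m (us1 @ vs1) *\<^sub>R n (us2 @ v # vs2))"
      by (intro linear_compose_scale_right multilin_linear[OF n])
    then show ?thesis
      unfolding eq by simp
  qed
next
  obtain C where C: "C \<ge> 0" "\<And>vs. length vs = k \<Longrightarrow> \<bar>m vs\<bar> \<le> C * norm_prod vs"
    using multilin_bound[OF m] by metis
  obtain C' where C': "C' \<ge> 0" "\<And>vs. length vs = l \<Longrightarrow> \<bar>n vs\<bar> \<le> C' * norm_prod vs"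
    using multilin_bound[OF n] by metis
  have "\<bar>m (nths vs S) * n (nths vs (- S))\<bar> \<le> (C * C') * norm_prod vs" if "length vs = k + l" for vs
  proof -
    have "\<bar>m (nths vs S) * n (nths vs (- S))\<bar>
        \<le> (C * norm_prod (nths vs S)) * (C' * norm_prod (nths vs (- S)))"
      unfolding abs_mult using C C' splits_length[OF S that] by (intro mult_mono) auto
    also have "\<dots> = (C * C') * (norm_prod (nths vs S) * norm_prod (nths vs (- S)))"
      by (simp add: mult_ac)
    finally show ?thesis
      by (simp add: norm_prod_nths)
  qed
  then show "\<exists>C. \<forall>vs. length vs = k + l \<longrightarrow>
      \<bar>m (nths vs S) * n (nths vs (- S))\<bar> \<le> C * norm_prod vs"
    by blast
qed

section \<open>Product estimates and the Leibniz rule\<close>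

text \<open>Splits the difference as \<open>(a' - a) * b' + a * (b' - b)\<close>. Since
  \<open>e \<le> 1\<close>, \<open>b'\<close> is bounded by \<open>(C' + 1) * q\<close>, whence the
  factor \<open>C + C' + 1\<close>. In the application \<open>p\<close> and \<open>q\<close> are the
  norm products of the two groups of arguments.\<close>

lemma product_diff_bound:
  fixes a b a' b' e p q \<epsilon> C C' :: real
  assumes "\<bar>a' - a\<bar> \<le> e * p" "\<bar>b' - b\<bar> \<le> e * q" "\<bar>a\<bar> \<le> C * p" "\<bar>b\<bar> \<le> C' * q"
    and "0 \<le> e" "e \<le> 1" "0 \<le> p" "0 \<le> q" "0 \<le> C" "0 \<le> C'" "e * (C + C' + 1) \<le> \<epsilon>"
  shows "\<bar>a' * b' - a * b\<bar> \<le> \<epsilon> * (p * q)"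
proof -
  have "e * q \<le> 1 * q"
    using assms by (intro mult_right_mono) auto
  then have b': "\<bar>b'\<bar> \<le> (C' + 1) * q"
    using assms(2,4) unfolding distrib_right by linarith
  have "a' * b' - a * b = (a' - a) * b' + a * (b' - b)"
    by (simp add: algebra_simps)
  then have "\<bar>a' * b' - a * b\<bar> \<le> \<bar>a' - a\<bar> * \<bar>b'\<bar> + \<bar>a\<bar> * \<bar>b' - b\<bar>"
    by (metis abs_mult abs_triangle_ineq)
  also have "\<dots> \<le> (e * p) * ((C' + 1) * q) + (C * p) * (e * q)"
    using assms b' by (intro add_mono mult_mono) auto
  also have "\<dots> = (e * (C + C' + 1)) * (p * q)"
    by (simp add: algebra_simps)
  also have "\<dots> \<le> \<epsilon> * (p * q)"
    using assms by (intro mult_right_mono) auto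
  finally show ?thesis .
qed

text \<open>\<open>t\<close> stands for \<open>norm h\<close>, and \<open>a1\<close>,
  \<open>b1\<close> for the derivatives in direction \<open>h\<close>. The error consists of two
  remainder terms, small through \<open>e\<close>, and the product \<open>a1 * b1\<close>, which is
  of order \<open>t\<close> squared and therefore small through \<open>t\<close>.\<close>

lemma product_deriv_bound:
  fixes a b a1 b1 a' b' e p q t \<epsilon> A B A1 B1 :: real
  assumes "\<bar>a' - a - a1\<bar> \<le> e * t * p" "\<bar>b' - b - b1\<bar> \<le> e * t * q"
    and a: "\<bar>a\<bar> \<le> A * p" "\<bar>a1\<bar> \<le> A1 * t * p" and b: "\<bar>b\<bar> \<le> B * q" "\<bar>b1\<bar> \<le> B1 * t * q"
    and nonneg: "0 \<le> e" "0 \<le> p" "0 \<le> q" "0 \<le> t" "0 \<le> A" "0 \<le> A1" "0 \<le> B" "0 \<le> B1"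
    and "e \<le> 1" "t \<le> 1" "e * (A + A1 + B + B1 + 1) + t * (A1 * B1) \<le> \<epsilon>"
  shows "\<bar>a' * b' - a * b - (a1 * b + a * b1)\<bar> \<le> \<epsilon> * t * (p * q)"
proof -
  have "a1 * b1 + (a' - a - a1) * b' + (a + a1) * (b' - b - b1) = a' * b' - a * b - (a1 * b + a * b1)"
    by (simp add: algebra_simps)
  then have "\<bar>a' * b' - a * b - (a1 * b + a * b1)\<bar> \<le>
      \<bar>a1\<bar> * \<bar>b1\<bar> + \<bar>a' - a - a1\<bar> * \<bar>b'\<bar> + \<bar>a + a1\<bar> * \<bar>b' - b - b1\<bar>"
    unfolding abs_mult[symmetric] by linarith
  moreover have "\<bar>a1\<bar> * \<bar>b1\<bar> \<le> (A1 * t * p) * (B1 * t * q)"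
    using a b nonneg by (intro mult_mono) auto
  moreover have "\<bar>a' - a - a1\<bar> * \<bar>b'\<bar> \<le> (e * t * p) * ((B + B1 + 1) * q)"
  proof (rule mult_mono)
    have "B1 * t * q \<le> B1 * 1 * q"
      using nonneg \<open>t \<le> 1\<close> by (intro mult_right_mono mult_left_mono) auto
    moreover have "e * t * q \<le> 1 * q"
      using nonneg \<open>t \<le> 1\<close> \<open>e \<le> 1\<close> by (intro mult_right_mono mult_le_one) auto
    ultimately show "\<bar>b'\<bar> \<le> (B + B1 + 1) * q"
      using assms(2) b unfolding distrib_right by linarith
  qed (use assms in auto)
  moreover have "\<bar>a + a1\<bar> * \<bar>b' - b - b1\<bar> \<le> ((A + A1) * p) * (e * t * q)"
  proof (rule mult_mono)
    have "A1 * t * p \<le> A1 * 1 * p"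
      using nonneg \<open>t \<le> 1\<close> by (intro mult_right_mono mult_left_mono) auto
    then show "\<bar>a + a1\<bar> \<le> (A + A1) * p"
      using a unfolding distrib_right by linarith
  qed (use assms in auto)
  ultimately have "\<bar>a' * b' - a * b - (a1 * b + a * b1)\<bar> \<le>
      (A1 * t * p) * (B1 * t * q) + (e * t * p) * ((B + B1 + 1) * q) + ((A + A1) * p) * (e * t * q)"
    by linarith
  also have "\<dots> = (e * (A + A1 + B + B1 + 1) + t * (A1 * B1)) * (t * (p * q))"
    by (simp add: algebra_simps)
  also have "\<dots> \<le> \<epsilon> * (t * (p * q))"
    using assms by (intro mult_right_mono) auto
  finally show ?thesis
    by (simp add: mult.assoc)
qed

lemma form_cont_at_tens:
  assumes m: "multilin k (M x)" "form_cont_at x k M" and n: "multilin l (N x)" "form_cont_at x l N"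
    and S: "splits S k l"
  shows "form_cont_at x (k + l) (tens S M N)"
  unfolding form_cont_at_def
proof (intro allI impI)
  fix \<epsilon> :: real assume "\<epsilon> > 0"
  obtain C where C: "C \<ge> 0" "\<And>vs. length vs = k \<Longrightarrow> \<bar>M x vs\<bar> \<le> C * norm_prod vs"
    using multilin_bound[OF m(1)] by metis
  obtain C' where C': "C' \<ge> 0" "\<And>vs. length vs = l \<Longrightarrow> \<bar>N x vs\<bar> \<le> C' * norm_prod vs"
    using multilin_bound[OF n(1)] by metis
  define e where "e = min 1 (\<epsilon> / (C + C' + 1))"
  have e: "e > 0" "e \<le> 1" "e \<le> \<epsilon> / (C + C' + 1)"
    using \<open>\<epsilon> > 0\<close> C(1) C'(1) by (auto simp: e_def)
  then have e': "e * (C + C' + 1) \<le> \<epsilon>"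
    using C(1) C'(1) by (simp add: pos_le_divide_eq)
  show "\<forall>\<^sub>F h in at 0. \<forall>vs. length vs = k + l \<longrightarrow>
      \<bar>tens S M N (x + h) vs - tens S M N x vs\<bar> \<le> \<epsilon> * norm_prod vs"
    using form_cont_atD[OF m(2) e(1)] form_cont_atD[OF n(2) e(1)]
  proof eventually_elim
    case (elim h)
    show ?case
    proof (intro allI impI)
      fix vs :: "'a list" assume "length vs = k + l"
      note len = splits_length[OF S this]
      have "\<bar>tens S M N (x + h) vs - tens S M N x vs\<bar> \<le>
          \<epsilon> * (norm_prod (nths vs S) * norm_prod (nths vs (- S)))"
        unfolding tens_def
        using elim len C C' e e' by (intro product_diff_bound[where e = e and C = C and C' = C']) auto
      then show "\<bar>tens S M N (x + h) vs - tens S M N x vs\<bar> \<le> \<epsilon> * norm_prod vs"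
        by (simp add: norm_prod_nths)
    qed
  qed
qed

lemma form_deriv_at_tens:
  assumes m: "multilin k (M x)" "multilin (Suc k) (M' x)" "form_deriv_at x k M (M' x)"
    and n: "multilin l (N x)" "multilin (Suc l) (N' x)" "form_deriv_at x l N (N' x)"
    and S: "splits S k l"
  shows "form_deriv_at x (k + l) (tens S M N)
    (\<lambda>vs. tens (insert 0 (Suc ` S)) M' N x vs + tens (Suc ` S) M N' x vs)"
  unfolding form_deriv_at_def
proof (intro allI impI)
  fix \<epsilon> :: real assume "\<epsilon> > 0"
  obtain A where A: "A \<ge> 0" "\<And>vs. length vs = k \<Longrightarrow> \<bar>M x vs\<bar> \<le> A * norm_prod vs"
    using multilin_bound[OF m(1)] by metis
  obtain A1 where A1: "A1 \<ge> 0" "\<And>vs. length vs = Suc k \<Longrightarrow> \<bar>M' x vs\<bar> \<le> A1 * norm_prod vs"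
    using multilin_bound[OF m(2)] by metis
  obtain B where B: "B \<ge> 0" "\<And>vs. length vs = l \<Longrightarrow> \<bar>N x vs\<bar> \<le> B * norm_prod vs"
    using multilin_bound[OF n(1)] by metis
  obtain B1 where B1: "B1 \<ge> 0" "\<And>vs. length vs = Suc l \<Longrightarrow> \<bar>N' x vs\<bar> \<le> B1 * norm_prod vs"
    using multilin_bound[OF n(2)] by metis
  define K where "K = A + A1 + B + B1 + 1"
  have "K > 0"
    using A(1) A1(1) B(1) B1(1) by (simp add: K_def)
  define e where "e = min 1 (\<epsilon> / 2 / K)"
  have e: "e > 0" "e \<le> 1" "e \<le> \<epsilon> / 2 / K"
    using \<open>\<epsilon> > 0\<close> \<open>K > 0\<close> by (auto simp: e_def)
  then have e': "e * K \<le> \<epsilon> / 2"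
    using \<open>K > 0\<close> by (simp add: pos_le_divide_eq)
  \<comment> \<open>Half of \<open>\<epsilon>\<close> is spent on the remainders, through
    \<open>e\<close>, and half on the quadratic term, through \<open>norm h < d\<close>; the added 1
    keeps the denominator positive.\<close>
  define d where "d = min 1 (\<epsilon> / 2 / (A1 * B1 + 1))"
  have "A1 * B1 \<ge> 0"
    using A1(1) B1(1) by simp
  then have d: "d > 0" "d \<le> 1" "d \<le> \<epsilon> / 2 / (A1 * B1 + 1)"
    using \<open>\<epsilon> > 0\<close> by (auto simp: d_def)
  moreover have "A1 * B1 + 1 > 0"
    using \<open>A1 * B1 \<ge> 0\<close> by linarith
  ultimately have "d * (A1 * B1 + 1) \<le> \<epsilon> / 2"
    using pos_le_divide_eq by blast
  then have d': "d * (A1 * B1) \<le> \<epsilon> / 2"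
    using d(1) by (simp add: distrib_left)
  have "\<forall>\<^sub>F h in at (0::'a). norm h < d"
    using d(1) by (auto simp: eventually_at)
  then show "\<forall>\<^sub>F h in at 0. \<forall>vs. length vs = k + l \<longrightarrow>
      \<bar>tens S M N (x + h) vs - tens S M N x vs -
        (tens (insert 0 (Suc ` S)) M' N x (h # vs) + tens (Suc ` S) M N' x (h # vs))\<bar>
      \<le> \<epsilon> * norm h * norm_prod vs"
    using form_deriv_atD[OF m(3) e(1)] form_deriv_atD[OF n(3) e(1)]
  proof eventually_elim
    case (elim h)
    have "norm h * (A1 * B1) \<le> d * (A1 * B1)"
      using elim(1) \<open>A1 * B1 \<ge> 0\<close> by (intro mult_right_mono) auto
    then have bound: "e * K + norm h * (A1 * B1) \<le> \<epsilon>"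
      using e' d' by linarith
    show ?case
    proof (intro allI impI)
      fix vs :: "'a list" assume "length vs = k + l"
      note len = splits_length[OF S this]
      let ?p = "nths vs S" and ?q = "nths vs (- S)"
      have "\<bar>M (x + h) ?p * N (x + h) ?q - M x ?p * N x ?q
          - (M' x (h # ?p) * N x ?q + M x ?p * N' x (h # ?q))\<bar>
          \<le> \<epsilon> * norm h * (norm_prod ?p * norm_prod ?q)"
      proof (rule product_deriv_bound[where e = e and A = A and B = B and ?A1.0 = A1 and ?B1.0 = B1])
        show "\<bar>M' x (h # ?p)\<bar> \<le> A1 * norm h * norm_prod ?p"
          using A1(2)[of "h # ?p"] len by (simp add: mult.assoc)
        show "\<bar>N' x (h # ?q)\<bar> \<le> B1 * norm h * norm_prod ?q"
          using B1(2)[of "h # ?q"] len by (simp add: mult.assoc)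
        show "e * (A + A1 + B + B1 + 1) + norm h * (A1 * B1) \<le> \<epsilon>"
          using bound by (simp add: K_def)
      qed (use elim len A A1 B B1 e d in auto)
      then show "\<bar>tens S M N (x + h) vs - tens S M N x vs -
          (tens (insert 0 (Suc ` S)) M' N x (h # vs) + tens (Suc ` S) M N' x (h # vs))\<bar>
          \<le> \<epsilon> * norm h * norm_prod vs"
        by (simp add: tens_def nths_Cons_shift norm_prod_nths)
    qed
  qed
qed

section \<open>Degree zero and uniqueness of derivatives\<close>

lemma form_cont_at_0_iff: "form_cont_at x 0 M \<longleftrightarrow> isCont (\<lambda>y. M y []) x"
proof -
  have "isCont (\<lambda>y. M y []) x \<longleftrightarrow> ((\<lambda>h. M (x + h) []) \<longlongrightarrow> M x []) (at 0)"
    by (simp add: isCont_def filterlim_at_to_0[of _ _ x] add.commute)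
  also have "\<dots> \<longleftrightarrow> (\<forall>\<epsilon>>0. \<forall>\<^sub>F h in at 0. \<bar>M (x + h) [] - M x []\<bar> < \<epsilon>)"
    by (simp add: tendsto_iff dist_real_def)
  also have "\<dots> \<longleftrightarrow> (\<forall>\<epsilon>>0. \<forall>\<^sub>F h in at 0. \<bar>M (x + h) [] - M x []\<bar> \<le> \<epsilon>)"
  proof (intro iffI allI impI)
    fix \<epsilon> :: real
    assume *: "\<forall>\<epsilon>>0. \<forall>\<^sub>F h in at 0. \<bar>M (x + h) [] - M x []\<bar> < \<epsilon>" and "\<epsilon> > 0"
    from *[rule_format, OF \<open>\<epsilon> > 0\<close>] show "\<forall>\<^sub>F h in at 0. \<bar>M (x + h) [] - M x []\<bar> \<le> \<epsilon>"
      by eventually_elim simp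
  next
    fix \<epsilon> :: real
    assume *: "\<forall>\<epsilon>>0. \<forall>\<^sub>F h in at 0. \<bar>M (x + h) [] - M x []\<bar> \<le> \<epsilon>" and "\<epsilon> > 0"
    have "\<forall>\<^sub>F h in at 0. \<bar>M (x + h) [] - M x []\<bar> \<le> \<epsilon> / 2"
      using *[rule_format, OF half_gt_zero[OF \<open>\<epsilon> > 0\<close>]] .
    then show "\<forall>\<^sub>F h in at 0. \<bar>M (x + h) [] - M x []\<bar> < \<epsilon>"
      by eventually_elim (use \<open>\<epsilon> > 0\<close> in auto)
  qed
  finally show ?thesis
    by (simp add: form_cont_at_def)
qed

lemma tendsto_0_iff_eventually_le:
  fixes a :: "'x \<Rightarrow> real"
  assumes "\<forall>\<^sub>F x in F. a x \<ge> 0"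
  shows "(a \<longlongrightarrow> 0) F \<longleftrightarrow> (\<forall>\<epsilon>>0. \<forall>\<^sub>F x in F. a x \<le> \<epsilon>)"
proof (intro iffI allI impI)
  fix \<epsilon> :: real assume "(a \<longlongrightarrow> 0) F" "\<epsilon> > 0"
  then have "\<forall>\<^sub>F x in F. a x < \<epsilon>"
    by (rule order_tendstoD)
  then show "\<forall>\<^sub>F x in F. a x \<le> \<epsilon>"
    by eventually_elim simp
next
  assume *: "\<forall>\<epsilon>>0. \<forall>\<^sub>F x in F. a x \<le> \<epsilon>"
  show "(a \<longlongrightarrow> 0) F"
  proof (rule tendstoI)
    fix \<epsilon> :: real assume "\<epsilon> > 0"
    have "\<forall>\<^sub>F x in F. a x \<le> \<epsilon> / 2"
      using *[rule_format, OF half_gt_zero[OF \<open>\<epsilon> > 0\<close>]] .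
    with assms show "\<forall>\<^sub>F x in F. dist (a x) 0 < \<epsilon>"
      by eventually_elim (use \<open>\<epsilon> > 0\<close> in auto)
  qed
qed

lemma quotient_tendsto_0_iff:
  fixes a :: "'e::real_normed_vector \<Rightarrow> real"
  assumes "\<forall>\<^sub>F h in at 0. a h \<ge> 0"
  shows "((\<lambda>h. a h / norm h) \<longlongrightarrow> 0) (at 0) \<longleftrightarrow> (\<forall>\<epsilon>>0. \<forall>\<^sub>F h in at 0. a h \<le> \<epsilon> * norm h)"
proof -
  have nz: "\<forall>\<^sub>F h::'e in at 0. h \<noteq> 0"
    by (simp add: eventually_at_filter)
  have "\<forall>\<^sub>F h in at 0. a h / norm h \<ge> 0"
    using assms by eventually_elim simp
  then have "((\<lambda>h. a h / norm h) \<longlongrightarrow> 0) (at 0) \<longleftrightarrow> (\<forall>\<epsilon>>0. \<forall>\<^sub>F h in at 0. a h / norm h \<le> \<epsilon>)"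
    by (rule tendsto_0_iff_eventually_le)
  moreover have "(\<forall>\<^sub>F h in at 0. a h / norm h \<le> \<epsilon>) \<longleftrightarrow> (\<forall>\<^sub>F h in at 0. a h \<le> \<epsilon> * norm h)" for \<epsilon>
    by (rule eventually_subst, rule eventually_mono[OF nz]) (simp add: pos_divide_le_eq)
  ultimately show ?thesis by simp
qed

lemma form_deriv_at_0_iff:
  assumes L: "multilin (Suc 0) L"
  shows "form_deriv_at x 0 M L \<longleftrightarrow> ((\<lambda>y. M y []) has_derivative (\<lambda>h. L [h])) (at x)"
proof -
  have lin: "linear (\<lambda>h. L [h])"
    using multilin_linear[OF L, of "[]" "[]"] by simp
  obtain C where "\<And>vs. length vs = Suc 0 \<Longrightarrow> \<bar>L vs\<bar> \<le> C * norm_prod vs"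
    using multilin_bound[OF L] by metis
  then have "norm (L [h]) \<le> C * norm h" for h
    using \<open>\<And>vs. length vs = Suc 0 \<Longrightarrow> \<bar>L vs\<bar> \<le> C * norm_prod vs\<close>[of "[h]"] by simp
  then have "bounded_linear (\<lambda>h. L [h])"
    using lin by (auto simp: bounded_linear_def bounded_linear_axioms_def mult.commute)
  then show ?thesis
    unfolding has_derivative_at by (subst quotient_tendsto_0_iff) (auto simp: form_deriv_at_def)
qed

text \<open>Freezing all arguments but the first leaves the Frechet derivative of a scalar function,
  whose uniqueness is known. Needed to glue derivatives chosen on different neighborhoods.\<close>

lemma form_deriv_at_unique:
  assumes L: "multilin (Suc k) L" "form_deriv_at x k M L"
    and L': "multilin (Suc k) L'" "form_deriv_at x k M L'" and len: "length vs = Suc k"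
  shows "L vs = L' vs"
proof -
  obtain v ws where vs: "vs = v # ws" "length ws = k"
    using len by (auto simp: length_Suc_conv)
  have *: "((\<lambda>y. M y ws) has_derivative (\<lambda>h. L (h # ws))) (at x)"
    if L: "multilin (Suc k) L" "form_deriv_at x k M L" for L
  proof -
    have "form_deriv_at x 0 (\<lambda>y _. M y ws) (\<lambda>us. L (us @ ws))"
      unfolding form_deriv_at_def
    proof (intro allI impI)
      fix \<epsilon> :: real assume "\<epsilon> > 0"
      define e where "e = \<epsilon> / (norm_prod ws + 1)"
      have "norm_prod ws + 1 > 0"
        by (rule add_nonneg_pos) simp_all
      then have "e > 0" "e * (norm_prod ws + 1) = \<epsilon>"
        using \<open>\<epsilon> > 0\<close> by (auto simp: e_def)
      then have le: "e * norm_prod ws \<le> \<epsilon>"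
        by (simp add: distrib_left)
      show "\<forall>\<^sub>F h in at 0. \<forall>vs. length vs = 0 \<longrightarrow>
          \<bar>M (x + h) ws - M x ws - L ((h # vs) @ ws)\<bar> \<le> \<epsilon> * norm h * norm_prod vs"
        using form_deriv_atD[OF L(2) \<open>e > 0\<close>]
      proof eventually_elim
        case (elim h)
        then have "\<bar>M (x + h) ws - M x ws - L (h # ws)\<bar> \<le> e * norm h * norm_prod ws"
          using vs(2) by blast
        also have "\<dots> = (e * norm_prod ws) * norm h"
          by (simp add: mult_ac)
        also have "\<dots> \<le> \<epsilon> * norm h"
          using le by (intro mult_right_mono) auto
        finally show ?case by simp
      qed
    qed
    moreover have "multilin (Suc 0) (\<lambda>us. L (us @ ws))"
      unfolding multilin_def
    proof (intro conjI allI impI)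
      fix us vs :: "'a list" assume "length us + length vs + 1 = Suc 0"
      then show "linear (\<lambda>v. L ((us @ v # vs) @ ws))"
        using multilin_linear[OF L(1), of "[]" ws] vs(2) by simp
    next
      obtain C where C: "\<And>vs. length vs = Suc k \<Longrightarrow> \<bar>L vs\<bar> \<le> C * norm_prod vs"
        using multilin_bound[OF L(1)] by metis
      have "\<bar>L (us @ ws)\<bar> \<le> (C * norm_prod ws) * norm_prod us" if "length us = Suc 0" for us
        using C[of "us @ ws"] vs(2) that by (simp add: mult_ac)
      then show "\<exists>C. \<forall>us. length us = Suc 0 \<longrightarrow> \<bar>L (us @ ws)\<bar> \<le> C * norm_prod us"
        by blast
    qed
    ultimately show ?thesis
      using form_deriv_at_0_iff[of "\<lambda>us. L (us @ ws)" x "\<lambda>y _. M y ws"] by simp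
  qed
  have "(\<lambda>h. L (h # ws)) = (\<lambda>h. L' (h # ws))"
    using has_derivative_unique[OF *[OF L] *[OF L']] .
  then show ?thesis
    unfolding vs(1) by (rule fun_cong)
qed

section \<open>Continuously differentiable fields of forms\<close>

text \<open>The remaining order \<open>p\<close> counts down while the degree \<open>k\<close>
  counts up. As \<open>\<infinity> - 1 = \<infinity>\<close> in \<open>enat\<close>, coinduction
  treats finite and infinite order uniformly, and closure properties only require a class of fields
  stable under differentiation. \<open>Cp_on_iff_Cp_form\<close> links this to
  \<open>Cp_on\<close>.\<close>

coinductive Cp_form :: "'e::real_normed_vector set \<Rightarrow> enat \<Rightarrow> nat \<Rightarrow> ('e \<Rightarrow> 'e list \<Rightarrow> real) \<Rightarrow> bool"
  for U where
  Cp_formI: "(\<And>x. x \<in> U \<Longrightarrow> multilin k (M x) \<and> form_cont_at x k M) \<Longrightarrow>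
    (p \<noteq> 0 \<Longrightarrow> \<exists>M'. (\<forall>x\<in>U. form_deriv_at x k M (M' x)) \<and> Cp_form U (p - 1) (Suc k) M') \<Longrightarrow>
    Cp_form U p k M"

lemma Cp_form_multilin: "Cp_form U p k M \<Longrightarrow> x \<in> U \<Longrightarrow> multilin k (M x)"
  by (auto elim: Cp_form.cases)

lemma Cp_form_cont: "Cp_form U p k M \<Longrightarrow> x \<in> U \<Longrightarrow> form_cont_at x k M"
  by (auto elim: Cp_form.cases)

lemma Cp_form_deriv:
  assumes "Cp_form U p k M" "p \<noteq> 0"
  obtains M' where "\<And>x. x \<in> U \<Longrightarrow> form_deriv_at x k M (M' x)" "Cp_form U (p - 1) (Suc k) M'"
  using assms by (elim Cp_form.cases) blast

lemma Cp_form_coinduct_step: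
  assumes "R p k M"
    and "\<And>p k M x. R p k M \<Longrightarrow> x \<in> U \<Longrightarrow> multilin k (M x) \<and> form_cont_at x k M"
    and "\<And>p k M. R p k M \<Longrightarrow> p \<noteq> 0 \<Longrightarrow>
      \<exists>M'. (\<forall>x\<in>U. form_deriv_at x k M (M' x)) \<and> R (p - 1) (Suc k) M'"
  shows "Cp_form U p k M"
  using assms(1)
proof (coinduction arbitrary: p k M rule: Cp_form.coinduct)
  case Cp_form
  then show ?case
    using assms(2,3)[OF Cp_form] by blast
qed

text \<open>In the product and chain rules the undifferentiated factor must be lowered to the order
  \<open>p - 1\<close> of the derivative next to it.\<close>

lemma Cp_form_pred:
  assumes "Cp_form U p k M"
  shows "Cp_form U (p - 1) k M"
proof (rule Cp_form_coinduct_step[where R = "\<lambda>q k M. \<exists>p. q = p - 1 \<and> Cp_form U p k M"])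
  show "\<exists>p'. p - 1 = p' - 1 \<and> Cp_form U p' k M"
    using assms by blast
next
  fix q k M x assume "\<exists>p. q = p - 1 \<and> Cp_form U p k M" "x \<in> U"
  then show "multilin k (M x) \<and> form_cont_at x k M"
    using Cp_form_multilin Cp_form_cont by blast
next
  fix q k M assume "\<exists>p. q = p - 1 \<and> Cp_form U p k M" "q \<noteq> 0"
  then obtain p where p: "q = p - 1" "Cp_form U p k M"
    by blast
  have "p \<noteq> 0"
    using \<open>q \<noteq> 0\<close> p(1) by auto
  then show "\<exists>M'. (\<forall>x\<in>U. form_deriv_at x k M (M' x)) \<and>
      (\<exists>p. q - 1 = p - 1 \<and> Cp_form U p (Suc k) M')"
    using Cp_form_deriv[OF p(2) \<open>p \<noteq> 0\<close>] p(1) by metis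
qed

text \<open>Lists of the wrong length carry arbitrary values, so agreement is asked for length
  \<open>k\<close> only; openness of \<open>V\<close> makes the agreement hold near each point, as
  derivatives require.\<close>

lemma Cp_form_cong:
  assumes "Cp_form U p k M" "open V" "V \<subseteq> U"
    and "\<And>x vs. x \<in> V \<Longrightarrow> length vs = k \<Longrightarrow> N x vs = M x vs"
  shows "Cp_form V p k N"
proof (rule Cp_form_coinduct_step[where R = "\<lambda>p k N. \<exists>M. Cp_form U p k M \<and>
    (\<forall>x\<in>V. \<forall>vs. length vs = k \<longrightarrow> N x vs = M x vs)"])
  show "\<exists>M. Cp_form U p k M \<and> (\<forall>x\<in>V. \<forall>vs. length vs = k \<longrightarrow> N x vs = M x vs)"
    using assms by blast
next
  fix p k N x
  assume "\<exists>M. Cp_form U p k M \<and> (\<forall>x\<in>V. \<forall>vs. length vs = k \<longrightarrow> N x vs = M x vs)" and x: "x \<in> V"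
  then obtain M where M: "Cp_form U p k M" "\<And>x vs. x \<in> V \<Longrightarrow> length vs = k \<Longrightarrow> N x vs = M x vs"
    by blast
  have "x \<in> U"
    using x assms(3) by blast
  show "multilin k (N x) \<and> form_cont_at x k N"
    using multilin_cong[OF Cp_form_multilin[OF M(1) \<open>x \<in> U\<close>] M(2)[OF x]]
      form_cont_at_cong[OF Cp_form_cont[OF M(1) \<open>x \<in> U\<close>] assms(2) x M(2)] by blast
next
  fix p k N
  assume "\<exists>M. Cp_form U p k M \<and> (\<forall>x\<in>V. \<forall>vs. length vs = k \<longrightarrow> N x vs = M x vs)" and p: "p \<noteq> 0"
  then obtain M where M: "Cp_form U p k M" "\<And>x vs. x \<in> V \<Longrightarrow> length vs = k \<Longrightarrow> N x vs = M x vs"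
    by blast
  obtain M' where M': "\<And>x. x \<in> U \<Longrightarrow> form_deriv_at x k M (M' x)" "Cp_form U (p - 1) (Suc k) M'"
    using Cp_form_deriv[OF M(1) p] by blast
  have "form_deriv_at x k N (M' x)" if "x \<in> V" for x
    using form_deriv_at_cong[OF M'(1) assms(2) that M(2)] that assms(3) by blast
  then show "\<exists>N'. (\<forall>x\<in>V. form_deriv_at x k N (N' x)) \<and>
      (\<exists>M. Cp_form U (p - 1) (Suc k) M \<and> (\<forall>x\<in>V. \<forall>vs. length vs = Suc k \<longrightarrow> N' x vs = M x vs))"
    using M'(2) by blast
qed

lemma Cp_form_local:
  assumes "\<And>x. x \<in> U \<Longrightarrow> \<exists>V. open V \<and> x \<in> V \<and> V \<subseteq> U \<and> Cp_form V p k M"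
  shows "Cp_form U p k M"
proof (rule Cp_form_coinduct_step[where
    R = "\<lambda>p k M. \<forall>x\<in>U. \<exists>V. open V \<and> x \<in> V \<and> V \<subseteq> U \<and> Cp_form V p k M"])
  show "\<forall>x\<in>U. \<exists>V. open V \<and> x \<in> V \<and> V \<subseteq> U \<and> Cp_form V p k M"
    using assms by blast
next
  fix p k M x assume "\<forall>x\<in>U. \<exists>V. open V \<and> x \<in> V \<and> V \<subseteq> U \<and> Cp_form V p k M" "x \<in> U"
  then show "multilin k (M x) \<and> form_cont_at x k M"
    using Cp_form_multilin Cp_form_cont by blast
next
  fix p k M assume R: "\<forall>x\<in>U. \<exists>V. open V \<and> x \<in> V \<and> V \<subseteq> U \<and> Cp_form V p k M" and p: "p \<noteq> 0"
  have "\<exists>V M'. open V \<and> x \<in> V \<and> V \<subseteq> U \<and> (\<forall>y\<in>V. form_deriv_at y k M (M' y)) \<and>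
      Cp_form V (p - 1) (Suc k) M'" if x: "x \<in> U" for x
  proof -
    obtain V where V: "open V" "x \<in> V" "V \<subseteq> U" "Cp_form V p k M"
      using R x by blast
    obtain M' where "\<And>y. y \<in> V \<Longrightarrow> form_deriv_at y k M (M' y)" "Cp_form V (p - 1) (Suc k) M'"
      using Cp_form_deriv[OF V(4) p] by blast
    with V show ?thesis by blast
  qed
  then obtain V M' where VM: "\<And>x. x \<in> U \<Longrightarrow> open (V x) \<and> x \<in> V x \<and> V x \<subseteq> U \<and>
      (\<forall>y\<in>V x. form_deriv_at y k M (M' x y)) \<and> Cp_form (V x) (p - 1) (Suc k) (M' x)"
    by metis
  have deriv: "form_deriv_at y k M (M' x y)" if "x \<in> U" "y \<in> V x" for x y
    using VM[OF that(1)] that(2) by blast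
  have multilin: "multilin (Suc k) (M' x y)" if "x \<in> U" "y \<in> V x" for x y
    using VM[OF that(1)] that(2) Cp_form_multilin by blast
  \<comment> \<open>The diagonal choice glues the local derivatives: at \<open>y\<close> it takes
    the one belonging to the neighborhood of \<open>y\<close>, and uniqueness identifies it with the
    derivative chosen for any other neighborhood containing \<open>y\<close>.\<close>
  define L where "L y = M' y y" for y
  have eq: "L y vs = M' x y vs" if "x \<in> U" "y \<in> V x" "length vs = Suc k" for x y vs
  proof -
    have y: "y \<in> U" "y \<in> V y"
      using VM[OF that(1)] that(2) VM[of y] by auto
    show ?thesis
      unfolding L_def
      by (rule form_deriv_at_unique[OF multilin[OF y] deriv[OF y] multilin[OF that(1,2)] deriv[OF that(1,2)] that(3)])
  qed
  have CpL: "Cp_form (V x) (p - 1) (Suc k) L" if x: "x \<in> U" for x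
  proof (rule Cp_form_cong[OF _ _ order_refl])
    show "Cp_form (V x) (p - 1) (Suc k) (M' x)" "open (V x)"
      using VM[OF x] by blast+
  qed (rule eq[OF x])
  show "\<exists>M'. (\<forall>x\<in>U. form_deriv_at x k M (M' x)) \<and>
      (\<forall>x\<in>U. \<exists>V. open V \<and> x \<in> V \<and> V \<subseteq> U \<and> Cp_form V (p - 1) (Suc k) M')"
  proof (intro exI[of _ L] conjI ballI)
    fix x assume x: "x \<in> U"
    show "form_deriv_at x k M (L x)"
      unfolding L_def using deriv[OF x] VM[OF x] by blast
    show "\<exists>V. open V \<and> x \<in> V \<and> V \<subseteq> U \<and> Cp_form V (p - 1) (Suc k) L"
      using VM[OF x] CpL[OF x] by blast
  qed
qed

lemma Cp_form_const:
  assumes "k = 0 \<or> c = 0"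
  shows "Cp_form U p k (\<lambda>_ _. c)"
proof (rule Cp_form_coinduct_step[where R = "\<lambda>p k M. \<exists>c. M = (\<lambda>_ _. c) \<and> (k = 0 \<or> c = 0)"])
  show "\<exists>c'. (\<lambda>_ _. c) = (\<lambda>_ _. c') \<and> (k = 0 \<or> c' = 0)"
    using assms by blast
next
  fix p and k :: nat and M :: "'a \<Rightarrow> 'a list \<Rightarrow> real" and x
  assume "\<exists>c. M = (\<lambda>_ _. c) \<and> (k = 0 \<or> c = 0)"
  then show "multilin k (M x) \<and> form_cont_at x k M"
    by (auto simp: form_cont_at_def intro!: multilin_const)
next
  fix p and k :: nat and M :: "'a \<Rightarrow> 'a list \<Rightarrow> real"
  assume "\<exists>c. M = (\<lambda>_ _. c) \<and> (k = 0 \<or> c = 0)"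
  then show "\<exists>M'. (\<forall>x\<in>U. form_deriv_at x k M (M' x)) \<and>
      (\<exists>c. M' = (\<lambda>_ _. c) \<and> (Suc k = 0 \<or> c = 0))"
    by (intro exI[of _ "\<lambda>_ _. 0"]) (auto simp: form_deriv_at_def)
qed

text \<open>Moves a bump to \<open>a\<close> and shrinks its support. Each differentiation
  multiplies by \<open>t\<close>, and the coefficient \<open>c\<close> absorbs that factor, which
  makes the family stable under differentiation.\<close>

lemma Cp_form_affine:
  fixes a :: "'e::real_normed_vector"
  assumes M: "Cp_form UNIV p k M" and "t > 0"
  shows "Cp_form UNIV p k (\<lambda>x vs. c * M (t *\<^sub>R (x - a)) vs)"
proof (rule Cp_form_coinduct_step[where R = "\<lambda>p k N. \<exists>c M. N = (\<lambda>x vs. c * M (t *\<^sub>R (x - a)) vs) \<and>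
    Cp_form UNIV p k M"])
  show "\<exists>c' M'. (\<lambda>x vs. c * M (t *\<^sub>R (x - a)) vs) = (\<lambda>x vs. c' * M' (t *\<^sub>R (x - a)) vs) \<and>
      Cp_form UNIV p k M'"
    using M by blast
next
  have scaled: "\<forall>\<^sub>F h in at 0. P (t *\<^sub>R h)" if "\<forall>\<^sub>F h::'e in at 0. P h" for P
  proof -
    have "\<exists>d>0. \<forall>h. h \<noteq> 0 \<and> dist h 0 < d \<longrightarrow> P h"
      using that by (simp add: eventually_at)
    then obtain d where d: "d > 0" "\<forall>h. h \<noteq> 0 \<and> dist h 0 < d \<longrightarrow> P h"
      by (elim exE conjE) (rule that)
    have "P (t *\<^sub>R h)" if "h \<noteq> 0" "norm h < d / t" for h
      using that \<open>t > 0\<close> by (intro d(2)[rule_format]) (auto simp: pos_less_divide_eq mult.commute)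
    moreover have "d / t > 0"
      using d(1) \<open>t > 0\<close> by simp
    ultimately show ?thesis
      by (auto simp: eventually_at)
  qed
  have shift: "t *\<^sub>R (x + h - a) = t *\<^sub>R (x - a) + t *\<^sub>R h" for x h :: 'e
    by (simp add: algebra_simps)
  {
    fix p k N and x :: 'e
    assume "\<exists>c M. N = (\<lambda>x vs. c * M (t *\<^sub>R (x - a)) vs) \<and> Cp_form UNIV p k M"
    then obtain c M where N: "N = (\<lambda>x vs. c * M (t *\<^sub>R (x - a)) vs)" and M: "Cp_form UNIV p k M"
      by blast
    have "form_cont_at x k N"
      unfolding form_cont_at_def
    proof (intro allI impI)
      fix \<epsilon> :: real assume "\<epsilon> > 0"
      then have "\<epsilon> / (\<bar>c\<bar> + 1) > 0" by simp
      from scaled[OF form_cont_atD[OF Cp_form_cont[OF M UNIV_I, of "t *\<^sub>R (x - a)"] this]]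
      show "\<forall>\<^sub>F h in at 0. \<forall>vs. length vs = k \<longrightarrow> \<bar>N (x + h) vs - N x vs\<bar> \<le> \<epsilon> * norm_prod vs"
      proof eventually_elim
        case (elim h)
        show ?case
        proof (intro allI impI)
          fix vs :: "'e list" assume "length vs = k"
          then have "\<bar>M (t *\<^sub>R (x - a) + t *\<^sub>R h) vs - M (t *\<^sub>R (x - a)) vs\<bar>
              \<le> \<epsilon> / (\<bar>c\<bar> + 1) * norm_prod vs"
            using elim by blast
          then have "\<bar>c\<bar> * \<bar>M (t *\<^sub>R (x - a) + t *\<^sub>R h) vs - M (t *\<^sub>R (x - a)) vs\<bar>
              \<le> (\<bar>c\<bar> + 1) * (\<epsilon> / (\<bar>c\<bar> + 1) * norm_prod vs)"
            by (intro mult_mono) auto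
          then show "\<bar>N (x + h) vs - N x vs\<bar> \<le> \<epsilon> * norm_prod vs"
            by (simp add: N shift right_diff_distrib[symmetric] abs_mult)
        qed
      qed
    qed
    then show "multilin k (N x) \<and> form_cont_at x k N"
      using multilin_scale[OF Cp_form_multilin[OF M]] by (simp add: N)
  next
    fix p k N
    assume "\<exists>c M. N = (\<lambda>x vs. c * M (t *\<^sub>R (x - a)) vs) \<and> Cp_form UNIV p k M" and "p \<noteq> 0"
    then obtain c M where N: "N = (\<lambda>x vs. c * M (t *\<^sub>R (x - a)) vs)" and M: "Cp_form UNIV p k M"
      by blast
    obtain M' where M'_UNIV: "\<And>x. x \<in> UNIV \<Longrightarrow> form_deriv_at x k M (M' x)"
        "Cp_form UNIV (p - 1) (Suc k) M'"
      by (rule Cp_form_deriv[OF M \<open>p \<noteq> 0\<close>]) (rule that)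
    note M' = M'_UNIV(1)[OF UNIV_I] M'_UNIV(2)
    have "form_deriv_at x k N (\<lambda>vs. (c * t) * M' (t *\<^sub>R (x - a)) vs)" for x
      unfolding form_deriv_at_def
    proof (intro allI impI)
      fix \<epsilon> :: real assume "\<epsilon> > 0"
      define e where "e = \<epsilon> / (\<bar>c\<bar> * t + 1)"
      have pos: "\<bar>c\<bar> * t + 1 > 0"
        using \<open>t > 0\<close> by (intro add_nonneg_pos) auto
      have "e > 0"
        using \<open>\<epsilon> > 0\<close> pos by (simp add: e_def)
      have "e * (\<bar>c\<bar> * t + 1) = \<epsilon>"
        using pos by (simp add: e_def)
      then have e: "e * (\<bar>c\<bar> * t) \<le> \<epsilon>"
        using \<open>e > 0\<close> by (simp add: distrib_left)
      from scaled[OF form_deriv_atD[OF M'(1)[of "t *\<^sub>R (x - a)"] \<open>e > 0\<close>]]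
      show "\<forall>\<^sub>F h in at 0. \<forall>vs. length vs = k \<longrightarrow>
          \<bar>N (x + h) vs - N x vs - (c * t) * M' (t *\<^sub>R (x - a)) (h # vs)\<bar>
          \<le> \<epsilon> * norm h * norm_prod vs"
      proof eventually_elim
        case (elim h)
        show ?case
        proof (intro allI impI)
          fix vs :: "'e list" assume len: "length vs = k"
          have "linear (\<lambda>v. M' (t *\<^sub>R (x - a)) (v # vs))"
            using multilin_linear[OF Cp_form_multilin[OF M'(2) UNIV_I], of "[]" vs] len by simp
          from linear_scale[OF this]
          have lin: "M' (t *\<^sub>R (x - a)) (t *\<^sub>R h # vs) = t * M' (t *\<^sub>R (x - a)) (h # vs)"
            by simp
          let ?r = "M (t *\<^sub>R (x - a) + t *\<^sub>R h) vs - M (t *\<^sub>R (x - a)) vs -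
            t * M' (t *\<^sub>R (x - a)) (h # vs)"
          have "\<bar>?r\<bar> \<le> e * (t * norm h) * norm_prod vs"
            using elim[rule_format, OF len] \<open>t > 0\<close> by (simp add: lin)
          then have "\<bar>c\<bar> * \<bar>?r\<bar> \<le> \<bar>c\<bar> * (e * (t * norm h) * norm_prod vs)"
            by (rule mult_left_mono) simp
          also have "\<dots> = (e * (\<bar>c\<bar> * t)) * (norm h * norm_prod vs)"
            by (simp add: mult_ac)
          also have "\<dots> \<le> \<epsilon> * (norm h * norm_prod vs)"
            by (intro mult_right_mono e) simp
          finally have "\<bar>c * ?r\<bar> \<le> \<epsilon> * norm h * norm_prod vs"
            by (simp add: abs_mult mult.assoc)
          then show "\<bar>N (x + h) vs - N x vs - (c * t) * M' (t *\<^sub>R (x - a)) (h # vs)\<bar>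
              \<le> \<epsilon> * norm h * norm_prod vs"
            by (simp add: N shift right_diff_distrib mult.assoc)
        qed
      qed
    qed
    then show "\<exists>N'. (\<forall>x\<in>UNIV. form_deriv_at x k N (N' x)) \<and>
        (\<exists>c M. N' = (\<lambda>x vs. c * M (t *\<^sub>R (x - a)) vs) \<and> Cp_form UNIV (p - 1) (Suc k) M)"
      using M'(2) by (intro exI[of _ "\<lambda>x vs. (c * t) * M' (t *\<^sub>R (x - a)) vs"]) blast
  }
qed

section \<open>Closure under sums, products and smooth composition\<close>

definition smooth_real :: "(real \<Rightarrow> real) \<Rightarrow> bool" where
  "smooth_real \<psi> \<longleftrightarrow> (\<exists>\<Psi>. \<Psi> 0 = \<psi> \<and> (\<forall>n x. (\<Psi> n has_real_derivative \<Psi> (Suc n) x) (at x)))"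

lemma smooth_real_deriv:
  assumes "smooth_real \<psi>"
  obtains \<psi>' where "\<And>x. (\<psi> has_real_derivative \<psi>' x) (at x)" "smooth_real \<psi>'"
proof -
  obtain \<Psi> where \<Psi>: "\<Psi> 0 = \<psi>" "\<And>n x. (\<Psi> n has_real_derivative \<Psi> (Suc n) x) (at x)"
    using assms by (auto simp: smooth_real_def)
  show thesis
  proof (rule that)
    show "(\<psi> has_real_derivative \<Psi> 1 x) (at x)" for x
      using \<Psi>(2)[of 0 x] \<Psi>(1) by simp
    show "smooth_real (\<Psi> 1)"
      unfolding smooth_real_def using \<Psi>(2) by (intro exI[of _ "\<lambda>n. \<Psi> (Suc n)"]) simp
  qed
qed

text \<open>The derivative of a product is a sum of products and the derivative of \<open>\<psi> \<circ> F\<close> is the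
  product of \<open>\<psi>' \<circ> F\<close> with the derivative of \<open>F\<close>. So the closure of \<open>Cp_form\<close> under the three
  operations together is stable under differentiation, which is what the coinduction needs.\<close>

inductive Cp_closure :: "'e::real_normed_vector set \<Rightarrow> enat \<Rightarrow> nat \<Rightarrow> ('e \<Rightarrow> 'e list \<Rightarrow> real) \<Rightarrow> bool"
  for U where
  base: "Cp_form U p k M \<Longrightarrow> Cp_closure U p k M"
| add: "Cp_closure U p k M \<Longrightarrow> Cp_closure U p k N \<Longrightarrow> Cp_closure U p k (\<lambda>x vs. M x vs + N x vs)"
| tens: "Cp_closure U p k M \<Longrightarrow> Cp_closure U p l N \<Longrightarrow> splits S k l \<Longrightarrow>
    Cp_closure U p (k + l) (tens S M N)"
| comp: "Cp_form U p 0 F \<Longrightarrow> smooth_real \<psi> \<Longrightarrow> Cp_closure U p 0 (\<lambda>x vs. \<psi> (F x vs))"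

lemma Cp_closure_pred: "Cp_closure U p k M \<Longrightarrow> Cp_closure U (p - 1) k M"
  by (induction rule: Cp_closure.induct) (auto intro: Cp_closure.intros Cp_form_pred)

lemma form_deriv_at_comp:
  assumes F: "form_deriv_at x 0 F (F' x)" "multilin (Suc 0) (F' x)"
    and \<psi>: "\<And>t. (\<psi> has_real_derivative \<psi>' t) (at t)"
  shows "form_deriv_at x 0 (\<lambda>x vs. \<psi> (F x vs)) (tens {} (\<lambda>x vs. \<psi>' (F x vs)) F' x)"
proof -
  \<comment> \<open>With \<open>S = {}\<close> every argument goes to the second factor, so this
    tensor product is a scalar multiple of \<open>F'\<close>.\<close>
  have L: "tens {} (\<lambda>x vs. \<psi>' (F x vs)) F' x = (\<lambda>vs. \<psi>' (F x []) * F' x vs)"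
    by (simp add: tens_def nths_all)
  have "((\<lambda>y. F y []) has_derivative (\<lambda>h. F' x [h])) (at x)"
    using form_deriv_at_0_iff[OF F(2)] F(1) by blast
  moreover have "(\<psi> has_derivative (\<lambda>h. \<psi>' (F x []) * h)) (at (F x []))"
    using \<psi>[of "F x []"] by (simp add: has_field_derivative_def)
  ultimately have "((\<lambda>y. \<psi> (F y [])) has_derivative (\<lambda>h. \<psi>' (F x []) * F' x [h])) (at x)"
    using has_derivative_compose[of "\<lambda>y. F y []"] by blast
  then show ?thesis
    unfolding L using form_deriv_at_0_iff[OF multilin_scale[OF F(2)]] by blast
qed

text \<open>Multilinearity of \<open>M'\<close> is carried in the conclusion because the Leibniz
  rule needs it for both factors, and the derivation of \<open>Cp_closure\<close> for
  \<open>M'\<close> is not a subderivation to which the induction hypothesis would apply.\<close>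

lemma Cp_closure_step:
  assumes "Cp_closure U p k M"
  shows "\<And>x. x \<in> U \<Longrightarrow> multilin k (M x) \<and> form_cont_at x k M"
    and "p \<noteq> 0 \<Longrightarrow> \<exists>M'. (\<forall>x\<in>U. form_deriv_at x k M (M' x) \<and> multilin (Suc k) (M' x)) \<and>
      Cp_closure U (p - 1) (Suc k) M'"
  using assms
proof (induction rule: Cp_closure.induct)
  case (base p k M)
  {
    case 1
    then show ?case
      using base Cp_form_multilin Cp_form_cont by blast
  next
    case 2
    then show ?case
      using Cp_form_deriv[OF base] Cp_form_multilin Cp_closure.base by metis
  }
next
  case (add p k M N)
  {
    case 1
    then show ?case
      using add.IH(1,3) by (intro conjI multilin_add form_cont_at_add) blast+
  next
    case 2
    obtain M' where M': "\<And>x. x \<in> U \<Longrightarrow> form_deriv_at x k M (M' x) \<and> multilin (Suc k) (M' x)"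
        "Cp_closure U (p - 1) (Suc k) M'"
      using add.IH(2)[OF 2] by blast
    obtain N' where N': "\<And>x. x \<in> U \<Longrightarrow> form_deriv_at x k N (N' x) \<and> multilin (Suc k) (N' x)"
        "Cp_closure U (p - 1) (Suc k) N'"
      using add.IH(4)[OF 2] by blast
    show ?case
      using M' N' by (intro exI[of _ "\<lambda>x vs. M' x vs + N' x vs"])
        (auto intro: multilin_add form_deriv_at_add Cp_closure.add)
  }
next
  case (tens p k M l N S)
  {
    case 1
    then have "multilin k (M x)" "form_cont_at x k M" "multilin l (N x)" "form_cont_at x l N"
      using tens.IH(1,3) by blast+
    then show ?case
      using multilin_tens[of k "M x" l "N x" S] form_cont_at_tens[of k M x l N S] tens.hyps(3)
      by (simp add: tens_def)
  next
    case 2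
    obtain M' where M': "\<And>x. x \<in> U \<Longrightarrow> form_deriv_at x k M (M' x) \<and> multilin (Suc k) (M' x)"
        "Cp_closure U (p - 1) (Suc k) M'"
      using tens.IH(2)[OF 2] by blast
    obtain N' where N': "\<And>x. x \<in> U \<Longrightarrow> form_deriv_at x l N (N' x) \<and> multilin (Suc l) (N' x)"
        "Cp_closure U (p - 1) (Suc l) N'"
      using tens.IH(4)[OF 2] by blast
    define L where "L = (\<lambda>x vs. tens (insert 0 (Suc ` S)) M' N x vs + tens (Suc ` S) M N' x vs)"
    have "form_deriv_at x (k + l) (tens S M N) (L x)" if "x \<in> U" for x
      unfolding L_def using tens.IH(1,3)[OF that] M'(1)[OF that] N'(1)[OF that] tens.hyps(3)
      by (intro form_deriv_at_tens) auto
    moreover have "Cp_closure U (p - 1) (Suc (k + l)) L"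
      unfolding L_def
    proof (rule Cp_closure.add)
      show "Cp_closure U (p - 1) (Suc (k + l)) (tens (insert 0 (Suc ` S)) M' N)"
        using Cp_closure.tens[OF M'(2) Cp_closure_pred[OF tens.hyps(2)] splits_Suc_left[OF tens.hyps(3)]]
        by simp
      show "Cp_closure U (p - 1) (Suc (k + l)) (tens (Suc ` S) M N')"
        using Cp_closure.tens[OF Cp_closure_pred[OF tens.hyps(1)] N'(2) splits_Suc_right[OF tens.hyps(3)]]
        by simp
    qed
    moreover have "multilin (Suc (k + l)) (L x)" if "x \<in> U" for x
    proof -
      have "multilin (Suc k + l) (tens (insert 0 (Suc ` S)) M' N x)"
        unfolding tens_def using tens.IH(3)[OF that] M'(1)[OF that]
        by (intro multilin_tens splits_Suc_left tens.hyps(3)) auto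
      moreover have "multilin (k + Suc l) (tens (Suc ` S) M N' x)"
        unfolding tens_def using tens.IH(1)[OF that] N'(1)[OF that]
        by (intro multilin_tens splits_Suc_right tens.hyps(3)) auto
      ultimately show ?thesis
        unfolding L_def by (intro multilin_add) auto
    qed
    ultimately show ?case
      by blast
  }
next
  case (comp p F \<psi>)
  obtain \<psi>' where \<psi>': "\<And>t. (\<psi> has_real_derivative \<psi>' t) (at t)" "smooth_real \<psi>'"
    using smooth_real_deriv[OF comp(2)] by blast
  {
    case 1
    have "isCont (\<lambda>y. F y []) x"
      using Cp_form_cont[OF comp(1) 1] by (simp add: form_cont_at_0_iff)
    then have "isCont (\<lambda>y. \<psi> (F y [])) x"
      using DERIV_isCont[OF \<psi>'(1)] by (rule isCont_o2)
    moreover have "multilin 0 (\<lambda>vs. \<psi> (F x vs))"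
      by (auto simp: multilin_def)
    ultimately show ?case
      by (simp add: form_cont_at_0_iff)
  next
    case 2
    obtain F' where F': "\<And>x. x \<in> U \<Longrightarrow> form_deriv_at x 0 F (F' x)" "Cp_form U (p - 1) (Suc 0) F'"
      using Cp_form_deriv[OF comp(1) 2] by blast
    have F'_multilin: "multilin (Suc 0) (F' x)" if "x \<in> U" for x
      using Cp_form_multilin[OF F'(2) that] .
    define L where "L = tens {} (\<lambda>x vs. \<psi>' (F x vs)) F'"
    have "form_deriv_at x 0 (\<lambda>x vs. \<psi> (F x vs)) (L x)" if "x \<in> U" for x
      unfolding L_def by (intro form_deriv_at_comp F' F'_multilin that \<psi>'(1))
    moreover have "multilin (Suc 0) (L x)" if "x \<in> U" for x
      using multilin_scale[OF F'_multilin[OF that]] by (simp add: L_def tens_def nths_all)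
    moreover have "Cp_closure U (p - 1) (Suc 0) L"
    proof -
      have "splits {} 0 (Suc 0)"
        by (simp add: splits_def)
      from Cp_closure.tens[OF Cp_closure.comp[OF Cp_form_pred[OF comp(1)] \<psi>'(2)]
          Cp_closure.base[OF F'(2)] this]
      show ?thesis
        by (simp add: L_def)
    qed
    ultimately show ?case by blast
  }
qed

lemma Cp_form_closure:
  assumes "Cp_closure U p k M"
  shows "Cp_form U p k M"
proof (rule Cp_form_coinduct_step[where R = "Cp_closure U", OF assms])
  show "multilin k (M x) \<and> form_cont_at x k M" if "Cp_closure U p k M" "x \<in> U" for p k M x
    using Cp_closure_step(1)[OF that] .
  show "\<exists>M'. (\<forall>x\<in>U. form_deriv_at x k M (M' x)) \<and> Cp_closure U (p - 1) (Suc k) M'"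
    if "Cp_closure U p k M" "p \<noteq> 0" for p k M
    using Cp_closure_step(2)[OF that] by blast
qed

lemma Cp_form_add: "Cp_form U p k M \<Longrightarrow> Cp_form U p k N \<Longrightarrow> Cp_form U p k (\<lambda>x vs. M x vs + N x vs)"
  by (rule Cp_form_closure[OF Cp_closure.add[OF Cp_closure.base Cp_closure.base]])

lemma Cp_form_mult:
  assumes "Cp_form U p 0 (\<lambda>x _. f x)" "Cp_form U p 0 (\<lambda>x _. g x)"
  shows "Cp_form U p 0 (\<lambda>x _. f x * g x)"
proof -
  have "splits {} 0 0"
    by (simp add: splits_def)
  from Cp_closure.tens[OF Cp_closure.base[OF assms(1)] Cp_closure.base[OF assms(2)] this]
  show ?thesis
    by (intro Cp_form_closure) (simp add: tens_def)
qed

lemma Cp_form_comp: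
  "Cp_form U p 0 (\<lambda>x _. f x) \<Longrightarrow> smooth_real \<psi> \<Longrightarrow> Cp_form U p 0 (\<lambda>x _. \<psi> (f x))"
  by (rule Cp_form_closure[OF Cp_closure.comp])

section \<open>Agreement with the definition by sequences of derivatives\<close>

lemma enat_diff_Suc: "p - enat k - 1 = p - enat (Suc k)"
  by (cases p) (auto simp: one_enat_def)

lemma enat_diff_ne_0: "p - enat k \<noteq> 0 \<longleftrightarrow> enat k < p"
  by (cases p) (auto simp: zero_enat_def)

text \<open>\<open>mnorm\<close> is a real supremum, informative only for bounded forms.
  Multilinearity on the open set \<open>U\<close> guarantees this for all small \<open>h\<close>,
  which is all that a limit sees.\<close>

lemma form_cont_at_iff_mnorm:
  assumes "open U" "x \<in> U" "\<And>y. y \<in> U \<Longrightarrow> multilin k (M y)"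
  shows "form_cont_at x k M \<longleftrightarrow> ((\<lambda>y. mnorm k (\<lambda>vs. M y vs - M x vs)) \<longlongrightarrow> 0) (at x within U)"
proof -
  have ev: "\<forall>\<^sub>F h in at 0. multilin k (\<lambda>vs. M (x + h) vs - M x vs)"
    using eventually_shift_in_open[OF assms(1,2)]
    by eventually_elim (intro multilin_diff assms(2,3))
  have "((\<lambda>y. mnorm k (\<lambda>vs. M y vs - M x vs)) \<longlongrightarrow> 0) (at x within U) \<longleftrightarrow>
      ((\<lambda>h. mnorm k (\<lambda>vs. M (x + h) vs - M x vs)) \<longlongrightarrow> 0) (at 0)"
    by (simp only: at_within_open[OF assms(2,1)] filterlim_at_to_0[of _ _ x] add.commute[of _ x])
  also have "\<dots> \<longleftrightarrow> (\<forall>\<epsilon>>0. \<forall>\<^sub>F h in at 0. mnorm k (\<lambda>vs. M (x + h) vs - M x vs) \<le> \<epsilon>)"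
    by (rule tendsto_0_iff_eventually_le, rule eventually_mono[OF ev], rule mnorm_le_iff(2)[of _ _ 0]) auto
  also have "\<dots> \<longleftrightarrow> form_cont_at x k M"
    unfolding form_cont_at_def
  proof (intro all_cong eventually_subst, rule eventually_mono[OF ev])
    fix \<epsilon> :: real and h assume "\<epsilon> > 0" "multilin k (\<lambda>vs. M (x + h) vs - M x vs)"
    then show "(mnorm k (\<lambda>vs. M (x + h) vs - M x vs) \<le> \<epsilon>) =
        (\<forall>vs. length vs = k \<longrightarrow> \<bar>M (x + h) vs - M x vs\<bar> \<le> \<epsilon> * norm_prod vs)"
      by (intro mnorm_le_iff(1)) auto
  qed
  finally show ?thesis by simp
qed

lemma form_deriv_at_iff_mnorm:
  assumes "open U" "x \<in> U" "\<And>y. y \<in> U \<Longrightarrow> multilin k (M y)" "multilin (Suc k) L"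
  shows "form_deriv_at x k M L \<longleftrightarrow>
    ((\<lambda>h. mnorm k (\<lambda>vs. M (x + h) vs - M x vs - L (h # vs)) / norm h) \<longlongrightarrow> 0) (at 0)"
proof -
  have ev: "\<forall>\<^sub>F h in at 0. multilin k (\<lambda>vs. M (x + h) vs - M x vs - L (h # vs))"
    using eventually_shift_in_open[OF assms(1,2)]
    by eventually_elim (intro multilin_diff multilin_slice assms(2-4))
  have "((\<lambda>h. mnorm k (\<lambda>vs. M (x + h) vs - M x vs - L (h # vs)) / norm h) \<longlongrightarrow> 0) (at 0) \<longleftrightarrow>
      (\<forall>\<epsilon>>0. \<forall>\<^sub>F h in at 0. mnorm k (\<lambda>vs. M (x + h) vs - M x vs - L (h # vs)) \<le> \<epsilon> * norm h)"
    by (rule quotient_tendsto_0_iff, rule eventually_mono[OF ev], rule mnorm_le_iff(2)[of _ _ 0]) auto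
  also have "\<dots> \<longleftrightarrow> form_deriv_at x k M L"
    unfolding form_deriv_at_def
  proof (intro all_cong eventually_subst, rule eventually_mono[OF ev])
    fix \<epsilon> :: real and h assume "\<epsilon> > 0" "multilin k (\<lambda>vs. M (x + h) vs - M x vs - L (h # vs))"
    then show "(mnorm k (\<lambda>vs. M (x + h) vs - M x vs - L (h # vs)) \<le> \<epsilon> * norm h) =
        (\<forall>vs. length vs = k \<longrightarrow>
          \<bar>M (x + h) vs - M x vs - L (h # vs)\<bar> \<le> \<epsilon> * norm h * norm_prod vs)"
      by (intro mnorm_le_iff(1)) auto
  qed
  finally show ?thesis by simp
qed

lemma Cp_on_iff_Cp_form:
  fixes g :: "'e::banach \<Rightarrow> real"
  assumes U: "open U"
  shows "Cp_on p U g \<longleftrightarrow> Cp_form U p 0 (\<lambda>x _. g x)"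
proof
  assume "Cp_on p U g"
  then obtain D where D: "\<And>x. x \<in> U \<Longrightarrow> D 0 x [] = g x"
    "\<And>k x. enat k \<le> p \<Longrightarrow> x \<in> U \<Longrightarrow> multilin k (D k x)"
    "\<And>k x. enat k \<le> p \<Longrightarrow> x \<in> U \<Longrightarrow> ((\<lambda>y. mnorm k (\<lambda>vs. D k y vs - D k x vs)) \<longlongrightarrow> 0) (at x within U)"
    "\<And>k x. enat k < p \<Longrightarrow> x \<in> U \<Longrightarrow>
      ((\<lambda>h. mnorm k (\<lambda>vs. D k (x + h) vs - D k x vs - D (Suc k) x (h # vs)) / norm h) \<longlongrightarrow> 0) (at 0)"
    unfolding Cp_on_def by blast
  have "Cp_form U p 0 (D 0)"
  \<comment> \<open>After \<open>k\<close> differentiations the field is \<open>D k\<close> and the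
    order left is \<open>p - k\<close>; the guard excludes orders about which \<open>Cp_on\<close>
    says nothing.\<close>
  proof (rule Cp_form_coinduct_step[where R = "\<lambda>q k M. enat k \<le> p \<and> q = p - enat k \<and> M = D k"])
    show "enat 0 \<le> p \<and> p = p - enat 0 \<and> D 0 = D 0"
      by (simp add: zero_enat_def[symmetric])
  next
    fix q k M x assume R: "enat k \<le> p \<and> q = p - enat k \<and> M = D k" and "x \<in> U"
    then have k: "enat k \<le> p" and M: "M = D k"
      by auto
    show "multilin k (M x) \<and> form_cont_at x k M"
      using form_cont_at_iff_mnorm[where M = "D k", OF U \<open>x \<in> U\<close> D(2)[OF k]]
        D(2)[OF k \<open>x \<in> U\<close>] D(3)[OF k \<open>x \<in> U\<close>] by (simp add: M)
  next
    fix q k M assume R: "enat k \<le> p \<and> q = p - enat k \<and> M = D k" and "q \<noteq> 0"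
    then have "enat k < p"
      by (simp add: enat_diff_ne_0)
    then have "enat (Suc k) \<le> p"
      by (simp add: Suc_ile_eq)
    have k: "enat k \<le> p" and M: "M = D k"
      using R by auto
    have "form_deriv_at x k M (D (Suc k) x)" if "x \<in> U" for x
      using form_deriv_at_iff_mnorm[where M = "D k", OF U that D(2)[OF k]
          D(2)[OF \<open>enat (Suc k) \<le> p\<close> that]] D(4)[OF \<open>enat k < p\<close> that] by (simp add: M)
    then show "\<exists>M'. (\<forall>x\<in>U. form_deriv_at x k M (M' x)) \<and>
        enat (Suc k) \<le> p \<and> q - 1 = p - enat (Suc k) \<and> M' = D (Suc k)"
      using R \<open>enat (Suc k) \<le> p\<close> enat_diff_Suc[of p k] by blast
  qed
  then show "Cp_form U p 0 (\<lambda>x _. g x)"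
    by (rule Cp_form_cong[OF _ U order_refl]) (simp add: D(1))
next
  assume g: "Cp_form U p 0 (\<lambda>x _. g x)"
  \<comment> \<open>Dependent choice collects the successive derivatives into one sequence; beyond
    order \<open>p\<close> the implications are vacuous and \<open>D k\<close> is arbitrary.\<close>
  have "\<exists>D. \<forall>k. ((k = 0 \<longrightarrow> D k = (\<lambda>x _. g x)) \<and> (enat k \<le> p \<longrightarrow> Cp_form U (p - enat k) k (D k))) \<and>
      (enat k < p \<longrightarrow> (\<forall>x\<in>U. form_deriv_at x k (D k) (D (Suc k) x)))"
    proof (rule dependent_nat_choice)
      show "\<exists>M. (0 = (0::nat) \<longrightarrow> M = (\<lambda>x _. g x)) \<and> (enat 0 \<le> p \<longrightarrow> Cp_form U (p - enat 0) 0 M)"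
        using g by (simp add: zero_enat_def[symmetric])
    next
      fix M and k :: nat
      assume M: "(k = 0 \<longrightarrow> M = (\<lambda>x _. g x)) \<and> (enat k \<le> p \<longrightarrow> Cp_form U (p - enat k) k M)"
      show "\<exists>M'. ((Suc k = 0 \<longrightarrow> M' = (\<lambda>x _. g x)) \<and>
          (enat (Suc k) \<le> p \<longrightarrow> Cp_form U (p - enat (Suc k)) (Suc k) M')) \<and>
          (enat k < p \<longrightarrow> (\<forall>x\<in>U. form_deriv_at x k M (M' x)))"
      proof (cases "enat k < p")
        case True
        then have "Cp_form U (p - enat k) k M" "p - enat k \<noteq> 0"
          using M enat_diff_ne_0 by auto
        from Cp_form_deriv[OF this] obtain M' where
          "\<And>x. x \<in> U \<Longrightarrow> form_deriv_at x k M (M' x)" "Cp_form U (p - enat k - 1) (Suc k) M'"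
          by blast
        then show ?thesis
          unfolding enat_diff_Suc by blast
      next
        case False
        then show ?thesis
          by (simp add: Suc_ile_eq)
      qed
    qed
  then obtain D where *: "\<And>k. ((k = 0 \<longrightarrow> D k = (\<lambda>x _. g x)) \<and>
      (enat k \<le> p \<longrightarrow> Cp_form U (p - enat k) k (D k))) \<and>
      (enat k < p \<longrightarrow> (\<forall>x\<in>U. form_deriv_at x k (D k) (D (Suc k) x)))"
    by (elim exE) (rule that, erule spec)
  have D: "D 0 = (\<lambda>x _. g x)" "\<And>k. enat k \<le> p \<Longrightarrow> Cp_form U (p - enat k) k (D k)"
    "\<And>k x. enat k < p \<Longrightarrow> x \<in> U \<Longrightarrow> form_deriv_at x k (D k) (D (Suc k) x)"
    using * by blast+
  have ml: "multilin k (D k x)" if "enat k \<le> p" "x \<in> U" for k x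
    using Cp_form_multilin[OF D(2)] that by blast
  have "((\<lambda>y. mnorm k (\<lambda>vs. D k y vs - D k x vs)) \<longlongrightarrow> 0) (at x within U)" if "enat k \<le> p" "x \<in> U" for k x
    using form_cont_at_iff_mnorm[where M = "D k", OF U that(2) ml[OF that(1)]]
      Cp_form_cont[OF D(2)[OF that(1)] that(2)] by simp
  moreover have "((\<lambda>h. mnorm k (\<lambda>vs. D k (x + h) vs - D k x vs - D (Suc k) x (h # vs)) / norm h) \<longlongrightarrow> 0) (at 0)"
    if "enat k < p" "x \<in> U" for k x
  proof -
    have "enat k \<le> p" "enat (Suc k) \<le> p"
      using that(1) by (auto simp: Suc_ile_eq)
    then show ?thesis
      using form_deriv_at_iff_mnorm[where M = "D k" and L = "D (Suc k) x", OF U that(2) ml ml] D(3)[OF that] that(2)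
      by simp
  qed
  ultimately show "Cp_on p U g"
    unfolding Cp_on_def using D(1) ml by (intro exI[of _ D]) auto
qed

section \<open>Smooth functions on open subsets of Banach spaces\<close>

lemma poly_div_exp_tendsto_0: "((\<lambda>x::real. poly P x / exp x) \<longlongrightarrow> 0) at_top"
proof -
  have "((\<lambda>x::real. \<Sum>i\<le>degree P. coeff P i * (x ^ i / exp x)) \<longlongrightarrow> (\<Sum>i\<le>degree P. coeff P i * 0)) at_top"
    by (intro tendsto_intros tendsto_power_div_exp_0)
  then show ?thesis
    by (simp add: poly_altdef sum_divide_distrib)
qed

text \<open>The classical function \<open>exp (- 1 / t)\<close>, extended by 0, with a polynomial
  factor in \<open>1 / t\<close> so that the family contains its own derivatives.\<close>

definition flat :: "real poly \<Rightarrow> real \<Rightarrow> real" where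
  "flat P t = (if t > 0 then poly P (1 / t) * exp (- 1 / t) else 0)"

text \<open>For positive \<open>t\<close> both factors contribute a factor \<open>1 / t^2\<close>,
  with coefficient \<open>P\<close> from the exponential and minus the derivative of
  \<open>P\<close> from the polynomial.\<close>

lemma flat_deriv: "(flat P has_real_derivative flat (monom 1 2 * (P - pderiv P)) t) (at t)"
proof (cases t "0::real" rule: linorder_cases)
  case greater
  have "((\<lambda>t. poly P (1 / t) * exp (- 1 / t)) has_real_derivative
      flat (monom 1 2 * (P - pderiv P)) t) (at t)"
    using greater
    by (auto intro!: derivative_eq_intros simp: flat_def poly_monom power2_eq_square field_simps)
  then show ?thesis
    by (rule has_field_derivative_transform_within_open[where S = "{0<..}"])
      (use greater in \<open>auto simp: flat_def\<close>)
next
  case less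
  have "((\<lambda>t. 0) has_real_derivative 0) (at t)"
    by simp
  then have "(flat P has_real_derivative 0) (at t)"
    by (rule has_field_derivative_transform_within_open[where S = "{..<0}"])
      (use less in \<open>auto simp: flat_def\<close>)
  then show ?thesis
    using less by (simp add: flat_def)
next
  case equal
  \<comment> \<open>With \<open>s = 1 / h\<close> the difference quotient at 0 from the right
    becomes \<open>s * poly P s / exp s\<close>; \<open>pCons 0 P\<close> is the polynomial
    \<open>P\<close> times the variable.\<close>
  have "((\<lambda>s. poly (pCons 0 P) s / exp s) \<longlongrightarrow> 0) at_top"
    by (rule poly_div_exp_tendsto_0)
  moreover have "\<forall>\<^sub>F s in at_top. poly (pCons 0 P) s / exp s = flat P (inverse s) / inverse s"
    using eventually_gt_at_top[of "0::real"]
    by eventually_elim (simp add: flat_def exp_minus field_simps)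
  ultimately have "((\<lambda>s. flat P (inverse s) / inverse s) \<longlongrightarrow> 0) at_top"
    by (rule Lim_transform_eventually)
  then have "((\<lambda>h. flat P h / h) \<longlongrightarrow> 0) (at_right 0)"
    by (simp add: filterlim_at_right_to_top)
  moreover have "((\<lambda>h. flat P h / h) \<longlongrightarrow> 0) (at_left 0)"
  proof (rule tendsto_eventually)
    show "\<forall>\<^sub>F h in at_left 0. flat P h / h = 0"
      by (auto simp: eventually_at_filter flat_def)
  qed
  ultimately have "((\<lambda>h. flat P h / h) \<longlongrightarrow> 0) (at 0)"
    by (rule filterlim_split_at[rotated])
  then show ?thesis
    using equal by (simp add: DERIV_def flat_def)
qed

lemma smooth_flat: "smooth_real (flat P)"
  unfolding smooth_real_def
  by (rule exI[of _ "\<lambda>n. flat (((\<lambda>P. monom 1 2 * (P - pderiv P)) ^^ n) P)"]) (simp add: flat_deriv)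

lemma flat_1_le: "flat 1 t \<le> 1" "flat 1 t \<ge> 0"
  by (auto simp: flat_def)

lemma flat_1_mono: "0 < s \<Longrightarrow> s \<le> t \<Longrightarrow> flat 1 s \<le> flat 1 t"
  by (auto simp: flat_def frac_le)

section \<open>Verification of \<open>adequate\<close> under condition (b)\<close>

lemma cond_b_adequate:
  fixes A :: "('a::metric_space \<Rightarrow> real) set"
  assumes A: "cond_b TYPE('e::banach) A"
  shows "adequate A"
proof -
  obtain e :: "'a \<Rightarrow> 'e" and U p where U: "open U" and e: "bij_betw e UNIV U"
    and iso': "\<forall>x y. dist x y = dist (e x) (e y)" and supp: "supports_Cp_bump TYPE('e) p"
    and A_cases: "A = {f. \<exists>g. Cp_on p U g \<and> f = g \<circ> e} \<or>
      A = {f. \<exists>g. Cp_on p U g \<and> f = g \<circ> e} \<inter> bounded_funs"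
    using A unfolding cond_b_def by (elim exE conjE) (rule that)
  note iso = iso'[rule_format]
  define F where "F = {f. \<exists>g. Cp_on p U g \<and> f = g \<circ> e}"
  define i where "i = inv_into UNIV e"
  have ie: "i (e x) = x" for x
    using e unfolding i_def by (simp add: bij_betw_def)
  have ei: "e (i u) = u" if "u \<in> U" for u
    using e that unfolding i_def by (simp add: bij_betw_def f_inv_into_f)
  have eU: "e x \<in> U" for x
    using e by (auto simp: bij_betw_def)
  have F_iff: "f \<in> F \<longleftrightarrow> Cp_form U p 0 (\<lambda>u _. f (i u))" for f
  proof
    assume "f \<in> F"
    then obtain g where g: "Cp_on p U g" "f = g \<circ> e"
      by (auto simp: F_def)
    then have "Cp_form U p 0 (\<lambda>u _. g u)"
      by (simp add: Cp_on_iff_Cp_form[OF U])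
    then show "Cp_form U p 0 (\<lambda>u _. f (i u))"
      by (rule Cp_form_cong[OF _ U order_refl]) (simp add: g(2) ei)
  next
    assume "Cp_form U p 0 (\<lambda>u _. f (i u))"
    then have "Cp_on p U (f \<circ> i)"
      by (simp add: Cp_on_iff_Cp_form[OF U])
    moreover have "f = (f \<circ> i) \<circ> e"
      by (auto simp: ie)
    ultimately show "f \<in> F"
      unfolding F_def by blast
  qed
  have A_iff: "A = F \<or> A = F \<inter> bounded_funs"
    using A_cases by (simp add: F_def)
  have "continuous_on UNIV e"
    unfolding continuous_on_iff by (auto simp: iso[symmetric])
  have "continuous_on U i"
    unfolding continuous_on_iff by (auto simp: iso ei)

  have F_const: "(\<lambda>_. c) \<in> F" for c
    unfolding F_iff by (rule Cp_form_const) simp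
  have F_add: "(\<lambda>x. f x + g x) \<in> F" if "f \<in> F" "g \<in> F" for f g
    using Cp_form_add[of U p 0 "\<lambda>u _. f (i u)" "\<lambda>u _. g (i u)"] that by (simp add: F_iff)
  have F_mult: "(\<lambda>x. f x * g x) \<in> F" if "f \<in> F" "g \<in> F" for f g
    using Cp_form_mult[of U p "\<lambda>u. f (i u)" "\<lambda>u. g (i u)"] that by (simp add: F_iff)
  have F_comp: "(\<lambda>x. \<psi> (f x)) \<in> F" if "f \<in> F" "smooth_real \<psi>" for f \<psi>
    using Cp_form_comp[of U p "\<lambda>u. f (i u)" \<psi>] that by (simp add: F_iff)
  have F_continuous: "continuous_on UNIV f" if "f \<in> F" for f
  proof -
    have "isCont (\<lambda>u. f (i u)) u" if "u \<in> U" for u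
      using Cp_form_cont[OF \<open>f \<in> F\<close>[unfolded F_iff] that] by (simp add: form_cont_at_0_iff)
    then have "continuous_on U (\<lambda>u. f (i u))"
      using U by (simp add: continuous_on_eq_continuous_at)
    then have "continuous_on UNIV (\<lambda>x. f (i (e x)))"
      using \<open>continuous_on UNIV e\<close> eU by (intro continuous_on_compose2[of U "\<lambda>u. f (i u)" UNIV e]) auto
    then show ?thesis
      by (simp add: ie)
  qed
  have F_local: "Aloc F \<subseteq> F"
  proof
    fix f assume f: "f \<in> Aloc F"
    show "f \<in> F"
      unfolding F_iff
    proof (rule Cp_form_local)
      fix u assume "u \<in> U"
      obtain W g where W: "open W" "i u \<in> W" "g \<in> F" "\<And>x. x \<in> W \<Longrightarrow> f x = g x"
        using f unfolding Aloc_def by blast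
      define V where "V = U \<inter> i -` W"
      have V: "open V" "u \<in> V" "V \<subseteq> U"
        using continuous_open_preimage[OF \<open>continuous_on U i\<close> U W(1)] \<open>u \<in> U\<close> W(2)
        by (auto simp: V_def)
      have "Cp_form V p 0 (\<lambda>u _. f (i u))"
        by (rule Cp_form_cong[OF W(3)[unfolded F_iff] V(1,3)]) (simp add: V_def W(4))
      with V show "\<exists>V. open V \<and> u \<in> V \<and> V \<subseteq> U \<and> Cp_form V p 0 (\<lambda>u _. f (i u))"
        by blast
    qed
  qed

  have b_add: "(\<lambda>x. f x + g x) \<in> bounded_funs" if "f \<in> bounded_funs" "g \<in> bounded_funs" for f g :: "'a \<Rightarrow> real"
    using that by (auto simp: bounded_funs_def intro: bounded_plus_comp)
  have b_mult: "(\<lambda>x. f x * g x) \<in> bounded_funs" if fg: "f \<in> bounded_funs" "g \<in> bounded_funs" for f g :: "'a \<Rightarrow> real"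
  proof -
    obtain B C where "\<And>x. \<bar>f x\<bar> \<le> B" "\<And>x. \<bar>g x\<bar> \<le> C"
      using fg by (auto simp: bounded_funs_def bounded_iff)
    then have "\<bar>f x * g x\<bar> \<le> B * C" for x
      unfolding abs_mult by (intro mult_mono) (auto intro: order_trans[OF abs_ge_zero])
    then show ?thesis
      by (auto simp: bounded_funs_def bounded_iff)
  qed
  have b_const: "(\<lambda>_. c) \<in> bounded_funs" for c
    by (auto simp: bounded_funs_def bounded_iff)
  have add: "(\<lambda>x. f x + g x) \<in> A" if "f \<in> A" "g \<in> A" for f g
    using A_iff that F_add b_add by blast
  have mult: "(\<lambda>x. f x * g x) \<in> A" if "f \<in> A" "g \<in> A" for f g
    using A_iff that F_mult b_mult by blast
  have const: "(\<lambda>_. c) \<in> A" for c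
    using A_iff F_const b_const by blast
  have flat_in: "(\<lambda>x. flat 1 (f x)) \<in> A" if "f \<in> F" for f
  proof -
    have "(\<lambda>x. flat 1 (f x)) \<in> bounded_funs"
      by (auto simp: bounded_funs_def bounded_iff flat_1_le intro!: exI[of _ 1])
    then show ?thesis
      using A_iff F_comp[OF that smooth_flat[of 1]] by blast
  qed
  have "A \<subseteq> F"
    using A_iff by blast
  have subspace: "is_subspace_fun A"
    unfolding is_subspace_fun_def using add const mult[OF const] by blast
  have bump: "\<exists>b\<in>A. b x = 1 \<and> (\<forall>y. 0 \<le> b y \<and> b y \<le> 3) \<and> (\<forall>y. y \<notin> W \<longrightarrow> b y = 0)"
    if W: "open W" "x \<in> W" for W x
  proof -
    obtain \<phi> :: "'e \<Rightarrow> real" where \<phi>: "Cp_on p UNIV \<phi>" "\<phi> 0 \<noteq> 0" "bounded {x. \<phi> x \<noteq> 0}"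
      using supp unfolding supports_Cp_bump_def by blast
    obtain R where R: "R > 0" "\<And>v. \<phi> v \<noteq> 0 \<Longrightarrow> norm v \<le> R"
      using \<phi>(3) by (auto simp: bounded_pos)
    obtain r where r: "r > 0" "ball x r \<subseteq> W"
      using W by (meson openE)
    \<comment> \<open>Outside \<open>ball x r\<close> the argument of \<open>\<phi>\<close> has norm
      at least \<open>t * r = R + 1\<close>, beyond the radius \<open>R\<close> outside which
      \<open>\<phi>\<close> vanishes.\<close>
    define t where "t = (R + 1) / r"
    define f where "f y = inverse (\<phi> 0) * \<phi> (t *\<^sub>R (e y - e x))" for y
    have "t > 0"
      using R(1) r(1) by (simp add: t_def)
    have "Cp_form UNIV p 0 (\<lambda>v _. \<phi> v)"
      using \<phi>(1) by (simp add: Cp_on_iff_Cp_form)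
    from Cp_form_affine[OF this \<open>t > 0\<close>, of "inverse (\<phi> 0)" "e x"]
    have "Cp_form U p 0 (\<lambda>u _. f (i u))"
      by (rule Cp_form_cong[OF _ U]) (auto simp: f_def ei)
    then have "f \<in> F"
      by (simp add: F_iff)
    \<comment> \<open>\<open>\<phi>\<close> may change sign and be unbounded. Composition with
      \<open>flat 1\<close> removes both defects and keeps the zeros, and the factor
      \<open>exp 1\<close> restores the value 1 at \<open>x\<close>, since \<open>f x = 1\<close>
      and \<open>flat 1 1 = exp (- 1)\<close>.\<close>
    define b where "b y = exp 1 * flat 1 (f y)" for y
    have "b \<in> A"
      unfolding b_def by (intro mult const flat_in \<open>f \<in> F\<close>)
    moreover have "b x = 1"
      using \<phi>(2) by (simp add: b_def f_def flat_def exp_minus)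
    moreover have "0 \<le> b y" "b y \<le> 3" for y
    proof -
      have "exp 1 * flat 1 (f y) \<le> 3 * 1"
        using exp_le flat_1_le by (intro mult_mono) auto
      then show "b y \<le> 3"
        by (simp add: b_def)
      show "0 \<le> b y"
        by (simp add: b_def flat_1_le)
    qed
    moreover have "b y = 0" if "y \<notin> W" for y
    proof -
      have "y \<notin> ball x r"
        using that r(2) by blast
      then have "r \<le> norm (e y - e x)"
        using iso[of x y] by (auto simp: dist_norm norm_minus_commute not_less)
      then have "t * r \<le> norm (t *\<^sub>R (e y - e x))"
        using \<open>t > 0\<close> by simp
      then have "R < norm (t *\<^sub>R (e y - e x))"
        using r(1) by (simp add: t_def)
      then have "\<phi> (t *\<^sub>R (e y - e x)) = 0"
        using R(2) by (meson not_le)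
      then show ?thesis
        by (simp add: b_def f_def flat_def)
    qed
    ultimately show ?thesis by blast
  qed
  show ?thesis
  proof unfold_locales
    show "is_subspace_fun A"
      by (rule subspace)
    show "contains_constants A"
      using const by (simp add: contains_constants_def)
    show "continuous_on UNIV f" if "f \<in> A" for f
      using F_continuous \<open>A \<subseteq> F\<close> that by blast
    show "\<exists>b\<in>A. b x = 1 \<and> (\<forall>y. 0 \<le> b y \<and> b y \<le> 3) \<and> (\<forall>y. y \<notin> W \<longrightarrow> b y = 0)"
      if "open W" "x \<in> W" for W x
      using that by (rule bump)
    show "\<exists>k\<in>A. (\<forall>x. 0 \<le> k x \<and> f x \<le> \<epsilon> + k x) \<and> (\<forall>x. f x \<le> 0 \<longrightarrow> k x = 0)"
      if f: "f \<in> A" and "\<epsilon> > 0" for f \<epsilon>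
    proof -
      \<comment> \<open>Where \<open>f x > \<epsilon>\<close>, the quotient of the flat values is at
        least 1 and \<open>f x * f x + 1\<close> already exceeds \<open>f x\<close>; elsewhere
        \<open>\<epsilon>\<close> alone bounds \<open>f x\<close>.\<close>
      define k where "k x = (f x * f x + 1) * (inverse (flat 1 \<epsilon>) * flat 1 (f x))" for x
      have pos: "flat 1 \<epsilon> > 0"
        using \<open>\<epsilon> > 0\<close> by (simp add: flat_def)
      have "k \<in> A"
        unfolding k_def using f \<open>A \<subseteq> F\<close> by (intro mult add const flat_in) auto
      moreover have "0 \<le> k x" for x
        using pos by (simp add: k_def flat_1_le)
      moreover have "f x \<le> \<epsilon> + k x" for x
      proof (cases "f x \<le> \<epsilon>")
        case True
        then show ?thesis
          using \<open>0 \<le> k x\<close> by simp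
      next
        case False
        have "0 \<le> (f x - 1/2)\<^sup>2"
          by simp
        then have "f x \<le> f x * f x + 1"
          by (simp add: power2_eq_square algebra_simps)
        also have "\<dots> = (f x * f x + 1) * (inverse (flat 1 \<epsilon>) * flat 1 \<epsilon>)"
          using pos by simp
        also have "\<dots> \<le> k x"
          unfolding k_def using False \<open>\<epsilon> > 0\<close> pos flat_1_mono[of \<epsilon> "f x"]
          by (intro mult_left_mono) auto
        finally show ?thesis
          using \<open>\<epsilon> > 0\<close> by simp
      qed
      moreover have "k x = 0" if "f x \<le> 0" for x
        using that by (simp add: k_def flat_def)
      ultimately show ?thesis by blast
    qed
    fix g :: "'a \<Rightarrow> real" and X :: "nat \<Rightarrow> 'a"
    assume g: "g \<in> A" "\<And>x. 1 \<le> g x" and X: "\<nexists>l r. strict_mono (r::nat \<Rightarrow> nat) \<and> (X \<circ> r) \<longlonglongrightarrow> l"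
    \<comment> \<open>Being \<open>C^p\<close> is a local property, so both variants of
      \<open>A\<close> have the form required by \<open>local_oscillation\<close>.\<close>
    have "B \<subseteq> Aloc B" for B :: "('a \<Rightarrow> real) set"
      unfolding Aloc_def by (auto intro!: exI[of _ UNIV])
    moreover have "Aloc A \<subseteq> Aloc F"
      using \<open>A \<subseteq> F\<close> unfolding Aloc_def by blast
    ultimately have "A = Aloc A \<or> A = Aloc A \<inter> bounded_funs"
      using A_iff F_local by blast
    from local_oscillation[OF this subspace bump g X]
    show "\<exists>f\<in>A. (\<exists>\<^sub>\<infinity>n. f (X n) \<ge> 3/4 * g (X n)) \<and> (\<exists>\<^sub>\<infinity>n. f (X n) \<le> 1/4 * g (X n))"
      by blast
  qed
qed

theorem theorem4p5:
  fixes AX :: "('a::metric_space \<Rightarrow> real) set"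
    and AY :: "('b::metric_space \<Rightarrow> real) set"
    and T :: "('a \<Rightarrow> real) \<Rightarrow> ('b \<Rightarrow> real)"
  assumes "cond_a AX \<or> cond_b TYPE('e::banach) AX"
    and "cond_a AY \<or> cond_b TYPE('f::banach) AY"
    and "order_iso AX AY T"
  shows "\<exists>h k. homeomorphism UNIV UNIV h k \<and>
     (\<forall>f\<in>AX. T f = (\<lambda>y. T (\<lambda>_. 1) y * f (k y))) \<and>
     (\<forall>g\<in>AY. inv_into AX T g = (\<lambda>x. inv_into AX T (\<lambda>_. 1) x * g (h x)))"
proof -
  interpret X: adequate AX
    using assms(1) cond_a_adequate cond_b_adequate by blast
  interpret Y: adequate AY
    using assms(2) cond_a_adequate cond_b_adequate by blast
  interpret order_isomorphism AX AY T
    by unfold_locales (rule assms(3))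
  show ?thesis
    by (rule weighted_composition)
qed

end
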